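(* Let $(M,g)$ be a connected quaternionic-Kähler manifold of dimension $4n\geq 8$ with non-zero scalar curvature, and let $\nu$ be its reduced scalar curvature. The map $$\mathcal C_{2}(M)\ni\psi\mapsto u:=\psi^{S^{2}E}$$ is an isomorphism from the vector space $\mathcal C_{2}(M)$ of compatible conformal-Killing $2$-forms on $(M,g)$ to the vector space of (real) sections $u$ of $S^{2}E$ which satisfy $$\nabla_{Y}u=\frac{1}{4n-1}\Big( X\wedge Y+\sum_{i=1}^{3}J_{i}X\wedge J_{i}Y\Big),\qquad\forall\, Y\in TM,$$ where $X$ is a vector field on $M$ (necessarily equal to $\frac{4n-1}{4n+2}\delta u$) and $\{J_{1},J_{2},J_{3}\}$ is a (local) admissible basis of $Q$. The inverse is the map $$u\mapsto \psi:=u-\frac{1}{(2n+1)\nu}(\nabla\delta u)^{S^{2}H}.$$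
   Context: A quaternionic-Kähler manifold is a Riemannian manifold $(M,g)$ of dimension $4n\geq 8$ with holonomy group included in $\mathrm{Sp}(1)\mathrm{Sp}(n)$; equivalently, there is a rank three sub-bundle $Q\subset \mathrm{End}(TM)$, preserved by the Levi-Civita connection $\nabla$ of $g$, locally generated by three anti-commuting $g$-orthogonal almost complex structures $J_1,J_2,J_3$ with $J_3=J_1J_2$ (a local admissible basis of $Q$), with Kähler forms $\omega_i:=g(J_i\cdot,\cdot)$. The metric $g$ is Einstein; its reduced scalar curvature is $\nu:=\frac{k}{4n(n+2)}$, where $k$ is the scalar curvature. Tangent vectors are identified with $1$-forms using $g$; $(X\wedge Y)(Z,V)=g(X,Z)g(Y,V)-g(X,V)g(Y,Z)$. For a vector field $X$, $(\nabla X)(Y,Z)=g(\nabla_YX,Z)$. As real bundles, $S^2H\subset\Lambda^2(M)$ is the bundle spanned locally by $\omega_1,\omega_2,\omega_3$, and $S^2E\subset\Lambda^2(M)$ is the bundle of $2$-forms $\psi$ with $\psi(J_i\cdot,J_i\cdot)=\psi$ for $i=1,2,3$. The projections of $\psi$ are $\psi^{S^2H}=\frac1{4n}\sum_{i,k}\psi(e_k,J_ie_k)\omega_i$ and $\psi^{S^2E}=\frac14\big(\psi+\sum_{i=1}^3\psi(J_i\cdot,J_i\cdot)\big)$, where $\{e_k\}$ is a local orthonormal frame. A $2$-form is compatible if it is a section of $S^2H\oplus S^2E$. A $2$-form $\psi$ on $(M,g)$ is conformal-Killing if $\nabla_Y\psi=\frac13 i_Yd\psi-\frac{1}{4n-1}Y\wedge\delta\psi$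 for all $Y\in TM$, where $\delta\psi=-\sum_k i_{e_k}\nabla_{e_k}\psi$ is the codifferential. *)

theory Defs
  imports "HOL-Analysis.Analysis"
begin

section \<open>Smooth manifolds\<close>

text \<open>Smooth maps on open subsets of a Euclidean space.\<close>

primrec k_smooth_on :: "nat \<Rightarrow> 'v::euclidean_space set \<Rightarrow> ('v \<Rightarrow> 'w::real_normed_vector) \<Rightarrow> bool" where
  "k_smooth_on 0 S f \<longleftrightarrow> continuous_on S f"
| "k_smooth_on (Suc k) S f \<longleftrightarrow>
     (\<forall>x\<in>S. f differentiable (at x)) \<and>
     (\<forall>v. k_smooth_on k S (\<lambda>x. frechet_derivative f (at x) v))"

definition smooth_on :: "'v::euclidean_space set \<Rightarrow> ('v \<Rightarrow> 'w::real_normed_vector) \<Rightarrow> bool" where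
  "smooth_on S f \<longleftrightarrow> (\<forall>k. k_smooth_on k S f)"

text \<open>
  A manifold is the universe of a type \<open>'a\<close> with an atlas modelled on the Euclidean space \<open>'v\<close>.
  Atlases are indexed by the points of the manifold in such a way that the chart with index \<open>p\<close>
  is defined around \<open>p\<close>; every smooth structure is given by such an atlas. The tangent space at
  \<open>p\<close> is identified with \<open>'v\<close> by means of the chart with index \<open>p\<close>. Hence vector fields,
  fields of endomorphisms and covariant 2-tensor fields have the types \<open>'a \<Rightarrow> 'v\<close>,
  \<open>'a \<Rightarrow> 'v \<Rightarrow> 'v\<close> and \<open>'a \<Rightarrow> 'v \<Rightarrow> 'v \<Rightarrow> real\<close>, and their smoothness has to be
  tested after a change to the coordinates of one fixed chart.
\<close>

type_synonym ('a, 'v) atlas = "'a \<Rightarrow> 'a set \<times> ('a \<Rightarrow> 'v)"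
type_synonym ('a, 'v) vfield = "'a \<Rightarrow> 'v"
type_synonym ('a, 'v) endofield = "'a \<Rightarrow> 'v \<Rightarrow> 'v"
type_synonym ('a, 'v) tensor2 = "'a \<Rightarrow> 'v \<Rightarrow> 'v \<Rightarrow> real"

definition cdom :: "('a, 'v) atlas \<Rightarrow> 'a \<Rightarrow> 'a set" where
  "cdom \<kappa> c = fst (\<kappa> c)"

definition crd :: "('a, 'v) atlas \<Rightarrow> 'a \<Rightarrow> 'a \<Rightarrow> 'v" where
  "crd \<kappa> c = snd (\<kappa> c)"

definition crd_inv :: "('a, 'v) atlas \<Rightarrow> 'a \<Rightarrow> 'v \<Rightarrow> 'a" where
  "crd_inv \<kappa> c = inv_into (cdom \<kappa> c) (crd \<kappa> c)"

definition smooth_atlas :: "('a::topological_space, 'v::euclidean_space) atlas \<Rightarrow> bool" where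
  "smooth_atlas \<kappa> \<longleftrightarrow>
     (\<forall>c. c \<in> cdom \<kappa> c \<and> open (cdom \<kappa> c) \<and> open (crd \<kappa> c ` cdom \<kappa> c) \<and>
          homeomorphism (cdom \<kappa> c) (crd \<kappa> c ` cdom \<kappa> c) (crd \<kappa> c) (crd_inv \<kappa> c)) \<and>
     (\<forall>c d. smooth_on (crd \<kappa> c ` (cdom \<kappa> c \<inter> cdom \<kappa> d)) (crd \<kappa> d \<circ> crd_inv \<kappa> c))"

text \<open>
  \<open>tr \<kappa> c d q\<close> converts the components of a vector at \<open>q\<close> from the chart \<open>c\<close> to the chart \<open>d\<close>.
  So \<open>tr \<kappa> q c q v\<close> are the components of \<open>v \<in> T\<^sub>qM\<close> in the chart \<open>c\<close>, and
  \<open>cfield \<kappa> c w\<close> is the coordinate vector field on \<open>cdom \<kappa> c\<close> with constant components \<open>w\<close>.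
\<close>

definition tr :: "('a, 'v::euclidean_space) atlas \<Rightarrow> 'a \<Rightarrow> 'a \<Rightarrow> 'a \<Rightarrow> 'v \<Rightarrow> 'v" where
  "tr \<kappa> c d q = frechet_derivative (crd \<kappa> d \<circ> crd_inv \<kappa> c) (at (crd \<kappa> c q))"

definition cfield :: "('a, 'v::euclidean_space) atlas \<Rightarrow> 'a \<Rightarrow> 'v \<Rightarrow> ('a, 'v) vfield" where
  "cfield \<kappa> c w = (\<lambda>q. tr \<kappa> c q q w)"

definition smooth_in_chart ::
    "('a, 'v::euclidean_space) atlas \<Rightarrow> 'a \<Rightarrow> 'a set \<Rightarrow> ('a \<Rightarrow> 'w::real_normed_vector) \<Rightarrow> bool" where
  "smooth_in_chart \<kappa> c U f \<longleftrightarrow>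
     smooth_on (crd \<kappa> c ` (U \<inter> cdom \<kappa> c)) (f \<circ> crd_inv \<kappa> c)"

definition smooth_function :: "('a, 'v::euclidean_space) atlas \<Rightarrow> 'a set \<Rightarrow> ('a \<Rightarrow> real) \<Rightarrow> bool" where
  "smooth_function \<kappa> U f \<longleftrightarrow> (\<forall>c. smooth_in_chart \<kappa> c U f)"

definition smooth_vfield ::
    "('a, 'v::euclidean_space) atlas \<Rightarrow> 'a set \<Rightarrow> ('a, 'v) vfield \<Rightarrow> bool" where
  "smooth_vfield \<kappa> U X \<longleftrightarrow> (\<forall>c. smooth_in_chart \<kappa> c U (\<lambda>q. tr \<kappa> q c q (X q)))"

definition smooth_endofield ::
    "('a, 'v::euclidean_space) atlas \<Rightarrow> 'a set \<Rightarrow> ('a, 'v) endofield \<Rightarrow> bool" where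
  "smooth_endofield \<kappa> U A \<longleftrightarrow>
     (\<forall>q\<in>U. linear (A q)) \<and>
     (\<forall>c w. smooth_in_chart \<kappa> c U (\<lambda>q. tr \<kappa> q c q (A q (cfield \<kappa> c w q))))"

definition smooth_tensor2 ::
    "('a, 'v::euclidean_space) atlas \<Rightarrow> 'a set \<Rightarrow> ('a, 'v) tensor2 \<Rightarrow> bool" where
  "smooth_tensor2 \<kappa> U B \<longleftrightarrow>
     (\<forall>q\<in>U. bilinear (B q)) \<and>
     (\<forall>c w z. smooth_in_chart \<kappa> c U (\<lambda>q. B q (cfield \<kappa> c w q) (cfield \<kappa> c z q)))"

definition two_form :: "('a, 'v::euclidean_space) atlas \<Rightarrow> ('a, 'v) tensor2 \<Rightarrow> bool" where
  "two_form \<kappa> \<psi> \<longleftrightarrow> smooth_tensor2 \<kappa> UNIV \<psi> \<and> (\<forall>p v w. \<psi> p v w = - \<psi> p w v)"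

text \<open>The derivative \<open>v(f)\<close> of a function \<open>f\<close> in the direction \<open>v \<in> T\<^sub>pM\<close>.\<close>

definition ddir :: "('a, 'v::euclidean_space) atlas \<Rightarrow> ('a \<Rightarrow> real) \<Rightarrow> 'a \<Rightarrow> 'v \<Rightarrow> real" where
  "ddir \<kappa> f p v = frechet_derivative (f \<circ> crd_inv \<kappa> p) (at (crd \<kappa> p p)) v"

text \<open>
  The exterior derivative of a 2-form, computed at \<open>p\<close> with coordinate fields of the chart \<open>p\<close>
  (whose brackets vanish).
\<close>

definition ext_deriv ::
    "('a, 'v::euclidean_space) atlas \<Rightarrow> ('a, 'v) tensor2 \<Rightarrow> 'a \<Rightarrow> 'v \<Rightarrow> 'v \<Rightarrow> 'v \<Rightarrow> real" where
  "ext_deriv \<kappa> \<psi> p x y z =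
     ddir \<kappa> (\<lambda>q. \<psi> q (cfield \<kappa> p y q) (cfield \<kappa> p z q)) p x +
     ddir \<kappa> (\<lambda>q. \<psi> q (cfield \<kappa> p z q) (cfield \<kappa> p x q)) p y +
     ddir \<kappa> (\<lambda>q. \<psi> q (cfield \<kappa> p x q) (cfield \<kappa> p y q)) p z"


section \<open>Riemannian metrics and the Levi-Civita connection\<close>

definition riemannian_metric :: "('a, 'v::euclidean_space) atlas \<Rightarrow> ('a, 'v) tensor2 \<Rightarrow> bool" where
  "riemannian_metric \<kappa> g \<longleftrightarrow>
     smooth_tensor2 \<kappa> UNIV g \<and> (\<forall>p v w. g p v w = g p w v) \<and> (\<forall>p v. v \<noteq> 0 \<longrightarrow> g p v v > 0)"

text \<open>
  A connection is an operator \<open>D\<close>, where \<open>D X p v\<close> stands for \<open>(\<nabla>\<^sub>vX)(p)\<close> and \<open>X\<close> is a vector field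
  that is defined and smooth on some open set containing \<open>p\<close>; there are no requirements on
  \<open>D X p\<close> if \<open>X\<close> is not smooth around \<open>p\<close>. By the Leibniz rule \<open>D X p\<close> depends only on the germ
  of \<open>X\<close> at \<open>p\<close>. In the condition on the torsion, \<open>[X, Y]\<close> is given by its action on functions.
\<close>

type_synonym ('a, 'v) connection = "('a, 'v) vfield \<Rightarrow> 'a \<Rightarrow> 'v \<Rightarrow> 'v"

definition affine_connection ::
    "('a::topological_space, 'v::euclidean_space) atlas \<Rightarrow> ('a, 'v) connection \<Rightarrow> bool" where
  "affine_connection \<kappa> D \<longleftrightarrow>
     (\<forall>U X. open U \<and> smooth_vfield \<kappa> U X \<longrightarrow>
        (\<forall>p\<in>U. linear (D X p)) \<and>
        (\<forall>Y. smooth_vfield \<kappa> U Y \<longrightarrow> smooth_vfield \<kappa> U (\<lambda>p. D X p (Y p))) \<and>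
        (\<forall>Y. smooth_vfield \<kappa> U Y \<longrightarrow>
           (\<forall>p\<in>U. \<forall>v. D (\<lambda>q. X q + Y q) p v = D X p v + D Y p v)) \<and>
        (\<forall>f. smooth_function \<kappa> U f \<longrightarrow>
           (\<forall>p\<in>U. \<forall>v. D (\<lambda>q. f q *\<^sub>R X q) p v = ddir \<kappa> f p v *\<^sub>R X p + f p *\<^sub>R D X p v)))"

definition torsion_free ::
    "('a::topological_space, 'v::euclidean_space) atlas \<Rightarrow> ('a, 'v) connection \<Rightarrow> bool" where
  "torsion_free \<kappa> D \<longleftrightarrow>
     (\<forall>U X Y f. open U \<and> smooth_vfield \<kappa> U X \<and> smooth_vfield \<kappa> U Y \<and> smooth_function \<kappa> U f \<longrightarrow>
        (\<forall>p\<in>U. ddir \<kappa> f p (D Y p (X p) - D X p (Y p)) =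
           ddir \<kappa> (\<lambda>q. ddir \<kappa> f q (Y q)) p (X p) - ddir \<kappa> (\<lambda>q. ddir \<kappa> f q (X q)) p (Y p)))"

definition metric_connection ::
    "('a::topological_space, 'v::euclidean_space) atlas \<Rightarrow> ('a, 'v) tensor2 \<Rightarrow> ('a, 'v) connection \<Rightarrow> bool"
  where
  "metric_connection \<kappa> g D \<longleftrightarrow>
     (\<forall>U X Y. open U \<and> smooth_vfield \<kappa> U X \<and> smooth_vfield \<kappa> U Y \<longrightarrow>
        (\<forall>p\<in>U. \<forall>v. ddir \<kappa> (\<lambda>q. g q (X q) (Y q)) p v =
           g p (D X p v) (Y p) + g p (X p) (D Y p v)))"

definition levi_civita ::
    "('a::topological_space, 'v::euclidean_space) atlas \<Rightarrow> ('a, 'v) tensor2 \<Rightarrow> ('a, 'v) connection \<Rightarrow> bool"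
  where
  "levi_civita \<kappa> g D \<longleftrightarrow> affine_connection \<kappa> D \<and> torsion_free \<kappa> D \<and> metric_connection \<kappa> g D"

text \<open>
  Covariant derivatives in the direction \<open>v \<in> T\<^sub>pM\<close> of an endomorphism field and of a covariant
  2-tensor field. They are tensorial in the remaining arguments \<open>w\<close>, \<open>z\<close>, which may
  therefore be extended by arbitrary vector fields; we take coordinate fields.
\<close>

definition covd_endo ::
    "('a, 'v::euclidean_space) atlas \<Rightarrow> ('a, 'v) connection \<Rightarrow> ('a, 'v) endofield \<Rightarrow> 'a \<Rightarrow> 'v \<Rightarrow> 'v \<Rightarrow> 'v"
  where
  "covd_endo \<kappa> D A p v w =
     D (\<lambda>q. A q (cfield \<kappa> p w q)) p v - A p (D (cfield \<kappa> p w) p v)"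

definition covd2 ::
    "('a, 'v::euclidean_space) atlas \<Rightarrow> ('a, 'v) connection \<Rightarrow> ('a, 'v) tensor2 \<Rightarrow>
      'a \<Rightarrow> 'v \<Rightarrow> 'v \<Rightarrow> 'v \<Rightarrow> real" where
  "covd2 \<kappa> D \<psi> p v w z =
     ddir \<kappa> (\<lambda>q. \<psi> q (cfield \<kappa> p w q) (cfield \<kappa> p z q)) p v
     - \<psi> p (D (cfield \<kappa> p w) p v) z - \<psi> p w (D (cfield \<kappa> p z) p v)"

text \<open>
  Pointwise metric notions; \<open>gp\<close> is an inner product on one tangent space. All the sums over
  \<open>onb gp\<close> below are independent of the orthonormal basis.
\<close>

definition orthonormal_basis :: "('v::euclidean_space \<Rightarrow> 'v \<Rightarrow> real) \<Rightarrow> 'v set \<Rightarrow> bool" where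
  "orthonormal_basis gp E \<longleftrightarrow>
     finite E \<and> card E = DIM('v) \<and> (\<forall>e\<in>E. \<forall>f\<in>E. gp e f = (if e = f then 1 else 0))"

definition onb :: "('v::euclidean_space \<Rightarrow> 'v \<Rightarrow> real) \<Rightarrow> 'v set" where
  "onb gp = (SOME E. orthonormal_basis gp E)"

definition sharp :: "('v \<Rightarrow> 'v \<Rightarrow> real) \<Rightarrow> ('v \<Rightarrow> real) \<Rightarrow> 'v" where
  "sharp gp \<alpha> = (THE x. \<forall>w. gp x w = \<alpha> w)"

definition wedge :: "('v \<Rightarrow> 'v \<Rightarrow> real) \<Rightarrow> 'v \<Rightarrow> 'v \<Rightarrow> 'v \<Rightarrow> 'v \<Rightarrow> real" where
  "wedge gp x y z v = gp x z * gp y v - gp x v * gp y z"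

text \<open>The codifferential of a 2-form, as a vector field.\<close>

definition codiff ::
    "('a, 'v::euclidean_space) atlas \<Rightarrow> ('a, 'v) tensor2 \<Rightarrow> ('a, 'v) connection \<Rightarrow> ('a, 'v) tensor2 \<Rightarrow>
      ('a, 'v) vfield" where
  "codiff \<kappa> g D \<psi> p = sharp (g p) (\<lambda>w. - (\<Sum>e\<in>onb (g p). covd2 \<kappa> D \<psi> p e e w))"

text \<open>
  \<open>curvature \<kappa> D p x y z\<close> is \<open>R(x,y)z\<close> with \<open>R(X,Y) = [\<nabla>\<^sub>X,\<nabla>\<^sub>Y] - \<nabla>\<^bsub>[X,Y]\<^esub>\<close>, so that round spheres
  have positive scalar curvature.
\<close>

definition curvature ::
    "('a, 'v::euclidean_space) atlas \<Rightarrow> ('a, 'v) connection \<Rightarrow> 'a \<Rightarrow> 'v \<Rightarrow> 'v \<Rightarrow> 'v \<Rightarrow> 'v" where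
  "curvature \<kappa> D p x y z =
     D (\<lambda>q. D (cfield \<kappa> p z) q (cfield \<kappa> p y q)) p x
     - D (\<lambda>q. D (cfield \<kappa> p z) q (cfield \<kappa> p x q)) p y"

definition ricci ::
    "('a, 'v::euclidean_space) atlas \<Rightarrow> ('a, 'v) tensor2 \<Rightarrow> ('a, 'v) connection \<Rightarrow> 'a \<Rightarrow> 'v \<Rightarrow> 'v \<Rightarrow> real"
  where
  "ricci \<kappa> g D p y z = (\<Sum>e\<in>onb (g p). g p (curvature \<kappa> D p e y z) e)"

definition scalar_curvature ::
    "('a, 'v::euclidean_space) atlas \<Rightarrow> ('a, 'v) tensor2 \<Rightarrow> ('a, 'v) connection \<Rightarrow> 'a \<Rightarrow> real" where
  "scalar_curvature \<kappa> g D p = (\<Sum>e\<in>onb (g p). ricci \<kappa> g D p e e)"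

definition conformal_killing ::
    "('a, 'v::euclidean_space) atlas \<Rightarrow> ('a, 'v) tensor2 \<Rightarrow> ('a, 'v) connection \<Rightarrow> ('a, 'v) tensor2 \<Rightarrow> bool"
  where
  "conformal_killing \<kappa> g D \<psi> \<longleftrightarrow> two_form \<kappa> \<psi> \<and>
     (\<forall>p y z w. covd2 \<kappa> D \<psi> p y z w =
        1 / 3 * ext_deriv \<kappa> \<psi> p y z w
        - 1 / (real DIM('v) - 1) * wedge (g p) y (codiff \<kappa> g D \<psi> p) z w)"


section \<open>Quaternionic-Kaehler structures\<close>

text \<open>
  An admissible basis of the fibre \<open>Qp\<close> of \<open>Q\<close> at one point is a triple \<open>I 1, I 2, I 3\<close>;
  the other values of \<open>I\<close> are irrelevant.
\<close>

definition admissible_triple ::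
    "('v::real_vector \<Rightarrow> 'v \<Rightarrow> real) \<Rightarrow> ('v \<Rightarrow> 'v) set \<Rightarrow> (nat \<Rightarrow> 'v \<Rightarrow> 'v) \<Rightarrow> bool" where
  "admissible_triple gp Qp I \<longleftrightarrow>
     (\<forall>i\<in>{1..3}. linear (I i) \<and> (\<forall>v. I i (I i v) = - v) \<and> (\<forall>v w. gp (I i v) (I i w) = gp v w)) \<and>
     (\<forall>i\<in>{1..3}. \<forall>j\<in>{1..3}. i \<noteq> j \<longrightarrow> (\<forall>v. I i (I j v) = - I j (I i v))) \<and>
     (\<forall>v. I 3 v = I 1 (I 2 v)) \<and>
     Qp = {A. \<exists>a :: nat \<Rightarrow> real. \<forall>v. A v = (\<Sum>i=1..3. a i *\<^sub>R I i v)}"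

definition admissible_basis ::
    "('a::topological_space, 'v::euclidean_space) atlas \<Rightarrow> ('a, 'v) tensor2 \<Rightarrow> ('a \<Rightarrow> ('v \<Rightarrow> 'v) set) \<Rightarrow>
      'a set \<Rightarrow> (nat \<Rightarrow> ('a, 'v) endofield) \<Rightarrow> bool" where
  "admissible_basis \<kappa> g Q U J \<longleftrightarrow>
     open U \<and> (\<forall>i\<in>{1..3}. smooth_endofield \<kappa> U (J i)) \<and>
     (\<forall>p\<in>U. admissible_triple (g p) (Q p) (\<lambda>i. J i p))"

definition parallel_subbundle ::
    "('a::topological_space, 'v::euclidean_space) atlas \<Rightarrow> ('a, 'v) connection \<Rightarrow>
      ('a \<Rightarrow> ('v \<Rightarrow> 'v) set) \<Rightarrow> bool" where
  "parallel_subbundle \<kappa> D Q \<longleftrightarrow>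
     (\<forall>U A. open U \<and> smooth_endofield \<kappa> U A \<and> (\<forall>p\<in>U. A p \<in> Q p) \<longrightarrow>
        (\<forall>p\<in>U. \<forall>v. covd_endo \<kappa> D A p v \<in> Q p))"

text \<open>The condition on the dimension is stated separately.\<close>

definition quaternionic_kaehler ::
    "('a::topological_space, 'v::euclidean_space) atlas \<Rightarrow> ('a, 'v) tensor2 \<Rightarrow> ('a, 'v) connection \<Rightarrow>
      ('a \<Rightarrow> ('v \<Rightarrow> 'v) set) \<Rightarrow> bool" where
  "quaternionic_kaehler \<kappa> g D Q \<longleftrightarrow>
     smooth_atlas \<kappa> \<and> riemannian_metric \<kappa> g \<and> levi_civita \<kappa> g D \<and>
     (\<forall>p. \<exists>U J. p \<in> U \<and> admissible_basis \<kappa> g Q U J) \<and> parallel_subbundle \<kappa> D Q"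

definition reduced_scalar_curvature ::
    "('a, 'v::euclidean_space) atlas \<Rightarrow> ('a, 'v) tensor2 \<Rightarrow> ('a, 'v) connection \<Rightarrow> nat \<Rightarrow> 'a \<Rightarrow> real" where
  "reduced_scalar_curvature \<kappa> g D n p =
     scalar_curvature \<kappa> g D p / (4 * real n * (real n + 2))"

text \<open>
  The fibres of \<open>S\<^sup>2H\<close> and \<open>S\<^sup>2E\<close> and the two projections, in terms of the inner product \<open>gp\<close> and the
  fibre \<open>Qp\<close> at one point. They do not depend on the admissible triple. The projection onto
  \<open>S\<^sup>2H\<close> makes sense for arbitrary bilinear forms (it factors through the skew part), and is
  applied below to \<open>\<nabla>X\<close>.
\<close>

definition S2H :: "('v::euclidean_space \<Rightarrow> 'v \<Rightarrow> real) \<Rightarrow> ('v \<Rightarrow> 'v) set \<Rightarrow> ('v \<Rightarrow> 'v \<Rightarrow> real) set" where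
  "S2H gp Qp = {B. \<exists>I. admissible_triple gp Qp I \<and>
     (\<exists>a :: nat \<Rightarrow> real. \<forall>v w. B v w = (\<Sum>i=1..3. a i * gp (I i v) w))}"

definition S2E :: "('v::euclidean_space \<Rightarrow> 'v \<Rightarrow> real) \<Rightarrow> ('v \<Rightarrow> 'v) set \<Rightarrow> ('v \<Rightarrow> 'v \<Rightarrow> real) set" where
  "S2E gp Qp = {B. bilinear B \<and> (\<forall>v w. B v w = - B w v) \<and>
     (\<forall>I. admissible_triple gp Qp I \<longrightarrow> (\<forall>i\<in>{1..3}. \<forall>v w. B (I i v) (I i w) = B v w))}"

definition some_triple ::
    "('v::euclidean_space \<Rightarrow> 'v \<Rightarrow> real) \<Rightarrow> ('v \<Rightarrow> 'v) set \<Rightarrow> nat \<Rightarrow> 'v \<Rightarrow> 'v" where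
  "some_triple gp Qp = (SOME I. admissible_triple gp Qp I)"

definition proj_S2H ::
    "('v::euclidean_space \<Rightarrow> 'v \<Rightarrow> real) \<Rightarrow> ('v \<Rightarrow> 'v) set \<Rightarrow> ('v \<Rightarrow> 'v \<Rightarrow> real) \<Rightarrow> 'v \<Rightarrow> 'v \<Rightarrow> real" where
  "proj_S2H gp Qp B v w =
     (let I = some_triple gp Qp in
      1 / real DIM('v) * (\<Sum>i=1..3. (\<Sum>e\<in>onb gp. B e (I i e)) * gp (I i v) w))"

definition proj_S2E ::
    "('v::euclidean_space \<Rightarrow> 'v \<Rightarrow> real) \<Rightarrow> ('v \<Rightarrow> 'v) set \<Rightarrow> ('v \<Rightarrow> 'v \<Rightarrow> real) \<Rightarrow> 'v \<Rightarrow> 'v \<Rightarrow> real" where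
  "proj_S2E gp Qp B v w =
     (let I = some_triple gp Qp in 1 / 4 * (B v w + (\<Sum>i=1..3. B (I i v) (I i w))))"

definition section_S2E ::
    "('a, 'v::euclidean_space) atlas \<Rightarrow> ('a, 'v) tensor2 \<Rightarrow> ('a \<Rightarrow> ('v \<Rightarrow> 'v) set) \<Rightarrow>
      ('a, 'v) tensor2 \<Rightarrow> bool" where
  "section_S2E \<kappa> g Q u \<longleftrightarrow> two_form \<kappa> u \<and> (\<forall>p. u p \<in> S2E (g p) (Q p))"

definition compatible ::
    "('a, 'v::euclidean_space) tensor2 \<Rightarrow> ('a \<Rightarrow> ('v \<Rightarrow> 'v) set) \<Rightarrow> ('a, 'v) tensor2 \<Rightarrow> bool" where
  "compatible g Q \<psi> \<longleftrightarrow>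
     (\<forall>p. \<exists>h\<in>S2H (g p) (Q p). \<exists>e\<in>S2E (g p) (Q p). \<forall>v w. \<psi> p v w = h v w + e v w)"

definition compatible_ck_forms ::
    "('a, 'v::euclidean_space) atlas \<Rightarrow> ('a, 'v) tensor2 \<Rightarrow> ('a, 'v) connection \<Rightarrow>
      ('a \<Rightarrow> ('v \<Rightarrow> 'v) set) \<Rightarrow> ('a, 'v) tensor2 set" where
  "compatible_ck_forms \<kappa> g D Q = {\<psi>. conformal_killing \<kappa> g D \<psi> \<and> compatible g Q \<psi>}"

text \<open>
  The equation \<open>\<nabla>\<^sub>Yu = 1/(4n-1) (X \<and> Y + \<Sum>\<^sub>i J\<^sub>iX \<and> J\<^sub>iY)\<close> with respect to the local admissible bases.
\<close>

definition S2E_equation ::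
    "('a::topological_space, 'v::euclidean_space) atlas \<Rightarrow> ('a, 'v) tensor2 \<Rightarrow> ('a, 'v) connection \<Rightarrow>
      ('a \<Rightarrow> ('v \<Rightarrow> 'v) set) \<Rightarrow> nat \<Rightarrow> ('a, 'v) tensor2 \<Rightarrow> ('a, 'v) vfield \<Rightarrow> bool" where
  "S2E_equation \<kappa> g D Q n u X \<longleftrightarrow>
     (\<forall>U J. admissible_basis \<kappa> g Q U J \<longrightarrow>
        (\<forall>p\<in>U. \<forall>y z w. covd2 \<kappa> D u p y z w =
           1 / (4 * real n - 1) *
             (wedge (g p) (X p) y z w + (\<Sum>i=1..3. wedge (g p) (J i p (X p)) (J i p y) z w))))"

definition S2E_solutions ::
    "('a::topological_space, 'v::euclidean_space) atlas \<Rightarrow> ('a, 'v) tensor2 \<Rightarrow> ('a, 'v) connection \<Rightarrow>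
      ('a \<Rightarrow> ('v \<Rightarrow> 'v) set) \<Rightarrow> nat \<Rightarrow> ('a, 'v) tensor2 set" where
  "S2E_solutions \<kappa> g D Q n =
     {u. section_S2E \<kappa> g Q u \<and> (\<exists>X. smooth_vfield \<kappa> UNIV X \<and> S2E_equation \<kappa> g D Q n u X)}"

definition S2E_part ::
    "('a, 'v::euclidean_space) tensor2 \<Rightarrow> ('a \<Rightarrow> ('v \<Rightarrow> 'v) set) \<Rightarrow> ('a, 'v) tensor2 \<Rightarrow> ('a, 'v) tensor2"
  where
  "S2E_part g Q \<psi> = (\<lambda>p. proj_S2E (g p) (Q p) (\<psi> p))"

text \<open>\<open>(\<nabla>X)(Y, Z) = g(\<nabla>\<^sub>YX, Z)\<close>\<close>

definition grad_form ::
    "('a, 'v) tensor2 \<Rightarrow> ('a, 'v) connection \<Rightarrow> ('a, 'v) vfield \<Rightarrow> ('a, 'v) tensor2" where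
  "grad_form g D X p y z = g p (D X p y) z"

definition ck_form_of ::
    "('a, 'v::euclidean_space) atlas \<Rightarrow> ('a, 'v) tensor2 \<Rightarrow> ('a, 'v) connection \<Rightarrow>
      ('a \<Rightarrow> ('v \<Rightarrow> 'v) set) \<Rightarrow> nat \<Rightarrow> ('a, 'v) tensor2 \<Rightarrow> ('a, 'v) tensor2" where
  "ck_form_of \<kappa> g D Q n u = (\<lambda>p y z. u p y z -
     1 / ((2 * real n + 1) * reduced_scalar_curvature \<kappa> g D n p) *
       proj_S2H (g p) (Q p) (grad_form g D (codiff \<kappa> g D u) p) y z)"

text \<open>
  Vector spaces of 2-tensor fields and their isomorphisms, for the pointwise operations
  (there is no instance of \<^class>\<open>real_vector\<close> for function types).
\<close>

definition tensor2_subspace :: "('a, 'v) tensor2 set \<Rightarrow> bool" where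
  "tensor2_subspace V \<longleftrightarrow>
     (\<lambda>p y z. 0) \<in> V \<and>
     (\<forall>\<phi>\<in>V. \<forall>\<psi>\<in>V. (\<lambda>p y z. \<phi> p y z + \<psi> p y z) \<in> V) \<and>
     (\<forall>(a::real). \<forall>\<psi>\<in>V. (\<lambda>p y z. a * \<psi> p y z) \<in> V)"

definition tensor2_iso ::
    "('a, 'v) tensor2 set \<Rightarrow> ('a, 'v) tensor2 set \<Rightarrow> (('a, 'v) tensor2 \<Rightarrow> ('a, 'v) tensor2) \<Rightarrow> bool" where
  "tensor2_iso V W F \<longleftrightarrow>
     tensor2_subspace V \<and> tensor2_subspace W \<and>
     (\<forall>\<phi>\<in>V. \<forall>\<psi>\<in>V. F (\<lambda>p y z. \<phi> p y z + \<psi> p y z) = (\<lambda>p y z. F \<phi> p y z + F \<psi> p y z)) \<and>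
     (\<forall>(a::real). \<forall>\<psi>\<in>V. F (\<lambda>p y z. a * \<psi> p y z) = (\<lambda>p y z. a * F \<psi> p y z)) \<and>
     bij_betw F V W"

end

theory Submission
  imports Defs
begin

text \<open>
  Write \<open>\<psi> = h + u\<close> with \<open>h\<close> in \<open>S\<^sup>2H\<close> and \<open>u\<close> in \<open>S\<^sup>2E\<close>, and put \<open>X = \<delta>\<psi>\<close>. Since \<open>Q\<close> is parallel,
  the covariant derivatives of \<open>h\<close> and \<open>u\<close> keep these types, and contractions of the conformal-Killing
  equation with the \<open>J\<^sub>i\<close> show that it is equivalent to the asserted equation for \<open>u\<close> together with
  \<open>\<nabla>\<^sub>Yh = 1/(4n-1) \<Sum>\<^sub>i \<omega>\<^sub>i(Y, X) \<omega>\<^sub>i\<close>. The Ricci identity for \<open>h\<close>, and the fact that the part of the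
  curvature in \<open>S\<^sup>2H\<close> is a multiple of \<open>\<nu>\<close>, determine \<open>h\<close> as a multiple of \<open>\<nu>\<^sup>-\<^sup>1 (\<nabla>X)\<close> projected
  to \<open>S\<^sup>2H\<close>. Conversely, the Ricci identity for a solution \<open>u\<close> makes \<open>X\<close> a Killing field, and Kostant's
  formula \<open>\<nabla>\<^sub>Y\<nabla>X = R(Y, X)\<close>, up to sign, shows that this multiple satisfies the equation for \<open>h\<close>. Here
  \<open>\<nu>\<close> is constant because the second Bianchi identity, contracted with the parallel tensor
  \<open>\<Sum>\<^sub>i \<omega>\<^sub>i \<otimes> \<omega>\<^sub>i\<close>, gives \<open>d\<nu> \<and> \<omega>\<^sub>i = 0\<close>.
\<close>


section \<open>Smooth maps between Euclidean spaces\<close>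

text \<open>The bases \<open>onb (g p)\<close> and \<open>triple p\<close> come from a choice
  operator, so they need not depend smoothly on \<open>p\<close> and cannot be differentiated. The
  obstacle is removed by the tensor \<open>M\<close>, the sum of omega_i (x) omega_i: it does not
  depend on the admissible triple, it is parallel because the connection matrix of \<open>Q\<close>
  is skew, and contraction with it yields both projections. A Leibniz rule for such contractions
  shows that derivatives respect the two bundles, and most of what remains is algebra on one tangent
  space. There the three structures are treated cyclically: the main contractions are carried out
  for \<open>J1\<close> and carried over to \<open>J2\<close> and \<open>J3\<close> by interpreting
  the locale again with a permuted triple. The dimension enters through the factor
  \<open>N - 4\<close>, which occurs both when the Ricci tensor is related to the curvature of
  \<open>Q\<close> and when the conformal-Killing equation is contracted; it vanishes in dimension
  four.\<close>

lemma k_smooth_on_cong: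
  assumes "open S" "\<And>x. x \<in> S \<Longrightarrow> f x = g x" "k_smooth_on k S f"
  shows "k_smooth_on k S g"
  using assms(2,3)
proof (induction k arbitrary: f g)
  case 0
  then show ?case using continuous_on_cong[of S S f g] by auto
next
  case (Suc k)
  have D: "(g has_derivative frechet_derivative f (at x)) (at x)" if "x \<in> S" for x
    by (rule has_derivative_transform_within_open[of f _ x UNIV S])
      (use Suc.prems that assms(1) in \<open>auto simp: frechet_derivative_works[symmetric]\<close>)
  have eq: "frechet_derivative f (at x) = frechet_derivative g (at x)" if "x \<in> S" for x
    using frechet_derivative_at[OF D[OF that]] .
  have "k_smooth_on k S (\<lambda>x. frechet_derivative g (at x) v)" for v
    by (rule Suc.IH[of "\<lambda>x. frechet_derivative f (at x) v"]) (use eq Suc.prems in auto)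
  moreover have "g differentiable (at x)" if "x \<in> S" for x
    using D[OF that] by (rule differentiableI)
  ultimately show ?case by simp
qed

lemma k_smooth_on_SucI:
  assumes "open S" "\<And>x. x \<in> S \<Longrightarrow> (f has_derivative f' x) (at x)"
    "\<And>v. k_smooth_on k S (\<lambda>x. f' x v)"
  shows "k_smooth_on (Suc k) S f"
proof -
  have "frechet_derivative f (at x) = f' x" if "x \<in> S" for x
    using assms(2) frechet_derivative_at that by metis
  then have "k_smooth_on k S (\<lambda>x. frechet_derivative f (at x) v)" for v
    by (intro k_smooth_on_cong[OF assms(1) _ assms(3)]) simp
  then show ?thesis using assms(2) by (auto simp: differentiable_def)
qed

lemma k_smooth_on_SucD:
  assumes "k_smooth_on (Suc k) S f" "x \<in> S"
  shows "(f has_derivative frechet_derivative f (at x)) (at x)"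
  using assms frechet_derivative_works by auto

lemma k_smooth_on_subset: "k_smooth_on k S f \<Longrightarrow> T \<subseteq> S \<Longrightarrow> k_smooth_on k T f"
  by (induction k arbitrary: f) (auto intro: continuous_on_subset)

lemma k_smooth_on_pred: "k_smooth_on (Suc k) S f \<Longrightarrow> k_smooth_on k S f"
proof (induction k arbitrary: f)
  case 0
  then show ?case
    by (auto intro!: continuous_at_imp_continuous_on differentiable_imp_continuous_within)
next
  case (Suc k)
  have "k_smooth_on k S (\<lambda>x. frechet_derivative f (at x) v)" for v
    by (rule Suc.IH) (use Suc.prems in simp)
  with Suc.prems show ?case by simp
qed

text \<open>Derivatives in \<open>k_smooth_on\<close> are full derivatives \<open>at x\<close>, not
  derivatives within \<open>S\<close>; hence the property depends only on the germs at the points of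
  \<open>S\<close>.\<close>

lemma k_smooth_on_local:
  assumes "\<And>x. x \<in> S \<Longrightarrow> \<exists>T. open T \<and> x \<in> T \<and> k_smooth_on k T f"
  shows "k_smooth_on k S f"
  using assms
proof (induction k arbitrary: f)
  case 0
  then show ?case
    by (auto intro!: continuous_at_imp_continuous_on dest: continuous_on_eq_continuous_at)
next
  case (Suc k)
  have "f differentiable at x" if "x \<in> S" for x
    using Suc.prems[OF that] by auto
  moreover have "k_smooth_on k S (\<lambda>x. frechet_derivative f (at x) v)" for v
    by (rule Suc.IH) (use Suc.prems in \<open>simp, blast\<close>)
  ultimately show ?case by simp
qed

lemma k_smooth_on_const: "open S \<Longrightarrow> k_smooth_on k S (\<lambda>x. a)"
proof (induction k arbitrary: a)
  case (Suc k)
  then show ?case by (intro k_smooth_on_SucI[where f' = "\<lambda>_ _. 0"]) auto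
qed auto

lemma k_smooth_on_add:
  "open S \<Longrightarrow> k_smooth_on k S f \<Longrightarrow> k_smooth_on k S g \<Longrightarrow> k_smooth_on k S (\<lambda>x. f x + g x)"
proof (induction k arbitrary: f g)
  case (Suc k)
  show ?case
  proof (rule k_smooth_on_SucI[OF \<open>open S\<close>])
    show "((\<lambda>x. f x + g x) has_derivative
        (\<lambda>v. frechet_derivative f (at x) v + frechet_derivative g (at x) v)) (at x)" if "x \<in> S" for x
      by (intro has_derivative_add k_smooth_on_SucD[OF Suc.prems(2) that] k_smooth_on_SucD[OF Suc.prems(3) that])
  qed (use Suc in auto)
qed (auto intro: continuous_on_add)

lemma k_smooth_on_scaleR:
  "open S \<Longrightarrow> k_smooth_on k S f \<Longrightarrow> k_smooth_on k S g \<Longrightarrow> k_smooth_on k S (\<lambda>x. f x *\<^sub>R g x)"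
proof (induction k arbitrary: f g)
  case (Suc k)
  show ?case
  proof (rule k_smooth_on_SucI[OF \<open>open S\<close>])
    show "((\<lambda>x. f x *\<^sub>R g x) has_derivative
        (\<lambda>v. f x *\<^sub>R frechet_derivative g (at x) v + frechet_derivative f (at x) v *\<^sub>R g x)) (at x)"
      if "x \<in> S" for x
      by (intro has_derivative_scaleR k_smooth_on_SucD[OF Suc.prems(2) that] k_smooth_on_SucD[OF Suc.prems(3) that])
    show "k_smooth_on k S (\<lambda>x. f x *\<^sub>R frechet_derivative g (at x) v + frechet_derivative f (at x) v *\<^sub>R g x)"
      for v
      by (intro k_smooth_on_add Suc.IH \<open>open S\<close> k_smooth_on_pred[OF Suc.prems(2)] k_smooth_on_pred[OF Suc.prems(3)])
        (use Suc.prems in auto)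
  qed
qed (auto intro: continuous_on_scaleR)

lemma k_smooth_on_linear:
  "open S \<Longrightarrow> bounded_linear L \<Longrightarrow> k_smooth_on k S f \<Longrightarrow> k_smooth_on k S (\<lambda>x. L (f x))"
proof (induction k arbitrary: f)
  case 0
  then show ?case by (auto intro: continuous_on_compose2[OF linear_continuous_on])
next
  case (Suc k)
  show ?case
  proof (rule k_smooth_on_SucI[OF \<open>open S\<close>])
    show "((\<lambda>x. L (f x)) has_derivative (\<lambda>v. L (frechet_derivative f (at x) v))) (at x)"
      if "x \<in> S" for x
      by (intro bounded_linear.has_derivative[OF Suc.prems(2)] k_smooth_on_SucD[OF Suc.prems(3) that])
  qed (use Suc in auto)
qed

lemma k_smooth_on_id: "open S \<Longrightarrow> k_smooth_on k S (\<lambda>x. x)"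
proof (cases k)
  case (Suc m)
  assume "open S"
  then show ?thesis
    unfolding Suc by (intro k_smooth_on_SucI[where f' = "\<lambda>_ v. v"] k_smooth_on_const) auto
qed auto

lemma k_smooth_on_sum:
  assumes "open S" "\<And>i. i \<in> I \<Longrightarrow> k_smooth_on k S (f i)"
  shows "k_smooth_on k S (\<lambda>x. \<Sum>i\<in>I. f i x)"
  using assms(2)
  by (induction I rule: infinite_finite_induct)
    (auto intro: k_smooth_on_const k_smooth_on_add assms(1))

text \<open>The chain rule produces a derivative of \<open>h\<close> in the varying direction
  \<open>?f' x v\<close>, which the induction hypothesis does not cover. Expanding that direction in
  \<open>Basis\<close> leaves derivatives of \<open>h\<close> in fixed directions, composed with
  \<open>f\<close> and multiplied by coefficients of \<open>?f'\<close>.\<close>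

lemma k_smooth_on_compose:
  fixes f :: "'a::euclidean_space \<Rightarrow> 'b::euclidean_space"
  shows "open S \<Longrightarrow> open T \<Longrightarrow> k_smooth_on k T h \<Longrightarrow> k_smooth_on k S f \<Longrightarrow> f ` S \<subseteq> T \<Longrightarrow>
    k_smooth_on k S (\<lambda>x. h (f x))"
proof (induction k arbitrary: h)
  case 0
  then show ?case by (auto intro: continuous_on_compose2)
next
  case (Suc k)
  let ?f' = "\<lambda>x. frechet_derivative f (at x)" and ?h' = "\<lambda>x. frechet_derivative h (at x)"
  have fx: "f x \<in> T" if "x \<in> S" for x using Suc.prems that by auto
  note df = k_smooth_on_SucD[OF Suc.prems(4)] and dh = k_smooth_on_SucD[OF Suc.prems(3) fx]
  show ?case
  proof (rule k_smooth_on_SucI[OF \<open>open S\<close>])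
    show "((\<lambda>x. h (f x)) has_derivative (\<lambda>v. \<Sum>b\<in>Basis. (?f' x v \<bullet> b) *\<^sub>R ?h' (f x) b)) (at x)"
      if "x \<in> S" for x
    proof -
      have "((\<lambda>x. h (f x)) has_derivative (\<lambda>v. ?h' (f x) (?f' x v))) (at x)"
        using has_derivative_compose[OF df[OF that] dh[OF that]] .
      moreover have "?h' (f x) (?f' x v) = (\<Sum>b\<in>Basis. (?f' x v \<bullet> b) *\<^sub>R ?h' (f x) b)" for v
      proof -
        have "linear (?h' (f x))" using dh[OF that] has_derivative_linear by auto
        then show ?thesis
          by (subst euclidean_representation[of "?f' x v", symmetric])
            (simp add: linear_sum linear_cmul)
      qed
      ultimately show ?thesis by simp
    qed
    show "k_smooth_on k S (\<lambda>x. \<Sum>b\<in>Basis. (?f' x v \<bullet> b) *\<^sub>R ?h' (f x) b)" for v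
    proof (intro k_smooth_on_sum k_smooth_on_scaleR \<open>open S\<close>)
      show "k_smooth_on k S (\<lambda>x. ?f' x v \<bullet> b)" for b
        by (rule k_smooth_on_linear[OF \<open>open S\<close> bounded_linear_inner_left]) (use Suc.prems in auto)
      show "k_smooth_on k S (\<lambda>x. ?h' (f x) b)" for b
        by (rule Suc.IH) (use Suc.prems k_smooth_on_pred[OF Suc.prems(4)] in auto)
    qed
  qed
qed

text \<open>Differentiation lowers the exponent, so the induction is over all exponents at once.
  Real powers serve twice below: for normalising vectors in the Gram-Schmidt process and for
  reciprocals.\<close>

lemma k_smooth_on_powr:
  fixes f :: "'a::euclidean_space \<Rightarrow> real"
  shows "open S \<Longrightarrow> (\<And>x. x \<in> S \<Longrightarrow> f x > 0) \<Longrightarrow> k_smooth_on k S f \<Longrightarrow>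
    k_smooth_on k S (\<lambda>x. f x powr a)"
proof (induction k arbitrary: a)
  case 0
  then show ?case by (auto intro!: continuous_on_powr continuous_on_const) force
next
  case (Suc k)
  show ?case
  proof (rule k_smooth_on_SucI[OF \<open>open S\<close>])
    show "((\<lambda>x. f x powr a) has_derivative
        (\<lambda>v. (a * f x powr (a - 1)) *\<^sub>R frechet_derivative f (at x) v)) (at x)" if "x \<in> S" for x
      using k_smooth_on_SucD[OF Suc.prems(3) that] Suc.prems(2)[OF that]
      by (auto intro!: derivative_eq_intros simp: powr_diff field_simps)
    show "k_smooth_on k S (\<lambda>x. (a * f x powr (a - 1)) *\<^sub>R frechet_derivative f (at x) v)" for v
    proof (rule k_smooth_on_scaleR[OF \<open>open S\<close>])
      have "k_smooth_on k S (\<lambda>x. f x powr (a - 1))"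
        by (rule Suc.IH) (use Suc.prems k_smooth_on_pred in auto)
      then show "k_smooth_on k S (\<lambda>x. a * f x powr (a - 1))"
        using k_smooth_on_scaleR[OF \<open>open S\<close> k_smooth_on_const[OF \<open>open S\<close>, of k a],
            of "\<lambda>x. f x powr (a - 1)"] by simp
    qed (use Suc.prems in auto)
  qed
qed

lemma smooth_on_cong: "open S \<Longrightarrow> (\<And>x. x \<in> S \<Longrightarrow> f x = g x) \<Longrightarrow> smooth_on S f \<Longrightarrow> smooth_on S g"
  unfolding smooth_on_def by (blast intro: k_smooth_on_cong)

lemma smooth_on_subset: "smooth_on S f \<Longrightarrow> T \<subseteq> S \<Longrightarrow> smooth_on T f"
  unfolding smooth_on_def by (blast intro: k_smooth_on_subset)

lemma smooth_on_local:
  "(\<And>x. x \<in> S \<Longrightarrow> \<exists>T. open T \<and> x \<in> T \<and> smooth_on T f) \<Longrightarrow> smooth_on S f"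
  unfolding smooth_on_def by (intro allI k_smooth_on_local) blast

lemma smooth_on_const: "open S \<Longrightarrow> smooth_on S (\<lambda>x. a)"
  unfolding smooth_on_def by (simp add: k_smooth_on_const)

lemma smooth_on_id: "open S \<Longrightarrow> smooth_on S (\<lambda>x. x)"
  unfolding smooth_on_def by (simp add: k_smooth_on_id)

lemma smooth_on_add:
  "open S \<Longrightarrow> smooth_on S f \<Longrightarrow> smooth_on S g \<Longrightarrow> smooth_on S (\<lambda>x. f x + g x)"
  unfolding smooth_on_def by (simp add: k_smooth_on_add)

lemma smooth_on_scaleR:
  "open S \<Longrightarrow> smooth_on S f \<Longrightarrow> smooth_on S g \<Longrightarrow> smooth_on S (\<lambda>x. f x *\<^sub>R g x)"
  unfolding smooth_on_def by (simp add: k_smooth_on_scaleR)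

lemma smooth_on_linear:
  "open S \<Longrightarrow> bounded_linear L \<Longrightarrow> smooth_on S f \<Longrightarrow> smooth_on S (\<lambda>x. L (f x))"
  unfolding smooth_on_def by (simp add: k_smooth_on_linear)

lemma smooth_on_compose:
  fixes f :: "'a::euclidean_space \<Rightarrow> 'b::euclidean_space"
  shows "open S \<Longrightarrow> open T \<Longrightarrow> smooth_on T h \<Longrightarrow> smooth_on S f \<Longrightarrow> f ` S \<subseteq> T \<Longrightarrow>
    smooth_on S (\<lambda>x. h (f x))"
  unfolding smooth_on_def by (blast intro: k_smooth_on_compose)

lemma smooth_on_powr:
  fixes f :: "'a::euclidean_space \<Rightarrow> real"
  shows "open S \<Longrightarrow> (\<And>x. x \<in> S \<Longrightarrow> f x > 0) \<Longrightarrow> smooth_on S f \<Longrightarrow> smooth_on S (\<lambda>x. f x powr a)"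
  unfolding smooth_on_def by (simp add: k_smooth_on_powr)

lemma smooth_on_has_derivative:
  "smooth_on S f \<Longrightarrow> x \<in> S \<Longrightarrow> (f has_derivative frechet_derivative f (at x)) (at x)"
  unfolding smooth_on_def by (blast intro: k_smooth_on_SucD)

lemma smooth_on_frechet_derivative:
  "smooth_on S f \<Longrightarrow> smooth_on S (\<lambda>x. frechet_derivative f (at x) v)"
  unfolding smooth_on_def using k_smooth_on.simps(2) by blast

lemma smooth_on_continuous_on: "smooth_on S f \<Longrightarrow> continuous_on S f"
  unfolding smooth_on_def using k_smooth_on.simps(1) by blast

subsection \<open>Germs of smooth maps\<close>

text \<open>Working with germs removes the bookkeeping of open domains from the later closure
  properties; \<open>smooth_on_iff_smooth_near\<close> translates back.\<close>

definition smooth_near :: "'v::euclidean_space \<Rightarrow> ('v \<Rightarrow> 'w::real_normed_vector) \<Rightarrow> bool" where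
  "smooth_near x f \<longleftrightarrow> (\<exists>S. open S \<and> x \<in> S \<and> smooth_on S f)"

lemma smooth_on_iff_smooth_near: "open S \<Longrightarrow> smooth_on S f \<longleftrightarrow> (\<forall>x\<in>S. smooth_near x f)"
  unfolding smooth_near_def
proof (intro iffI ballI)
  assume "\<forall>x\<in>S. \<exists>T. open T \<and> x \<in> T \<and> smooth_on T f"
  then show "smooth_on S f" by (intro smooth_on_local) simp
qed auto

lemma smooth_nearE2:
  assumes "smooth_near x f" "smooth_near x g"
  obtains S where "open S" "x \<in> S" "smooth_on S f" "smooth_on S g"
proof -
  obtain S where S: "open S" "x \<in> S" "smooth_on S f"
    using assms(1) unfolding smooth_near_def by metis
  obtain T where T: "open T" "x \<in> T" "smooth_on T g"
    using assms(2) unfolding smooth_near_def by metis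
  from S T show thesis
    by (intro that[of "S \<inter> T"] smooth_on_subset[OF S(3)] smooth_on_subset[OF T(3)]) auto
qed

lemma smooth_near_cong:
  assumes "smooth_near x f" "eventually (\<lambda>y. f y = g y) (nhds x)"
  shows "smooth_near x g"
proof -
  obtain S where S: "open S" "x \<in> S" "smooth_on S f"
    using assms(1) unfolding smooth_near_def by metis
  obtain T where T: "open T" "x \<in> T" "\<forall>y\<in>T. f y = g y"
    using assms(2) unfolding eventually_nhds by metis
  from S T have "smooth_on (S \<inter> T) g"
    by (auto intro!: smooth_on_cong[of "S \<inter> T" f g] smooth_on_subset[OF S(3)])
  then show ?thesis
    unfolding smooth_near_def using S T by (intro exI[of _ "S \<inter> T"]) auto
qed

lemma eventually_smooth_near: "smooth_near x f \<Longrightarrow> eventually (\<lambda>y. smooth_near y f) (nhds x)"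
  unfolding smooth_near_def eventually_nhds by blast

lemma smooth_near_const: "smooth_near x (\<lambda>y. a)"
  unfolding smooth_near_def using smooth_on_const open_UNIV by blast

lemma smooth_near_id: "smooth_near x (\<lambda>y. y)"
  unfolding smooth_near_def using smooth_on_id open_UNIV by blast

lemma smooth_near_add: "smooth_near x f \<Longrightarrow> smooth_near x g \<Longrightarrow> smooth_near x (\<lambda>y. f y + g y)"
  by (erule (1) smooth_nearE2) (auto simp: smooth_near_def intro: smooth_on_add)

lemma smooth_near_scaleR: "smooth_near x f \<Longrightarrow> smooth_near x g \<Longrightarrow> smooth_near x (\<lambda>y. f y *\<^sub>R g y)"
  by (erule (1) smooth_nearE2) (auto simp: smooth_near_def intro: smooth_on_scaleR)

lemma smooth_near_sum:
  "(\<And>i. i \<in> I \<Longrightarrow> smooth_near x (f i)) \<Longrightarrow> smooth_near x (\<lambda>y. \<Sum>i\<in>I. f i y)"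
  by (induction I rule: infinite_finite_induct) (auto intro: smooth_near_const smooth_near_add)

lemma smooth_near_linear: "bounded_linear L \<Longrightarrow> smooth_near x f \<Longrightarrow> smooth_near x (\<lambda>y. L (f y))"
  unfolding smooth_near_def by (blast intro: smooth_on_linear)

lemma smooth_near_isCont: "smooth_near x f \<Longrightarrow> isCont f x"
  unfolding smooth_near_def using smooth_on_continuous_on continuous_on_eq_continuous_at by blast

lemma smooth_near_has_derivative:
  "smooth_near x f \<Longrightarrow> (f has_derivative frechet_derivative f (at x)) (at x)"
  unfolding smooth_near_def by (blast intro: smooth_on_has_derivative)

lemma smooth_near_frechet_derivative:
  "smooth_near x f \<Longrightarrow> smooth_near x (\<lambda>y. frechet_derivative f (at y) v)"
  unfolding smooth_near_def using smooth_on_frechet_derivative by blast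

lemma smooth_near_compose:
  fixes f :: "'a::euclidean_space \<Rightarrow> 'b::euclidean_space"
  assumes "smooth_near (f x) h" "smooth_near x f"
  shows "smooth_near x (\<lambda>y. h (f y))"
proof -
  obtain S where S: "open S" "x \<in> S" "smooth_on S f"
    using assms(2) unfolding smooth_near_def by metis
  obtain T where T: "open T" "f x \<in> T" "smooth_on T h"
    using assms(1) unfolding smooth_near_def by metis
  note * = S T
  then have "open (S \<inter> f -` T)"
    using smooth_on_continuous_on continuous_open_preimage by blast
  moreover have "smooth_on (S \<inter> f -` T) (\<lambda>y. h (f y))"
    by (rule smooth_on_compose[OF calculation \<open>open T\<close> \<open>smooth_on T h\<close>])
      (use S in \<open>auto intro!: smooth_on_subset[OF S(3)]\<close>)
  ultimately show ?thesis
    unfolding smooth_near_def using * by (intro exI[of _ "S \<inter> f -` T"]) simp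
qed

lemma smooth_near_powr:
  fixes f :: "'a::euclidean_space \<Rightarrow> real"
  assumes "smooth_near x f" "f x > 0"
  shows "smooth_near x (\<lambda>y. f y powr a)"
proof -
  obtain S where *: "open S" "x \<in> S" "smooth_on S f"
    using assms unfolding smooth_near_def by metis
  then have "open (S \<inter> f -` {0<..})"
    using smooth_on_continuous_on continuous_open_preimage open_greaterThan by blast
  moreover have "smooth_on (S \<inter> f -` {0<..}) (\<lambda>y. f y powr a)"
    by (rule smooth_on_powr[OF calculation]) (use * in \<open>auto intro!: smooth_on_subset[OF *(3)]\<close>)
  ultimately show ?thesis
    unfolding smooth_near_def using * assms(2) by (intro exI[of _ "S \<inter> f -` {0<..}"]) simp
qed

section \<open>Smooth functions and vector fields near a point\<close>

locale manifold =
  fixes \<kappa> :: "('a::t2_space, 'v::euclidean_space) atlas"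
  assumes atlas: "smooth_atlas \<kappa>"
begin

lemma centre_in_cdom [simp]: "c \<in> cdom \<kappa> c"
  and open_cdom: "open (cdom \<kappa> c)"
  and crd_homeomorphism:
    "homeomorphism (cdom \<kappa> c) (crd \<kappa> c ` cdom \<kappa> c) (crd \<kappa> c) (crd_inv \<kappa> c)"
  and transition_smooth_on:
    "smooth_on (crd \<kappa> c ` (cdom \<kappa> c \<inter> cdom \<kappa> d)) (crd \<kappa> d \<circ> crd_inv \<kappa> c)"
  using atlas unfolding smooth_atlas_def by auto

lemma crd_inv_crd [simp]: "q \<in> cdom \<kappa> c \<Longrightarrow> crd_inv \<kappa> c (crd \<kappa> c q) = q"
  using crd_homeomorphism unfolding homeomorphism_def by blast

lemma open_crd_image:
  assumes "open U"
  shows "open (crd \<kappa> c ` (U \<inter> cdom \<kappa> c))"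
proof -
  have "openin (top_of_set (cdom \<kappa> c)) (U \<inter> cdom \<kappa> c)"
    using assms by (metis Int_commute openin_open_Int)
  then have "openin (top_of_set (crd \<kappa> c ` cdom \<kappa> c)) (crd \<kappa> c ` (U \<inter> cdom \<kappa> c))"
    by (rule homeomorphism_imp_open_map[OF crd_homeomorphism])
  moreover have "open (crd \<kappa> c ` cdom \<kappa> c)"
    using atlas unfolding smooth_atlas_def by auto
  ultimately show ?thesis by (metis openin_open_eq)
qed

lemma eventually_in_cdom: "q \<in> cdom \<kappa> c \<Longrightarrow> eventually (\<lambda>r. r \<in> cdom \<kappa> c) (nhds q)"
  by (intro eventually_nhds_in_open open_cdom)

text \<open>Charts are homeomorphisms onto open sets, so they carry the neighbourhood filter of
  \<open>q\<close> to that of its image. Local statements are transferred between the manifold and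
  coordinates through this equivalence.\<close>

lemma eventually_nhds_chart:
  assumes "q \<in> cdom \<kappa> c"
  shows "eventually (\<lambda>x. P (crd_inv \<kappa> c x)) (nhds (crd \<kappa> c q)) \<longleftrightarrow> eventually P (nhds q)"
proof
  assume "eventually P (nhds q)"
  then obtain U where U: "open U" "q \<in> U" "\<forall>r\<in>U. P r"
    unfolding eventually_nhds by blast
  then have "\<forall>x \<in> crd \<kappa> c ` (U \<inter> cdom \<kappa> c). P (crd_inv \<kappa> c x)" by auto
  moreover have "crd \<kappa> c q \<in> crd \<kappa> c ` (U \<inter> cdom \<kappa> c)" using U assms by auto
  ultimately show "eventually (\<lambda>x. P (crd_inv \<kappa> c x)) (nhds (crd \<kappa> c q))"
    unfolding eventually_nhds using open_crd_image[OF U(1), of c] by blast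
next
  assume P: "eventually (\<lambda>x. P (crd_inv \<kappa> c x)) (nhds (crd \<kappa> c q))"
  have "continuous_on (cdom \<kappa> c) (crd \<kappa> c)"
    using crd_homeomorphism unfolding homeomorphism_def by blast
  then have "isCont (crd \<kappa> c) q"
    using assms open_cdom continuous_on_eq_continuous_at by blast
  then have "filterlim (crd \<kappa> c) (nhds (crd \<kappa> c q)) (nhds q)"
    using isContD tendsto_at_iff_tendsto_nhds by blast
  from eventually_compose_filterlim[OF P this]
  have "eventually (\<lambda>r. P (crd_inv \<kappa> c (crd \<kappa> c r))) (nhds q)" .
  then show "eventually P (nhds q)"
    by (rule eventually_elim2[OF _ eventually_in_cdom[OF assms]]) simp
qed

lemma eventually_in_chart:
  assumes "q \<in> cdom \<kappa> c" "q \<in> cdom \<kappa> d"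
  shows "eventually (\<lambda>x. crd_inv \<kappa> c x \<in> cdom \<kappa> d) (nhds (crd \<kappa> c q))"
  using eventually_nhds_chart[OF assms(1), of "\<lambda>r. r \<in> cdom \<kappa> d"] eventually_in_cdom[OF assms(2)]
  by simp

lemma eventually_crd_crd_inv:
  assumes "q \<in> cdom \<kappa> c"
  shows "eventually (\<lambda>x. crd \<kappa> c (crd_inv \<kappa> c x) = x) (nhds (crd \<kappa> c q))"
  using open_crd_image[OF open_UNIV, of c] assms unfolding eventually_nhds
  by (intro exI[of _ "crd \<kappa> c ` (UNIV \<inter> cdom \<kappa> c)"]) auto

lemma smooth_near_transition:
  assumes "q \<in> cdom \<kappa> c" "q \<in> cdom \<kappa> d"
  shows "smooth_near (crd \<kappa> c q) (\<lambda>x. crd \<kappa> d (crd_inv \<kappa> c x))"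
  using transition_smooth_on[of c d] open_crd_image[OF open_cdom, of c d] assms
  unfolding smooth_near_def comp_def by (auto simp: Int_commute)

lemma transition_has_derivative:
  assumes "q \<in> cdom \<kappa> c" "q \<in> cdom \<kappa> d"
  shows "((\<lambda>x. crd \<kappa> d (crd_inv \<kappa> c x)) has_derivative tr \<kappa> c d q) (at (crd \<kappa> c q))"
  using smooth_near_has_derivative[OF smooth_near_transition[OF assms]]
  unfolding tr_def comp_def .

lemma linear_tr: "q \<in> cdom \<kappa> c \<Longrightarrow> q \<in> cdom \<kappa> d \<Longrightarrow> linear (tr \<kappa> c d q)"
  using transition_has_derivative has_derivative_linear by blast

lemma has_derivative_cong_nhds:
  assumes "(f has_derivative f') (at x)" "eventually (\<lambda>y. f y = h y) (nhds x)"
  shows "(h has_derivative f') (at x)"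
proof -
  obtain T where T: "open T" "x \<in> T" "\<forall>y\<in>T. f y = h y"
    using assms(2) unfolding eventually_nhds by auto
  then show ?thesis
    by (intro has_derivative_transform_within_open[OF assms(1)]) auto
qed

text \<open>The chain rule for transition maps. The composite agrees with the direct transition only
  near \<open>crd \<kappa> c q\<close>, which is enough for derivatives.\<close>

lemma tr_tr:
  assumes "q \<in> cdom \<kappa> c" "q \<in> cdom \<kappa> d" "q \<in> cdom \<kappa> e"
  shows "tr \<kappa> d e q (tr \<kappa> c d q v) = tr \<kappa> c e q v"
proof -
  have "((\<lambda>x. crd \<kappa> e (crd_inv \<kappa> d (crd \<kappa> d (crd_inv \<kappa> c x)))) has_derivative
      (\<lambda>v. tr \<kappa> d e q (tr \<kappa> c d q v))) (at (crd \<kappa> c q))"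
    using has_derivative_compose[OF transition_has_derivative[OF assms(1,2)],
        where g = "\<lambda>y. crd \<kappa> e (crd_inv \<kappa> d y)" and g' = "tr \<kappa> d e q"]
      transition_has_derivative[OF assms(2,3)] assms by simp
  moreover have "eventually (\<lambda>x. crd \<kappa> e (crd_inv \<kappa> d (crd \<kappa> d (crd_inv \<kappa> c x))) =
      crd \<kappa> e (crd_inv \<kappa> c x)) (nhds (crd \<kappa> c q))"
    by (rule eventually_mono[OF eventually_in_chart[OF assms(1,2)]]) simp
  ultimately have "((\<lambda>x. crd \<kappa> e (crd_inv \<kappa> c x)) has_derivative
      (\<lambda>v. tr \<kappa> d e q (tr \<kappa> c d q v))) (at (crd \<kappa> c q))"
    by (rule has_derivative_cong_nhds)
  from has_derivative_unique[OF this transition_has_derivative[OF assms(1,3)]]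
  show ?thesis by (rule fun_cong)
qed

lemma tr_same: "q \<in> cdom \<kappa> c \<Longrightarrow> tr \<kappa> c c q v = v"
proof -
  assume q: "q \<in> cdom \<kappa> c"
  have "((\<lambda>x. crd \<kappa> c (crd_inv \<kappa> c x)) has_derivative (\<lambda>v. v)) (at (crd \<kappa> c q))"
    by (rule has_derivative_cong_nhds[OF has_derivative_ident])
      (use eventually_crd_crd_inv[OF q] in eventually_elim, simp)
  from has_derivative_unique[OF this transition_has_derivative[OF q q]]
  show ?thesis by (rule fun_cong[symmetric])
qed

lemma smooth_near_change_chart:
  assumes "smooth_near (crd \<kappa> c q) (\<lambda>x. f (crd_inv \<kappa> c x))" "q \<in> cdom \<kappa> c" "q \<in> cdom \<kappa> d"
  shows "smooth_near (crd \<kappa> d q) (\<lambda>x. f (crd_inv \<kappa> d x))"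
proof (rule smooth_near_cong)
  show "smooth_near (crd \<kappa> d q) (\<lambda>x. f (crd_inv \<kappa> c (crd \<kappa> c (crd_inv \<kappa> d x))))"
    by (rule smooth_near_compose[OF _ smooth_near_transition]) (use assms in simp_all)
  show "eventually (\<lambda>x. f (crd_inv \<kappa> c (crd \<kappa> c (crd_inv \<kappa> d x))) = f (crd_inv \<kappa> d x))
      (nhds (crd \<kappa> d q))"
    by (rule eventually_mono[OF eventually_in_chart[OF assms(3,2)]]) simp
qed

definition smooth_fun_at :: "'a \<Rightarrow> ('a \<Rightarrow> real) \<Rightarrow> bool" where
  "smooth_fun_at q f \<longleftrightarrow> smooth_near (crd \<kappa> q q) (\<lambda>x. f (crd_inv \<kappa> q x))"

text \<open>The value \<open>X q\<close> refers to the chart indexed by \<open>q\<close>, which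
  changes with the point. Only after conversion to one fixed chart \<open>c\<close> do the
  components form a function whose smoothness can be tested.\<close>

definition vcomp :: "'a \<Rightarrow> ('a, 'v) vfield \<Rightarrow> 'a \<Rightarrow> 'v" where
  "vcomp c X q = tr \<kappa> q c q (X q)"

definition smooth_vf_at :: "'a \<Rightarrow> ('a, 'v) vfield \<Rightarrow> bool" where
  "smooth_vf_at q X \<longleftrightarrow> smooth_near (crd \<kappa> q q) (\<lambda>x. vcomp q X (crd_inv \<kappa> q x))"

lemma smooth_fun_at_chart:
  assumes "q \<in> cdom \<kappa> c"
  shows "smooth_fun_at q f \<longleftrightarrow> smooth_near (crd \<kappa> c q) (\<lambda>x. f (crd_inv \<kappa> c x))"
  unfolding smooth_fun_at_def
  using smooth_near_change_chart[where f = f, OF _ assms centre_in_cdom]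
    smooth_near_change_chart[where f = f, OF _ centre_in_cdom assms] by (rule iffI[rotated])

lemma vcomp_change:
  assumes "q \<in> cdom \<kappa> c" "q \<in> cdom \<kappa> d"
  shows "vcomp d X q = tr \<kappa> c d q (vcomp c X q)"
  unfolding vcomp_def using tr_tr[OF centre_in_cdom assms] by simp

text \<open>Components change by the Jacobian of the transition map, and its entries are derivatives
  of a smooth map; \<open>tr\<close> at a varying point is this Jacobian at the coordinates of the
  point.\<close>

lemma smooth_near_vcomp_change:
  assumes X: "smooth_near (crd \<kappa> c q) (\<lambda>x. vcomp c X (crd_inv \<kappa> c x))"
    and q: "q \<in> cdom \<kappa> c" "q \<in> cdom \<kappa> d"
  shows "smooth_near (crd \<kappa> d q) (\<lambda>x. vcomp d X (crd_inv \<kappa> d x))"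
proof (rule smooth_near_change_chart[OF smooth_near_cong q])
  let ?T = "\<lambda>x. crd \<kappa> d (crd_inv \<kappa> c x)"
  show "smooth_near (crd \<kappa> c q)
      (\<lambda>x. \<Sum>b\<in>Basis. (vcomp c X (crd_inv \<kappa> c x) \<bullet> b) *\<^sub>R frechet_derivative ?T (at x) b)"
    by (intro smooth_near_sum smooth_near_scaleR smooth_near_frechet_derivative
        smooth_near_transition q smooth_near_linear[OF bounded_linear_inner_left X])
  show "eventually (\<lambda>x. (\<Sum>b\<in>Basis. (vcomp c X (crd_inv \<kappa> c x) \<bullet> b) *\<^sub>R
      frechet_derivative ?T (at x) b) = vcomp d X (crd_inv \<kappa> c x)) (nhds (crd \<kappa> c q))"
    using eventually_in_chart[OF q(1,1)] eventually_in_chart[OF q] eventually_crd_crd_inv[OF q(1)]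
  proof eventually_elim
    case (elim x)
    define r where "r = crd_inv \<kappa> c x"
    have r: "r \<in> cdom \<kappa> c" "r \<in> cdom \<kappa> d" "x = crd \<kappa> c r"
      using elim unfolding r_def by auto
    have "frechet_derivative ?T (at x) = tr \<kappa> c d r"
      unfolding r(3) tr_def comp_def ..
    then have "(\<Sum>b\<in>Basis. (vcomp c X r \<bullet> b) *\<^sub>R frechet_derivative ?T (at x) b) =
        tr \<kappa> c d r (\<Sum>b\<in>Basis. (vcomp c X r \<bullet> b) *\<^sub>R b)"
      using linear_tr[OF r(1,2)] by (simp add: linear_sum linear_cmul)
    also have "\<dots> = vcomp d X r"
      using vcomp_change[OF r(1,2)] by (simp add: euclidean_representation)
    finally show ?case unfolding r_def .
  qed
qed

lemma smooth_vf_at_chart: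
  assumes "q \<in> cdom \<kappa> c"
  shows "smooth_vf_at q X \<longleftrightarrow> smooth_near (crd \<kappa> c q) (\<lambda>x. vcomp c X (crd_inv \<kappa> c x))"
  unfolding smooth_vf_at_def
  using smooth_near_vcomp_change[where X = X, OF _ assms centre_in_cdom]
    smooth_near_vcomp_change[where X = X, OF _ centre_in_cdom assms] by (rule iffI[rotated])

lemma smooth_in_chart_iff:
  assumes "open U"
  shows "smooth_in_chart \<kappa> c U f \<longleftrightarrow>
    (\<forall>q \<in> U \<inter> cdom \<kappa> c. smooth_near (crd \<kappa> c q) (\<lambda>x. f (crd_inv \<kappa> c x)))"
  unfolding smooth_in_chart_def smooth_on_iff_smooth_near[OF open_crd_image[OF assms]] comp_def
  by auto

lemma smooth_function_iff:
  assumes "open U"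
  shows "smooth_function \<kappa> U f \<longleftrightarrow> (\<forall>q\<in>U. smooth_fun_at q f)"
proof -
  have "smooth_in_chart \<kappa> c U f \<longleftrightarrow> (\<forall>q\<in>U \<inter> cdom \<kappa> c. smooth_fun_at q f)" for c
    unfolding smooth_in_chart_iff[OF assms] using smooth_fun_at_chart by blast
  then show ?thesis
    unfolding smooth_function_def using centre_in_cdom by blast
qed

lemma smooth_vfield_iff:
  assumes "open U"
  shows "smooth_vfield \<kappa> U X \<longleftrightarrow> (\<forall>q\<in>U. smooth_vf_at q X)"
proof -
  have "smooth_in_chart \<kappa> c U (vcomp c X) \<longleftrightarrow> (\<forall>q\<in>U \<inter> cdom \<kappa> c. smooth_vf_at q X)" for c
    unfolding smooth_in_chart_iff[OF assms] using smooth_vf_at_chart by blast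
  then show ?thesis
    unfolding smooth_vfield_def vcomp_def using centre_in_cdom by blast
qed

lemma eventually_smooth_fun_at:
  assumes "smooth_fun_at q f"
  shows "eventually (\<lambda>r. smooth_fun_at r f) (nhds q)"
proof -
  have "eventually (\<lambda>x. smooth_near x (\<lambda>x. f (crd_inv \<kappa> q x))) (nhds (crd \<kappa> q q))"
    using assms unfolding smooth_fun_at_def by (rule eventually_smooth_near)
  then have "eventually (\<lambda>x. smooth_fun_at (crd_inv \<kappa> q x) f) (nhds (crd \<kappa> q q))"
    using eventually_crd_crd_inv[OF centre_in_cdom] eventually_in_chart[OF centre_in_cdom centre_in_cdom]
    by eventually_elim (simp add: smooth_fun_at_chart[of _ q])
  then show ?thesis using eventually_nhds_chart[OF centre_in_cdom, of "\<lambda>r. smooth_fun_at r f"] by simp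
qed

lemma eventually_smooth_vf_at:
  assumes "smooth_vf_at q X"
  shows "eventually (\<lambda>r. smooth_vf_at r X) (nhds q)"
proof -
  have "eventually (\<lambda>x. smooth_near x (\<lambda>x. vcomp q X (crd_inv \<kappa> q x))) (nhds (crd \<kappa> q q))"
    using assms unfolding smooth_vf_at_def by (rule eventually_smooth_near)
  then have "eventually (\<lambda>x. smooth_vf_at (crd_inv \<kappa> q x) X) (nhds (crd \<kappa> q q))"
    using eventually_crd_crd_inv[OF centre_in_cdom] eventually_in_chart[OF centre_in_cdom centre_in_cdom]
    by eventually_elim (simp add: smooth_vf_at_chart[of _ q])
  then show ?thesis using eventually_nhds_chart[OF centre_in_cdom, of "\<lambda>r. smooth_vf_at r X"] by simp
qed

section \<open>Arithmetic of germs of smooth functions and vector fields\<close>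

lemma smooth_fun_at_cong:
  assumes "smooth_fun_at q f" "eventually (\<lambda>r. f r = h r) (nhds q)"
  shows "smooth_fun_at q h"
  using assms(1) smooth_near_cong
    eventually_nhds_chart[OF centre_in_cdom, of "\<lambda>r. f r = h r"] assms(2)
  unfolding smooth_fun_at_def by fast

lemma smooth_fun_at_const: "smooth_fun_at q (\<lambda>r. a)"
  unfolding smooth_fun_at_def by (rule smooth_near_const)

lemma smooth_fun_at_add:
  "smooth_fun_at q f \<Longrightarrow> smooth_fun_at q h \<Longrightarrow> smooth_fun_at q (\<lambda>r. f r + h r)"
  unfolding smooth_fun_at_def by (rule smooth_near_add)

lemma smooth_fun_at_mult:
  "smooth_fun_at q f \<Longrightarrow> smooth_fun_at q h \<Longrightarrow> smooth_fun_at q (\<lambda>r. f r * h r)"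
  unfolding smooth_fun_at_def using smooth_near_scaleR[where 'b = real] by simp

lemma smooth_fun_at_minus: "smooth_fun_at q f \<Longrightarrow> smooth_fun_at q (\<lambda>r. - f r)"
  using smooth_fun_at_mult[OF smooth_fun_at_const, of q f "-1"] by simp

lemma smooth_fun_at_diff:
  "smooth_fun_at q f \<Longrightarrow> smooth_fun_at q h \<Longrightarrow> smooth_fun_at q (\<lambda>r. f r - h r)"
  using smooth_fun_at_add[of q f "\<lambda>r. - h r"] smooth_fun_at_minus by simp

lemma smooth_fun_at_sum:
  "(\<And>i. i \<in> I \<Longrightarrow> smooth_fun_at q (f i)) \<Longrightarrow> smooth_fun_at q (\<lambda>r. \<Sum>i\<in>I. f i r)"
  unfolding smooth_fun_at_def by (rule smooth_near_sum)

lemma smooth_fun_at_powr: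
  "smooth_fun_at q f \<Longrightarrow> f q > 0 \<Longrightarrow> smooth_fun_at q (\<lambda>r. f r powr a)"
  unfolding smooth_fun_at_def by (rule smooth_near_powr) auto

text \<open>Powers with real exponent are smooth only at positive bases, whereas \<open>f\<close>
  may be negative near \<open>q\<close>. Hence the reciprocal is written as \<open>f\<close> times
  the inverse of its square.\<close>

lemma smooth_fun_at_inverse:
  assumes "smooth_fun_at q f" "f q \<noteq> 0"
  shows "smooth_fun_at q (\<lambda>r. inverse (f r))"
proof -
  have "smooth_fun_at q (\<lambda>r. f r * (f r * f r) powr (-1))"
    using assms by (intro smooth_fun_at_mult smooth_fun_at_powr) (auto simp: zero_less_mult_iff)
  moreover have "f r * (f r * f r) powr (-1) = inverse (f r)" for r
    by (cases "f r = 0") (simp_all add: powr_minus)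
  ultimately show ?thesis by simp
qed

lemma smooth_fun_at_tendsto:
  assumes "smooth_fun_at q f"
  shows "filterlim f (nhds (f q)) (nhds q)"
proof (rule topological_tendstoI)
  fix S assume S: "open S" "f q \<in> S"
  have "isCont (\<lambda>x. f (crd_inv \<kappa> q x)) (crd \<kappa> q q)"
    using assms unfolding smooth_fun_at_def by (rule smooth_near_isCont)
  then have "filterlim (\<lambda>x. f (crd_inv \<kappa> q x)) (nhds (f q)) (nhds (crd \<kappa> q q))"
    using isContD[of "crd \<kappa> q q" "\<lambda>x. f (crd_inv \<kappa> q x)"] 
      tendsto_at_iff_tendsto_nhds[of "\<lambda>x. f (crd_inv \<kappa> q x)" "crd \<kappa> q q"]
    by simp
  then have "eventually (\<lambda>x. f (crd_inv \<kappa> q x) \<in> S) (nhds (crd \<kappa> q q))"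
    using S topological_tendstoD by blast
  then show "eventually (\<lambda>r. f r \<in> S) (nhds q)"
    using eventually_nhds_chart[OF centre_in_cdom, of "\<lambda>r. f r \<in> S"] by simp
qed

lemma eventually_smooth_fun_at_gt:
  assumes "smooth_fun_at q f" "f q > a"
  shows "eventually (\<lambda>r. f r > a) (nhds q)"
  using order_tendstoD(1)[OF smooth_fun_at_tendsto[OF assms(1)] assms(2)] .

lemma vcomp_self: "vcomp q X q = X q"
  unfolding vcomp_def by (simp add: tr_same)

lemma vcomp_add: "r \<in> cdom \<kappa> c \<Longrightarrow> vcomp c (\<lambda>r. X r + Y r) r = vcomp c X r + vcomp c Y r"
  unfolding vcomp_def using linear_tr[OF centre_in_cdom] by (simp add: linear_add)

lemma vcomp_scaleR: "r \<in> cdom \<kappa> c \<Longrightarrow> vcomp c (\<lambda>r. f r *\<^sub>R X r) r = f r *\<^sub>R vcomp c X r"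
  unfolding vcomp_def using linear_tr[OF centre_in_cdom] by (simp add: linear_cmul)

lemma vcomp_cfield: "r \<in> cdom \<kappa> c \<Longrightarrow> vcomp c (cfield \<kappa> c w) r = w"
  unfolding vcomp_def cfield_def using tr_tr[of r c r c] tr_same by simp

lemma cfield_self: "cfield \<kappa> c w c = w"
  unfolding cfield_def by (simp add: tr_same)

lemma vcomp_expansion:
  assumes "r \<in> cdom \<kappa> c"
  shows "X r = (\<Sum>b\<in>Basis. (vcomp c X r \<bullet> b) *\<^sub>R cfield \<kappa> c b r)"
proof -
  have "X r = tr \<kappa> c r r (vcomp c X r)"
    unfolding vcomp_def using tr_tr[of r r c r] tr_same assms by simp
  also have "\<dots> = tr \<kappa> c r r (\<Sum>b\<in>Basis. (vcomp c X r \<bullet> b) *\<^sub>R b)"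
    by (simp add: euclidean_representation)
  also have "\<dots> = (\<Sum>b\<in>Basis. (vcomp c X r \<bullet> b) *\<^sub>R cfield \<kappa> c b r)"
    unfolding cfield_def using linear_tr[OF assms centre_in_cdom] by (simp add: linear_sum linear_cmul)
  finally show ?thesis .
qed

lemma smooth_vf_atI:
  assumes "q \<in> cdom \<kappa> c" "\<And>b. b \<in> Basis \<Longrightarrow> smooth_fun_at q (\<lambda>r. vcomp c X r \<bullet> b)"
  shows "smooth_vf_at q X"
proof -
  have "smooth_near (crd \<kappa> c q) (\<lambda>x. \<Sum>b\<in>Basis. (vcomp c X (crd_inv \<kappa> c x) \<bullet> b) *\<^sub>R b)"
    using assms(2) smooth_fun_at_chart[OF assms(1)]
    by (intro smooth_near_sum smooth_near_scaleR smooth_near_const) simp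
  then show ?thesis
    unfolding smooth_vf_at_chart[OF assms(1)] by (simp add: euclidean_representation)
qed

lemma smooth_fun_at_vcomp:
  "q \<in> cdom \<kappa> c \<Longrightarrow> smooth_vf_at q X \<Longrightarrow> smooth_fun_at q (\<lambda>r. vcomp c X r \<bullet> b)"
  unfolding smooth_vf_at_chart smooth_fun_at_chart
  by (rule smooth_near_linear[OF bounded_linear_inner_left])

lemma smooth_vf_at_cong:
  assumes "smooth_vf_at q X" "eventually (\<lambda>r. X r = Y r) (nhds q)"
  shows "smooth_vf_at q Y"
proof (rule smooth_vf_atI[OF centre_in_cdom])
  show "smooth_fun_at q (\<lambda>r. vcomp q Y r \<bullet> b)" for b
    by (rule smooth_fun_at_cong[OF smooth_fun_at_vcomp[OF centre_in_cdom assms(1)]])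
      (use assms(2) in eventually_elim, simp add: vcomp_def)
qed

lemma smooth_vf_at_add:
  assumes "smooth_vf_at q X" "smooth_vf_at q Y"
  shows "smooth_vf_at q (\<lambda>r. X r + Y r)"
proof (rule smooth_vf_atI[OF centre_in_cdom])
  show "smooth_fun_at q (\<lambda>r. vcomp q (\<lambda>r. X r + Y r) r \<bullet> b)" for b
    by (rule smooth_fun_at_cong[OF smooth_fun_at_add[OF smooth_fun_at_vcomp[OF centre_in_cdom assms(1)]
            smooth_fun_at_vcomp[OF centre_in_cdom assms(2)]]])
      (use eventually_in_cdom[OF centre_in_cdom] in eventually_elim, simp add: vcomp_add inner_add_left)
qed

lemma smooth_vf_at_scaleR:
  assumes "smooth_fun_at q f" "smooth_vf_at q X"
  shows "smooth_vf_at q (\<lambda>r. f r *\<^sub>R X r)"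
proof (rule smooth_vf_atI[OF centre_in_cdom])
  show "smooth_fun_at q (\<lambda>r. vcomp q (\<lambda>r. f r *\<^sub>R X r) r \<bullet> b)" for b
    by (rule smooth_fun_at_cong[OF smooth_fun_at_mult[OF assms(1)
            smooth_fun_at_vcomp[OF centre_in_cdom assms(2), of b]]])
      (use eventually_in_cdom[OF centre_in_cdom] in eventually_elim, simp add: vcomp_scaleR)
qed

lemma smooth_vf_at_cfield: 
  assumes "q \<in> cdom \<kappa> c"
  shows "smooth_vf_at q (cfield \<kappa> c w)"
proof (rule smooth_vf_atI[OF assms])
  show "smooth_fun_at q (\<lambda>r. vcomp c (cfield \<kappa> c w) r \<bullet> b)" for b
    by (rule smooth_fun_at_cong[OF smooth_fun_at_const[of q "w \<bullet> b"]])
      (use eventually_in_cdom[OF assms] in eventually_elim, simp add: vcomp_cfield)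
qed

lemma smooth_vf_at_zero: "smooth_vf_at q (\<lambda>r. 0)"
  using smooth_vf_at_scaleR[OF smooth_fun_at_const smooth_vf_at_cfield[OF centre_in_cdom], of q 0]
  by simp

lemma smooth_vf_at_minus: "smooth_vf_at q X \<Longrightarrow> smooth_vf_at q (\<lambda>r. - X r)"
  using smooth_vf_at_scaleR[OF smooth_fun_at_const, of q X "-1"] by simp

lemma smooth_vf_at_diff:
  "smooth_vf_at q X \<Longrightarrow> smooth_vf_at q Y \<Longrightarrow> smooth_vf_at q (\<lambda>r. X r - Y r)"
  using smooth_vf_at_add[of q X "\<lambda>r. - Y r"] smooth_vf_at_minus by simp

lemma smooth_vf_at_sum:
  "(\<And>i. i \<in> I \<Longrightarrow> smooth_vf_at q (X i)) \<Longrightarrow> smooth_vf_at q (\<lambda>r. \<Sum>i\<in>I. X i r)"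
  by (induction I rule: infinite_finite_induct) (auto intro: smooth_vf_at_zero smooth_vf_at_add)

lemma smooth_vf_at_germ_field:
  assumes "smooth_vf_at q X"
  obtains U where "open U" "q \<in> U" "smooth_vfield \<kappa> U X"
proof -
  obtain U where "open U" "q \<in> U" "\<forall>r\<in>U. smooth_vf_at r X"
    using eventually_smooth_vf_at[OF assms] unfolding eventually_nhds by auto
  then show thesis using that smooth_vfield_iff by blast
qed

text \<open>The definition tests smoothness on coordinate fields only. Arbitrary smooth fields are
  combinations of these with smooth coefficients, and bilinearity does the rest.\<close>

lemma smooth_tensor2_at:
  assumes B: "smooth_tensor2 \<kappa> U B" "open U" "q \<in> U" and XY: "smooth_vf_at q X" "smooth_vf_at q Y"
  shows "smooth_fun_at q (\<lambda>r. B r (X r) (Y r))"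
proof (rule smooth_fun_at_cong)
  let ?f = "\<lambda>r. \<Sum>b\<in>Basis. \<Sum>b'\<in>Basis. (vcomp q X r \<bullet> b) * ((vcomp q Y r \<bullet> b') *
      B r (cfield \<kappa> q b r) (cfield \<kappa> q b' r))"
  have "smooth_fun_at q (\<lambda>r. B r (cfield \<kappa> q b r) (cfield \<kappa> q b' r))" for b b'
    using B unfolding smooth_tensor2_def smooth_fun_at_def smooth_in_chart_iff[OF B(2)] by auto
  then show "smooth_fun_at q ?f"
    using XY by (intro smooth_fun_at_sum smooth_fun_at_mult smooth_fun_at_vcomp centre_in_cdom)
  show "eventually (\<lambda>r. ?f r = B r (X r) (Y r)) (nhds q)"
    using eventually_in_cdom[OF centre_in_cdom] eventually_nhds_in_open[OF B(2,3)]
  proof eventually_elim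
    case (elim r)
    have lin: "linear (\<lambda>x. B r x y)" "linear (B r x)" for x y
      using B(1) elim(2) unfolding smooth_tensor2_def bilinear_def by auto
    have "B r (X r) (Y r) = B r (\<Sum>b\<in>Basis. (vcomp q X r \<bullet> b) *\<^sub>R cfield \<kappa> q b r)
        (\<Sum>b\<in>Basis. (vcomp q Y r \<bullet> b) *\<^sub>R cfield \<kappa> q b r)"
      using vcomp_expansion[OF elim(1)] by metis
    also have "\<dots> = ?f r"
      by (simp add: linear_sum[OF lin(1)] linear_cmul[OF lin(1)] linear_sum[OF lin(2)] linear_cmul[OF lin(2)]
          sum_distrib_left) (subst sum.swap, simp add: mult.left_commute)
    finally show ?case by simp
  qed
qed

lemma smooth_tensor2I:
  assumes "\<And>q. bilinear (B q)"
    "\<And>q X Y. smooth_vf_at q X \<Longrightarrow> smooth_vf_at q Y \<Longrightarrow> smooth_fun_at q (\<lambda>r. B r (X r) (Y r))"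
  shows "smooth_tensor2 \<kappa> UNIV B"
  unfolding smooth_tensor2_def smooth_in_chart_iff[OF open_UNIV]
proof (intro conjI ballI allI assms(1))
  fix c w z q assume "q \<in> UNIV \<inter> cdom \<kappa> c"
  then have q: "q \<in> cdom \<kappa> c" by simp
  show "smooth_near (crd \<kappa> c q) (\<lambda>x. B (crd_inv \<kappa> c x) (cfield \<kappa> c w (crd_inv \<kappa> c x))
      (cfield \<kappa> c z (crd_inv \<kappa> c x)))"
    using assms(2)[OF smooth_vf_at_cfield[OF q] smooth_vf_at_cfield[OF q]]
    unfolding smooth_fun_at_chart[OF q] .
qed

lemma smooth_endofield_at:
  assumes A: "smooth_endofield \<kappa> U A" "open U" "q \<in> U" and X: "smooth_vf_at q X"
  shows "smooth_vf_at q (\<lambda>r. A r (X r))"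
proof (rule smooth_vf_at_cong)
  let ?Y = "\<lambda>r. \<Sum>b\<in>Basis. (vcomp q X r \<bullet> b) *\<^sub>R A r (cfield \<kappa> q b r)"
  have "smooth_vf_at q (\<lambda>r. A r (cfield \<kappa> q b r))" for b
    using A unfolding smooth_endofield_def smooth_vf_at_def vcomp_def smooth_in_chart_iff[OF A(2)] by auto
  then show "smooth_vf_at q ?Y"
    using X by (intro smooth_vf_at_sum smooth_vf_at_scaleR smooth_fun_at_vcomp centre_in_cdom)
  show "eventually (\<lambda>r. ?Y r = A r (X r)) (nhds q)"
    using eventually_in_cdom[OF centre_in_cdom] eventually_nhds_in_open[OF A(2,3)]
  proof eventually_elim
    case (elim r)
    have lin: "linear (A r)"
      using A(1) elim(2) unfolding smooth_endofield_def by auto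
    show ?case
      by (subst (2) vcomp_expansion[OF elim(1)]) (simp add: linear_sum[OF lin] linear_cmul[OF lin])
  qed
qed

subsection \<open>Directional derivatives\<close>

lemma ddir_has_derivative:
  "smooth_fun_at q f \<Longrightarrow> ((\<lambda>x. f (crd_inv \<kappa> q x)) has_derivative ddir \<kappa> f q) (at (crd \<kappa> q q))"
  unfolding smooth_fun_at_def ddir_def comp_def by (drule smooth_near_has_derivative) simp

lemma ddirI:
  "((\<lambda>x. f (crd_inv \<kappa> q x)) has_derivative F) (at (crd \<kappa> q q)) \<Longrightarrow> ddir \<kappa> f q v = F v"
  unfolding ddir_def comp_def by (drule frechet_derivative_at) simp

lemma linear_ddir: "smooth_fun_at q f \<Longrightarrow> linear (ddir \<kappa> f q)"
  using ddir_has_derivative has_derivative_linear by blast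

lemma ddir_const: "ddir \<kappa> (\<lambda>r. a) q v = 0"
  by (rule ddirI) simp

lemma ddir_add:
  "smooth_fun_at q f \<Longrightarrow> smooth_fun_at q h \<Longrightarrow>
    ddir \<kappa> (\<lambda>r. f r + h r) q v = ddir \<kappa> f q v + ddir \<kappa> h q v"
  by (intro ddirI has_derivative_add ddir_has_derivative)

lemma ddir_mult:
  "smooth_fun_at q f \<Longrightarrow> smooth_fun_at q h \<Longrightarrow>
    ddir \<kappa> (\<lambda>r. f r * h r) q v = f q * ddir \<kappa> h q v + ddir \<kappa> f q v * h q"
  using ddirI[of "\<lambda>r. f r * h r", OF has_derivative_mult[OF ddir_has_derivative[of q f] ddir_has_derivative[of q h]]]
  by simp

lemma ddir_cmult: "smooth_fun_at q f \<Longrightarrow> ddir \<kappa> (\<lambda>r. a * f r) q v = a * ddir \<kappa> f q v"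
  using ddir_mult[OF smooth_fun_at_const] by (simp add: ddir_const)

lemma ddir_minus: "smooth_fun_at q f \<Longrightarrow> ddir \<kappa> (\<lambda>r. - f r) q v = - ddir \<kappa> f q v"
  using ddir_cmult[of q f "-1"] by simp

lemma ddir_diff:
  "smooth_fun_at q f \<Longrightarrow> smooth_fun_at q h \<Longrightarrow>
    ddir \<kappa> (\<lambda>r. f r - h r) q v = ddir \<kappa> f q v - ddir \<kappa> h q v"
  by (intro ddirI has_derivative_diff ddir_has_derivative)

lemma ddir_sum:
  "(\<And>i. i \<in> I \<Longrightarrow> smooth_fun_at q (f i)) \<Longrightarrow>
    ddir \<kappa> (\<lambda>r. \<Sum>i\<in>I. f i r) q v = (\<Sum>i\<in>I. ddir \<kappa> (f i) q v)"
  by (intro ddirI has_derivative_sum ddir_has_derivative)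

lemma ddir_cong:
  assumes "smooth_fun_at q f" "eventually (\<lambda>r. f r = h r) (nhds q)"
  shows "ddir \<kappa> h q v = ddir \<kappa> f q v"
  using has_derivative_cong_nhds[OF ddir_has_derivative[OF assms(1)]] assms(2)
    eventually_nhds_chart[OF centre_in_cdom, of "\<lambda>r. f r = h r"]
  by (intro ddirI) fast

lemma ddir_chart:
  assumes "smooth_fun_at q f" "q \<in> cdom \<kappa> c"
  shows "ddir \<kappa> f q v = frechet_derivative (\<lambda>x. f (crd_inv \<kappa> c x)) (at (crd \<kappa> c q)) (tr \<kappa> q c q v)"
proof (rule ddirI, rule has_derivative_cong_nhds)
  let ?F = "\<lambda>x. f (crd_inv \<kappa> c x)"
  have "(?F has_derivative frechet_derivative ?F (at (crd \<kappa> c q))) (at (crd \<kappa> c q))"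
    using assms smooth_fun_at_chart smooth_near_has_derivative by blast
  then show "((\<lambda>x. ?F (crd \<kappa> c (crd_inv \<kappa> q x))) has_derivative
      (\<lambda>v. frechet_derivative ?F (at (crd \<kappa> c q)) (tr \<kappa> q c q v))) (at (crd \<kappa> q q))"
    by (intro has_derivative_compose[OF transition_has_derivative[OF centre_in_cdom assms(2)]]) simp
  show "eventually (\<lambda>x. ?F (crd \<kappa> c (crd_inv \<kappa> q x)) = f (crd_inv \<kappa> q x)) (nhds (crd \<kappa> q q))"
    by (rule eventually_mono[OF eventually_in_chart[OF centre_in_cdom assms(2)]]) simp
qed

text \<open>At each point \<open>r\<close> the derivative is taken in the chart of \<open>r\<close>.
  By \<open>ddir_chart\<close> all of them are moved to the chart of \<open>q\<close>, where they
  become partial derivatives of one smooth function with smooth coefficients.\<close>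

lemma smooth_fun_at_ddir:
  assumes f: "smooth_fun_at q f" and X: "smooth_vf_at q X"
  shows "smooth_fun_at q (\<lambda>r. ddir \<kappa> f r (X r))"
  unfolding smooth_fun_at_def
proof (rule smooth_near_cong)
  let ?F = "\<lambda>x. f (crd_inv \<kappa> q x)"
  let ?G = "\<lambda>x. \<Sum>b\<in>Basis. (vcomp q X (crd_inv \<kappa> q x) \<bullet> b) *\<^sub>R frechet_derivative ?F (at x) b"
  show "smooth_near (crd \<kappa> q q) ?G"
    using X f unfolding smooth_vf_at_def smooth_fun_at_def
    by (intro smooth_near_sum smooth_near_scaleR smooth_near_frechet_derivative
        smooth_near_linear[OF bounded_linear_inner_left])
  have "eventually (\<lambda>x. smooth_fun_at (crd_inv \<kappa> q x) f) (nhds (crd \<kappa> q q))"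
    using eventually_nhds_chart[OF centre_in_cdom, of "\<lambda>r. smooth_fun_at r f"]
      eventually_smooth_fun_at[OF f] by simp
  then show "eventually (\<lambda>x. ?G x = ddir \<kappa> f (crd_inv \<kappa> q x) (X (crd_inv \<kappa> q x))) (nhds (crd \<kappa> q q))"
    using eventually_in_chart[OF centre_in_cdom centre_in_cdom] eventually_crd_crd_inv[OF centre_in_cdom]
  proof eventually_elim
    case (elim x)
    define r where "r = crd_inv \<kappa> q x"
    have x: "x = crd \<kappa> q r" "r \<in> cdom \<kappa> q" "smooth_fun_at r f"
      using elim unfolding r_def by auto
    have "(?F has_derivative frechet_derivative ?F (at x)) (at x)"
      unfolding x(1) using x(2,3) smooth_fun_at_chart smooth_near_has_derivative by blast
    then have lin: "linear (frechet_derivative ?F (at x))"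
      using has_derivative_linear by blast
    have "ddir \<kappa> f r (X r) = frechet_derivative ?F (at x) (vcomp q X r)"
      unfolding x(1) vcomp_def using ddir_chart[OF x(3,2)] .
    also have "\<dots> = frechet_derivative ?F (at x) (\<Sum>b\<in>Basis. (vcomp q X r \<bullet> b) *\<^sub>R b)"
      by (simp add: euclidean_representation)
    also have "\<dots> = ?G x"
      unfolding r_def by (simp add: linear_sum[OF lin] linear_cmul[OF lin])
    finally show ?case unfolding r_def by simp
  qed
qed

subsection \<open>Tensoriality\<close>

text \<open>
  The indicator function of a neighbourhood is smooth near its points, so function linearity
  already makes \<open>T\<close> local; no bump functions are needed.
\<close>

lemma function_linear_local:
  fixes T :: "('a, 'v) vfield \<Rightarrow> 'w::real_vector"
  assumes mul: "\<And>f X. smooth_fun_at p f \<Longrightarrow> smooth_vf_at p X \<Longrightarrow> f p = 1 \<Longrightarrow>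
      ddir \<kappa> f p = (\<lambda>v. 0) \<Longrightarrow> T (\<lambda>q. f q *\<^sub>R X q) = T X"
    and X: "smooth_vf_at p X" and XY: "eventually (\<lambda>q. X q = Y q) (nhds p)"
  shows "T X = T Y"
proof -
  obtain U where U: "open U" "p \<in> U" "\<forall>q\<in>U. X q = Y q"
    using XY unfolding eventually_nhds by auto
  let ?f = "\<lambda>q. if q \<in> U then 1 else (0::real)"
  have ev: "eventually (\<lambda>q. 1 = ?f q) (nhds p)"
    using eventually_nhds_in_open[OF U(1,2)] by eventually_elim simp
  have f: "smooth_fun_at p ?f" "ddir \<kappa> ?f p = (\<lambda>v. 0)"
    using smooth_fun_at_cong[OF smooth_fun_at_const ev] ddir_cong[OF smooth_fun_at_const ev]
    by (auto simp: ddir_const)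
  have "(\<lambda>q. ?f q *\<^sub>R X q) = (\<lambda>q. ?f q *\<^sub>R Y q)"
    using U(3) by auto
  then show ?thesis
    using mul[OF f(1) X _ f(2)] mul[OF f(1) smooth_vf_at_cong[OF X XY] _ f(2)] U(2) by simp
qed

text \<open>Near \<open>p\<close> a field equals a combination of coordinate fields, and locality
  allows this replacement. Function linearity then evaluates the sum from the values of the
  coefficients at \<open>p\<close> alone.\<close>

lemma tensorial:
  fixes T :: "('a, 'v) vfield \<Rightarrow> 'w::real_vector"
  assumes add: "\<And>X Y. smooth_vf_at p X \<Longrightarrow> smooth_vf_at p Y \<Longrightarrow> T (\<lambda>q. X q + Y q) = T X + T Y"
    and mul: "\<And>f X. smooth_fun_at p f \<Longrightarrow> smooth_vf_at p X \<Longrightarrow> T (\<lambda>q. f q *\<^sub>R X q) = f p *\<^sub>R T X"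
    and XY: "smooth_vf_at p X" "smooth_vf_at p Y" "X p = Y p"
  shows "T X = T Y"
proof -
  have sum: "T (\<lambda>q. \<Sum>b\<in>B. f b q *\<^sub>R Z b q) = (\<Sum>b\<in>B. f b p *\<^sub>R T (Z b))"
    if "finite B" "\<And>b. smooth_fun_at p (f b)" "\<And>b. smooth_vf_at p (Z b)"
    for B :: "'v set" and f Z
    using that(1)
  proof induction
    case empty
    then show ?case using mul[OF smooth_fun_at_const smooth_vf_at_zero, of 0] by simp
  next
    case (insert b B)
    then show ?case
      using that(2,3) add[of "\<lambda>q. f b q *\<^sub>R Z b q" "\<lambda>q. \<Sum>b\<in>B. f b q *\<^sub>R Z b q"]
      by (simp add: mul smooth_vf_at_scaleR smooth_vf_at_sum)
  qed
  have "T X = (\<Sum>b\<in>Basis. (X p \<bullet> b) *\<^sub>R T (cfield \<kappa> p b))" if X: "smooth_vf_at p X" for X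
  proof -
    have "T X = T (\<lambda>q. \<Sum>b\<in>Basis. (vcomp p X q \<bullet> b) *\<^sub>R cfield \<kappa> p b q)"
    proof (rule function_linear_local[OF _ X])
      show "eventually (\<lambda>q. X q = (\<Sum>b\<in>Basis. (vcomp p X q \<bullet> b) *\<^sub>R cfield \<kappa> p b q)) (nhds p)"
        using eventually_in_cdom[OF centre_in_cdom] by eventually_elim (rule vcomp_expansion)
    qed (simp add: mul)
    also have "\<dots> = (\<Sum>b\<in>Basis. (vcomp p X p \<bullet> b) *\<^sub>R T (cfield \<kappa> p b))"
      by (rule sum) (auto intro: smooth_fun_at_vcomp[OF centre_in_cdom X] smooth_vf_at_cfield)
    finally show ?thesis by (simp add: vcomp_self)
  qed
  then show ?thesis using XY by simp
qed

end

section \<open>Levi-Civita connections on germs of vector fields\<close>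

locale levi_civita_manifold = manifold \<kappa>
  for \<kappa> :: "('a::t2_space, 'v::euclidean_space) atlas" +
  fixes g :: "('a, 'v) tensor2" and D :: "('a, 'v) connection"
  assumes metric: "riemannian_metric \<kappa> g" and lc: "levi_civita \<kappa> g D"
begin

lemma g_bilinear: "bilinear (g p)"
  using metric unfolding riemannian_metric_def smooth_tensor2_def by blast

lemma g_sym: "g p v w = g p w v"
  using metric unfolding riemannian_metric_def by blast

lemma g_pos: "v \<noteq> 0 \<Longrightarrow> g p v v > 0"
  using metric unfolding riemannian_metric_def by blast

lemma smooth_g: "smooth_vf_at p X \<Longrightarrow> smooth_vf_at p Y \<Longrightarrow> smooth_fun_at p (\<lambda>q. g q (X q) (Y q))"
  by (rule smooth_tensor2_at[OF _ open_UNIV UNIV_I])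
    (use metric in \<open>simp_all add: riemannian_metric_def\<close>)

lemma germ_fields2:
  assumes "smooth_vf_at p X" "smooth_vf_at p Y"
  obtains U where "open U" "p \<in> U" "smooth_vfield \<kappa> U X" "smooth_vfield \<kappa> U Y"
proof -
  have "eventually (\<lambda>q. smooth_vf_at q X \<and> smooth_vf_at q Y) (nhds p)"
    by (intro eventually_conj eventually_smooth_vf_at assms)
  then obtain U where "open U" "p \<in> U" "\<forall>q\<in>U. smooth_vf_at q X \<and> smooth_vf_at q Y"
    unfolding eventually_nhds by auto
  then show thesis using that smooth_vfield_iff by simp
qed

lemma affine: "affine_connection \<kappa> D" and torsion: "torsion_free \<kappa> D"
  and compatible_metric: "metric_connection \<kappa> g D"
  using lc unfolding levi_civita_def by auto

lemmas affineD = affine[unfolded affine_connection_def, THEN spec, THEN spec, THEN mp, OF conjI]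

lemma linear_D:
  assumes "smooth_vf_at p X" shows "linear (D X p)"
proof -
  obtain U where U: "open U" "p \<in> U" "smooth_vfield \<kappa> U X" using smooth_vf_at_germ_field[OF assms] .
  show ?thesis using affineD[OF U(1,3), THEN conjunct1, THEN bspec, OF U(2)] .
qed

lemma smooth_D:
  assumes "smooth_vf_at p X" "smooth_vf_at p Y"
  shows "smooth_vf_at p (\<lambda>q. D X q (Y q))"
proof -
  obtain U where U: "open U" "p \<in> U" "smooth_vfield \<kappa> U X" "smooth_vfield \<kappa> U Y"
    using germ_fields2[OF assms] .
  have "smooth_vfield \<kappa> U (\<lambda>q. D X q (Y q))"
    using affineD[OF U(1,3), THEN conjunct2, THEN conjunct1, THEN spec, THEN mp, OF U(4)] .
  then show ?thesis using smooth_vfield_iff[OF U(1)] U(2) by simp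
qed

lemma D_add:
  assumes "smooth_vf_at p X" "smooth_vf_at p Y"
  shows "D (\<lambda>q. X q + Y q) p v = D X p v + D Y p v"
proof -
  obtain U where U: "open U" "p \<in> U" "smooth_vfield \<kappa> U X" "smooth_vfield \<kappa> U Y"
    using germ_fields2[OF assms] .
  show ?thesis
    using affineD[OF U(1,3), THEN conjunct2, THEN conjunct2, THEN conjunct1, THEN spec, THEN mp, OF U(4),
        THEN bspec, OF U(2)] by simp
qed

lemma D_scaleR:
  assumes "smooth_fun_at p f" "smooth_vf_at p X"
  shows "D (\<lambda>q. f q *\<^sub>R X q) p v = ddir \<kappa> f p v *\<^sub>R X p + f p *\<^sub>R D X p v"
proof -
  have "eventually (\<lambda>q. smooth_vf_at q X \<and> smooth_fun_at q f) (nhds p)"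
    by (intro eventually_conj eventually_smooth_vf_at eventually_smooth_fun_at assms)
  then obtain U where U: "open U" "p \<in> U" "\<forall>q\<in>U. smooth_vf_at q X \<and> smooth_fun_at q f"
    unfolding eventually_nhds by auto
  then have Xf: "smooth_vfield \<kappa> U X" "smooth_function \<kappa> U f"
    using smooth_vfield_iff[OF U(1)] smooth_function_iff[OF U(1)] by simp_all
  show ?thesis
    using affineD[OF U(1) Xf(1), THEN conjunct2, THEN conjunct2, THEN conjunct2, THEN spec, THEN mp, OF Xf(2),
        THEN bspec, OF U(2)] by simp
qed

text \<open>Although \<open>D\<close> is not function linear, its Leibniz term vanishes for factors
  with value 1 and zero differential at \<open>p\<close>, and \<open>function_linear_local\<close>
  asks for no more.\<close>

lemma D_cong:
  assumes "smooth_vf_at p X" "eventually (\<lambda>q. X q = Y q) (nhds p)"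
  shows "D Y p v = D X p v"
  using function_linear_local[of p "\<lambda>X. D X p v", OF _ assms] D_scaleR by simp

lemma D_cmult: "smooth_vf_at p X \<Longrightarrow> D (\<lambda>q. a *\<^sub>R X q) p v = a *\<^sub>R D X p v"
  using D_scaleR[OF smooth_fun_at_const] by (simp add: ddir_const)

lemma D_minus: "smooth_vf_at p X \<Longrightarrow> D (\<lambda>q. - X q) p v = - D X p v"
  using D_cmult[of p X "-1"] by simp

lemma D_diff:
  "smooth_vf_at p X \<Longrightarrow> smooth_vf_at p Y \<Longrightarrow> D (\<lambda>q. X q - Y q) p v = D X p v - D Y p v"
  using D_add[of p X "\<lambda>q. - Y q"] D_minus[of p Y] smooth_vf_at_minus[of p Y] by simp

lemma D_metric:
  assumes "smooth_vf_at p X" "smooth_vf_at p Y"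
  shows "ddir \<kappa> (\<lambda>q. g q (X q) (Y q)) p v = g p (D X p v) (Y p) + g p (X p) (D Y p v)"
proof -
  obtain U where U: "open U" "p \<in> U" "smooth_vfield \<kappa> U X" "smooth_vfield \<kappa> U Y"
    using germ_fields2[OF assms] .
  show ?thesis
    using compatible_metric[unfolded metric_connection_def, THEN spec, THEN spec, THEN spec, THEN mp,
        OF conjI[OF U(1) conjI[OF U(3,4)]], THEN bspec, OF U(2)] by simp
qed

lemma D_torsion:
  assumes "smooth_vf_at p X" "smooth_vf_at p Y" "smooth_fun_at p f"
  shows "ddir \<kappa> f p (D Y p (X p) - D X p (Y p)) =
    ddir \<kappa> (\<lambda>q. ddir \<kappa> f q (Y q)) p (X p) - ddir \<kappa> (\<lambda>q. ddir \<kappa> f q (X q)) p (Y p)"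
proof -
  have "eventually (\<lambda>q. smooth_vf_at q X \<and> smooth_vf_at q Y \<and> smooth_fun_at q f) (nhds p)"
    by (intro eventually_conj eventually_smooth_vf_at eventually_smooth_fun_at assms)
  then obtain U where U: "open U" "p \<in> U"
    "\<forall>q\<in>U. smooth_vf_at q X \<and> smooth_vf_at q Y \<and> smooth_fun_at q f"
    unfolding eventually_nhds by auto
  then have XYf: "smooth_vfield \<kappa> U X" "smooth_vfield \<kappa> U Y" "smooth_function \<kappa> U f"
    using smooth_vfield_iff[OF U(1)] smooth_function_iff[OF U(1)] by simp_all
  show ?thesis
    using torsion[unfolded torsion_free_def, THEN spec, THEN spec, THEN spec, THEN spec, THEN mp,
        OF conjI[OF U(1) conjI[OF XYf(1) conjI[OF XYf(2,3)]]], THEN bspec, OF U(2)] .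
qed

text \<open>
  The Lie bracket of two coordinate fields annihilates the coordinate functions, hence vanishes.
\<close>

lemma cfield_commute:
  assumes "q \<in> cdom \<kappa> c"
  shows "D (cfield \<kappa> c w) q (cfield \<kappa> c z q) = D (cfield \<kappa> c z) q (cfield \<kappa> c w q)"
proof -
  let ?x = "\<lambda>b r. crd \<kappa> c r \<bullet> b"
  have x: "smooth_fun_at r (?x b)" and dx: "ddir \<kappa> (?x b) r v = tr \<kappa> r c r v \<bullet> b"
    if r: "r \<in> cdom \<kappa> c" for r b v
  proof -
    have ev: "eventually (\<lambda>y. y \<bullet> b = ?x b (crd_inv \<kappa> c y)) (nhds (crd \<kappa> c r))"
      using eventually_crd_crd_inv[OF r] by eventually_elim simp
    show *: "smooth_fun_at r (?x b)"
      unfolding smooth_fun_at_chart[OF r]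
      by (rule smooth_near_cong[OF smooth_near_linear[OF bounded_linear_inner_left smooth_near_id] ev])
    have "((\<lambda>y. y \<bullet> b) has_derivative (\<lambda>v. v \<bullet> b)) (at (crd \<kappa> c r))"
      by (intro has_derivative_inner_left has_derivative_ident)
    from frechet_derivative_at[OF has_derivative_cong_nhds[OF this ev]]
    show "ddir \<kappa> (?x b) r v = tr \<kappa> r c r v \<bullet> b"
      unfolding ddir_chart[OF * r] by metis
  qed
  have const: "ddir \<kappa> (\<lambda>r. ddir \<kappa> (?x b) r (cfield \<kappa> c w r)) q v = 0" for b w v
  proof -
    have "eventually (\<lambda>r. w \<bullet> b = ddir \<kappa> (?x b) r (cfield \<kappa> c w r)) (nhds q)"
      using eventually_in_cdom[OF assms]
      by eventually_elim (simp add: dx vcomp_def[symmetric] vcomp_cfield)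
    from ddir_cong[OF smooth_fun_at_const this] show ?thesis by (simp add: ddir_const)
  qed
  let ?d = "D (cfield \<kappa> c z) q (cfield \<kappa> c w q) - D (cfield \<kappa> c w) q (cfield \<kappa> c z q)"
  have "tr \<kappa> q c q ?d \<bullet> b = 0" for b
    using D_torsion[OF smooth_vf_at_cfield[OF assms, of w] smooth_vf_at_cfield[OF assms, of z]
        x[OF assms, of b]] dx[OF assms] const by simp
  then have "tr \<kappa> q c q ?d = 0"
    by (metis inner_eq_zero_iff)
  then have "tr \<kappa> c q q (tr \<kappa> q c q ?d) = 0"
    using linear_tr[OF assms centre_in_cdom] linear_0 by metis
  then have "?d = 0"
    using tr_tr[of q q c q] tr_same[of q q] assms by simp
  then show ?thesis by simp
qed

subsection \<open>Covariant derivatives of tensor fields\<close>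

lemma ddir_tensor2_linear:
  assumes B: "smooth_tensor2 \<kappa> U B" "open U" "p \<in> U"
    and X: "smooth_vf_at p X" and Y: "smooth_vf_at p Y"
  shows "smooth_vf_at p X' \<Longrightarrow> ddir \<kappa> (\<lambda>q. B q (X q + X' q) (Y q)) p v =
      ddir \<kappa> (\<lambda>q. B q (X q) (Y q)) p v + ddir \<kappa> (\<lambda>q. B q (X' q) (Y q)) p v"
    and "smooth_vf_at p X' \<Longrightarrow> ddir \<kappa> (\<lambda>q. B q (Y q) (X q + X' q)) p v =
      ddir \<kappa> (\<lambda>q. B q (Y q) (X q)) p v + ddir \<kappa> (\<lambda>q. B q (Y q) (X' q)) p v"
    and "smooth_fun_at p f \<Longrightarrow> ddir \<kappa> (\<lambda>q. B q (f q *\<^sub>R X q) (Y q)) p v =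
      ddir \<kappa> (\<lambda>q. f q * B q (X q) (Y q)) p v"
    and "smooth_fun_at p f \<Longrightarrow> ddir \<kappa> (\<lambda>q. B q (Y q) (f q *\<^sub>R X q)) p v =
      ddir \<kappa> (\<lambda>q. f q * B q (Y q) (X q)) p v"
proof -
  note sB = smooth_tensor2_at[OF B]
  have U: "eventually (\<lambda>q. bilinear (B q)) (nhds p)"
    using eventually_nhds_in_open[OF B(2,3)] B(1) unfolding smooth_tensor2_def by (auto elim: eventually_mono)
  have "eventually (\<lambda>q. B q (X q) (Y q) + B q (X' q) (Y q) = B q (X q + X' q) (Y q)) (nhds p)"
    using U by eventually_elim (simp add: bilinear_ladd)
  from ddir_cong[OF smooth_fun_at_add[OF sB sB] this] X Y
  show "smooth_vf_at p X' \<Longrightarrow> ddir \<kappa> (\<lambda>q. B q (X q + X' q) (Y q)) p v =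
      ddir \<kappa> (\<lambda>q. B q (X q) (Y q)) p v + ddir \<kappa> (\<lambda>q. B q (X' q) (Y q)) p v"
    by (simp add: ddir_add sB)
  have "eventually (\<lambda>q. B q (Y q) (X q) + B q (Y q) (X' q) = B q (Y q) (X q + X' q)) (nhds p)"
    using U by eventually_elim (simp add: bilinear_radd)
  from ddir_cong[OF smooth_fun_at_add[OF sB sB] this] X Y
  show "smooth_vf_at p X' \<Longrightarrow> ddir \<kappa> (\<lambda>q. B q (Y q) (X q + X' q)) p v =
      ddir \<kappa> (\<lambda>q. B q (Y q) (X q)) p v + ddir \<kappa> (\<lambda>q. B q (Y q) (X' q)) p v"
    by (simp add: ddir_add sB)
  assume f: "smooth_fun_at p f"
  have "eventually (\<lambda>q. f q * B q (X q) (Y q) = B q (f q *\<^sub>R X q) (Y q)) (nhds p)"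
    using U by eventually_elim (simp add: bilinear_lmul)
  from ddir_cong[OF smooth_fun_at_mult[OF f sB] this] X Y
  show "ddir \<kappa> (\<lambda>q. B q (f q *\<^sub>R X q) (Y q)) p v = ddir \<kappa> (\<lambda>q. f q * B q (X q) (Y q)) p v"
    by simp
  have "eventually (\<lambda>q. f q * B q (Y q) (X q) = B q (Y q) (f q *\<^sub>R X q)) (nhds p)"
    using U by eventually_elim (simp add: bilinear_rmul)
  from ddir_cong[OF smooth_fun_at_mult[OF f sB] this] X Y
  show "ddir \<kappa> (\<lambda>q. B q (Y q) (f q *\<^sub>R X q)) p v = ddir \<kappa> (\<lambda>q. f q * B q (Y q) (X q)) p v"
    by simp
qed

text \<open>\<open>covd2\<close> is defined with coordinate fields. The derivatives of coefficient
  functions coming from the first term and from the connection terms cancel, so the combination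
  \<open>T\<close> is tensorial in each field.\<close>

lemma covd2_field_on:
  assumes B: "smooth_tensor2 \<kappa> U B" "open U" "p \<in> U" and X: "smooth_vf_at p X" and Y: "smooth_vf_at p Y"
  shows "ddir \<kappa> (\<lambda>q. B q (X q) (Y q)) p v =
    covd2 \<kappa> D B p v (X p) (Y p) + B p (D X p v) (Y p) + B p (X p) (D Y p v)"
proof -
  define T where "T X Y = ddir \<kappa> (\<lambda>q. B q (X q) (Y q)) p v - B p (D X p v) (Y p) - B p (X p) (D Y p v)"
    for X Y
  note sB = smooth_tensor2_at[OF B]
  note ddir_B = ddir_tensor2_linear[OF B]
  have bl: "bilinear (B p)" using B unfolding smooth_tensor2_def by auto
  note bl = bilinear_ladd[OF bl] bilinear_radd[OF bl] bilinear_lmul[OF bl] bilinear_rmul[OF bl]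
  let ?cX = "cfield \<kappa> p (X p)" and ?cY = "cfield \<kappa> p (Y p)"
  have c: "smooth_vf_at p ?cX" "smooth_vf_at p ?cY" by (auto intro: smooth_vf_at_cfield)
  have "T X Y = T ?cX Y"
  proof (rule tensorial[of p "\<lambda>X. T X Y"])
    show "T (\<lambda>q. X q + X' q) Y = T X Y + T X' Y" if "smooth_vf_at p X" "smooth_vf_at p X'" for X X'
      unfolding T_def using that Y by (simp add: bl D_add ddir_B ddir_add sB)
    show "T (\<lambda>q. f q *\<^sub>R X q) Y = f p *\<^sub>R T X Y" if "smooth_fun_at p f" "smooth_vf_at p X" for f X
      unfolding T_def using that Y by (simp add: bl D_scaleR ddir_B ddir_mult sB algebra_simps)
  qed (use X c in \<open>auto simp: cfield_self\<close>)
  also have "\<dots> = T ?cX ?cY"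
  proof (rule tensorial[of p "\<lambda>Y. T ?cX Y"])
    show "T ?cX (\<lambda>q. X q + X' q) = T ?cX X + T ?cX X'" if "smooth_vf_at p X" "smooth_vf_at p X'" for X X'
      unfolding T_def using that c by (simp add: bl D_add ddir_B ddir_add sB)
    show "T ?cX (\<lambda>q. f q *\<^sub>R X q) = f p *\<^sub>R T ?cX X" if "smooth_fun_at p f" "smooth_vf_at p X" for f X
      unfolding T_def using that c by (simp add: bl D_scaleR ddir_B ddir_mult sB algebra_simps)
  qed (use Y c in \<open>auto simp: cfield_self\<close>)
  also have "\<dots> = covd2 \<kappa> D B p v (X p) (Y p)"
    unfolding T_def covd2_def by (simp add: cfield_self)
  finally show ?thesis unfolding T_def by simp
qed

lemmas covd2_field = covd2_field_on[OF _ open_UNIV UNIV_I]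

lemma smooth_covd2:
  assumes B: "smooth_tensor2 \<kappa> UNIV B"
    and X: "smooth_vf_at p X" and Y: "smooth_vf_at p Y" and Z: "smooth_vf_at p Z"
  shows "smooth_fun_at p (\<lambda>q. covd2 \<kappa> D B q (Z q) (X q) (Y q))"
proof (rule smooth_fun_at_cong)
  let ?f = "\<lambda>q. ddir \<kappa> (\<lambda>q. B q (X q) (Y q)) q (Z q) - B q (D X q (Z q)) (Y q) - B q (X q) (D Y q (Z q))"
  show "smooth_fun_at p ?f"
    by (intro smooth_fun_at_diff smooth_fun_at_ddir smooth_tensor2_at[OF B open_UNIV UNIV_I] smooth_D X Y Z)
  show "eventually (\<lambda>q. ?f q = covd2 \<kappa> D B q (Z q) (X q) (Y q)) (nhds p)"
    using eventually_smooth_vf_at[OF X] eventually_smooth_vf_at[OF Y]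
    by eventually_elim (simp add: covd2_field[OF B])
qed

lemma linear_covd2:
  assumes B: "smooth_tensor2 \<kappa> UNIV B"
  shows "linear (\<lambda>v. covd2 \<kappa> D B p v w z)"
proof -
  have c: "smooth_vf_at p (cfield \<kappa> p w)" for w by (auto intro: smooth_vf_at_cfield)
  have "linear (ddir \<kappa> (\<lambda>q. B q (cfield \<kappa> p w q) (cfield \<kappa> p z q)) p)"
    by (intro linear_ddir smooth_tensor2_at[OF B open_UNIV UNIV_I] c)
  moreover have "linear (\<lambda>v. B p (D (cfield \<kappa> p w) p v) z)" "linear (\<lambda>v. B p w (D (cfield \<kappa> p z) p v))"
    using linear_compose[OF linear_D[OF c[of w]], where g = "\<lambda>x. B p x z"]
      linear_compose[OF linear_D[OF c[of z]], where g = "B p w"] B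
    unfolding smooth_tensor2_def bilinear_def comp_def by simp_all
  ultimately show ?thesis
    unfolding covd2_def by (intro linear_compose_sub)
qed

lemma covd_endo_field:
  assumes A: "smooth_endofield \<kappa> U A" "open U" "p \<in> U" and X: "smooth_vf_at p X"
  shows "D (\<lambda>q. A q (X q)) p v = covd_endo \<kappa> D A p v (X p) + A p (D X p v)"
proof -
  define T where "T X = D (\<lambda>q. A q (X q)) p v - A p (D X p v)" for X
  note sA = smooth_endofield_at[OF A]
  have lin: "linear (A q)" if "q \<in> U" for q
    using A(1) that unfolding smooth_endofield_def by blast
  have "T X = T (cfield \<kappa> p (X p))"
  proof (rule tensorial[of p T])
    fix Y Z assume YZ: "smooth_vf_at p Y" "smooth_vf_at p Z"
    have "eventually (\<lambda>q. A q (Y q) + A q (Z q) = A q (Y q + Z q)) (nhds p)"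
      using eventually_nhds_in_open[OF A(2,3)] by eventually_elim (simp add: linear_add[OF lin])
    from D_cong[OF smooth_vf_at_add[OF sA sA] this] YZ
    show "T (\<lambda>q. Y q + Z q) = T Y + T Z"
      unfolding T_def by (simp add: D_add sA linear_add[OF lin[OF A(3)]])
  next
    fix f Y assume f: "smooth_fun_at p f" and Y: "smooth_vf_at p Y"
    have "eventually (\<lambda>q. f q *\<^sub>R A q (Y q) = A q (f q *\<^sub>R Y q)) (nhds p)"
      using eventually_nhds_in_open[OF A(2,3)] by eventually_elim (simp add: linear_cmul[OF lin])
    from D_cong[OF smooth_vf_at_scaleR[OF f sA] this] f Y
    show "T (\<lambda>q. f q *\<^sub>R Y q) = f p *\<^sub>R T Y"
      unfolding T_def
      by (simp add: D_scaleR sA linear_add[OF lin[OF A(3)]] linear_cmul[OF lin[OF A(3)]] algebra_simps)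
  qed (use X in \<open>auto simp: cfield_self intro: smooth_vf_at_cfield\<close>)
  then show ?thesis
    unfolding T_def covd_endo_def by (simp add: cfield_self diff_eq_eq)
qed

subsection \<open>Curvature\<close>

text \<open>The curvature operator on arbitrary fields, with the bracket written as
  \<open>D Y p (X p) - D X p (Y p)\<close>; this is correct because the torsion vanishes. The
  bracket term is absent from \<open>curvature\<close>, where coordinate fields commute.\<close>

definition curv_op :: "('a, 'v) vfield \<Rightarrow> ('a, 'v) vfield \<Rightarrow> ('a, 'v) vfield \<Rightarrow> ('a, 'v) vfield" where
  "curv_op X Y Z p = D (\<lambda>q. D Z q (Y q)) p (X p) - D (\<lambda>q. D Z q (X q)) p (Y p)
     - D Z p (D Y p (X p) - D X p (Y p))"

lemma smooth_curv_op:
  "smooth_vf_at p X \<Longrightarrow> smooth_vf_at p Y \<Longrightarrow> smooth_vf_at p Z \<Longrightarrow> smooth_vf_at p (curv_op X Y Z)"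
  unfolding curv_op_def[abs_def] by (intro smooth_vf_at_diff smooth_D)

lemma curv_op_swap:
  assumes "smooth_vf_at p Z"
  shows "curv_op Y X Z p = - curv_op X Y Z p"
  unfolding curv_op_def using linear_diff[OF linear_D[OF assms]] by simp

lemma curv_op_add1:
  assumes "smooth_vf_at p X" "smooth_vf_at p X'" "smooth_vf_at p Y" "smooth_vf_at p Z"
  shows "curv_op (\<lambda>q. X q + X' q) Y Z p = curv_op X Y Z p + curv_op X' Y Z p"
proof -
  have "eventually (\<lambda>q. D Z q (X q) + D Z q (X' q) = D Z q (X q + X' q)) (nhds p)"
    using eventually_smooth_vf_at[OF assms(4)] by eventually_elim (simp add: linear_add[OF linear_D])
  from D_cong[OF smooth_vf_at_add[OF smooth_D smooth_D] this] assms
  show ?thesis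
    unfolding curv_op_def by (simp add: smooth_D D_add linear_add[OF linear_D] linear_diff[OF linear_D])
qed

lemma curv_op_scaleR1:
  assumes "smooth_fun_at p f" "smooth_vf_at p X" "smooth_vf_at p Y" "smooth_vf_at p Z"
  shows "curv_op (\<lambda>q. f q *\<^sub>R X q) Y Z p = f p *\<^sub>R curv_op X Y Z p"
proof -
  have "eventually (\<lambda>q. f q *\<^sub>R D Z q (X q) = D Z q (f q *\<^sub>R X q)) (nhds p)"
    using eventually_smooth_vf_at[OF assms(4)] by eventually_elim (simp add: linear_cmul[OF linear_D])
  from D_cong[OF smooth_vf_at_scaleR[OF _ smooth_D] this] assms
  show ?thesis
    unfolding curv_op_def
    by (simp add: smooth_D D_scaleR linear_add[OF linear_D] linear_diff[OF linear_D]
        linear_cmul[OF linear_D] algebra_simps)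
qed

lemma curv_op_add3:
  assumes "smooth_vf_at p Z" "smooth_vf_at p Z'" "smooth_vf_at p X" "smooth_vf_at p Y"
  shows "curv_op X Y (\<lambda>q. Z q + Z' q) p = curv_op X Y Z p + curv_op X Y Z' p"
proof -
  have "D (\<lambda>q. D (\<lambda>q. Z q + Z' q) q (W q)) p v = D (\<lambda>q. D Z q (W q)) p v + D (\<lambda>q. D Z' q (W q)) p v"
    if W: "smooth_vf_at p W" for W v
  proof -
    have "eventually (\<lambda>q. D Z q (W q) + D Z' q (W q) = D (\<lambda>q. Z q + Z' q) q (W q)) (nhds p)"
      using eventually_smooth_vf_at[OF assms(1)] eventually_smooth_vf_at[OF assms(2)]
      by eventually_elim (simp add: D_add)
    from D_cong[OF smooth_vf_at_add[OF smooth_D smooth_D] this] assms W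
    show ?thesis by (simp add: D_add smooth_D)
  qed
  then show ?thesis
    unfolding curv_op_def using assms by (simp add: D_add)
qed

text \<open>The Leibniz rule leaves second derivatives of \<open>f\<close>. By vanishing torsion
  their commutator is the derivative of \<open>f\<close> along the bracket, which cancels against
  the bracket term.\<close>

lemma curv_op_scaleR3:
  assumes f: "smooth_fun_at p f" and Z: "smooth_vf_at p Z"
    and X: "smooth_vf_at p X" and Y: "smooth_vf_at p Y"
  shows "curv_op X Y (\<lambda>q. f q *\<^sub>R Z q) p = f p *\<^sub>R curv_op X Y Z p"
proof -
  have *: "D (\<lambda>q. D (\<lambda>q. f q *\<^sub>R Z q) q (W q)) p v =
      ddir \<kappa> (\<lambda>q. ddir \<kappa> f q (W q)) p v *\<^sub>R Z p + ddir \<kappa> f p (W p) *\<^sub>R D Z p v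
      + ddir \<kappa> f p v *\<^sub>R D Z p (W p) + f p *\<^sub>R D (\<lambda>q. D Z q (W q)) p v"
    if W: "smooth_vf_at p W" for W v
  proof -
    have "eventually (\<lambda>q. ddir \<kappa> f q (W q) *\<^sub>R Z q + f q *\<^sub>R D Z q (W q) =
        D (\<lambda>q. f q *\<^sub>R Z q) q (W q)) (nhds p)"
      using eventually_smooth_fun_at[OF f] eventually_smooth_vf_at[OF Z]
      by eventually_elim (simp add: D_scaleR)
    from D_cong[OF smooth_vf_at_add[OF smooth_vf_at_scaleR smooth_vf_at_scaleR] this] f Z W
    show ?thesis by (simp add: D_add D_scaleR smooth_D smooth_fun_at_ddir smooth_vf_at_scaleR)
  qed
  have "ddir \<kappa> (\<lambda>q. ddir \<kappa> f q (Y q)) p (X p) =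
      ddir \<kappa> (\<lambda>q. ddir \<kappa> f q (X q)) p (Y p) + ddir \<kappa> f p (D Y p (X p) - D X p (Y p))"
    using D_torsion[OF X Y f] by simp
  then show ?thesis
    unfolding curv_op_def *[OF X] *[OF Y] D_scaleR[OF f Z] by (simp add: algebra_simps)
qed

lemma curvature_field:
  assumes X: "smooth_vf_at p X" and Y: "smooth_vf_at p Y" and Z: "smooth_vf_at p Z"
  shows "curvature \<kappa> D p (X p) (Y p) (Z p) = curv_op X Y Z p"
proof -
  let ?cX = "cfield \<kappa> p (X p)" and ?cY = "cfield \<kappa> p (Y p)" and ?cZ = "cfield \<kappa> p (Z p)"
  have c: "smooth_vf_at p ?cX" "smooth_vf_at p ?cY" "smooth_vf_at p ?cZ"
    by (auto intro: smooth_vf_at_cfield)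
  have 1: "curv_op X Y Z p = curv_op ?cX Y Z p" if "smooth_vf_at p Y" "smooth_vf_at p Z" for Y Z
    using that X c by (intro tensorial[of p "\<lambda>X. curv_op X Y Z p"])
      (auto simp: curv_op_add1 curv_op_scaleR1 cfield_self)
  have 2: "curv_op ?cX Y Z p = curv_op ?cX ?cY Z p" if "smooth_vf_at p Z" for Z
  proof -
    have "curv_op Y ?cX Z p = curv_op ?cY ?cX Z p"
      using that Y c by (intro tensorial[of p "\<lambda>Y. curv_op Y ?cX Z p"])
        (auto simp: curv_op_add1 curv_op_scaleR1 cfield_self)
    then show ?thesis using curv_op_swap[OF that] by metis
  qed
  have 3: "curv_op ?cX ?cY Z p = curv_op ?cX ?cY ?cZ p"
    using Z c by (intro tensorial[of p "\<lambda>Z. curv_op ?cX ?cY Z p"])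
      (auto simp: curv_op_add3 curv_op_scaleR3 cfield_self)
  have "curv_op ?cX ?cY ?cZ p = curvature \<kappa> D p (X p) (Y p) (Z p)"
    unfolding curv_op_def curvature_def
    using cfield_commute[OF centre_in_cdom, of p "X p" "Y p"] linear_0[OF linear_D[OF c(3)]]
    by (simp add: cfield_self)
  then show ?thesis using 1[OF Y Z] 2[OF Z] 3 by simp
qed

text \<open>The fields belong to the chart of \<open>p\<close>, but the point \<open>q\<close> may
  be anywhere in its domain. This is what allows the curvature to be differentiated along coordinate
  fields.\<close>

lemma curvature_cfield:
  assumes "q \<in> cdom \<kappa> p" "smooth_vf_at q V"
  shows "curvature \<kappa> D q (cfield \<kappa> p x q) (cfield \<kappa> p y q) (V q) =
    D (\<lambda>r. D V r (cfield \<kappa> p y r)) q (cfield \<kappa> p x q) - D (\<lambda>r. D V r (cfield \<kappa> p x r)) q (cfield \<kappa> p y q)"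
  unfolding curvature_field[OF smooth_vf_at_cfield smooth_vf_at_cfield assms(2), OF assms(1,1)]
    curv_op_def cfield_commute[OF assms(1), of x y]
  using linear_0[OF linear_D[OF assms(2)]] by simp

lemma curvature_swap: "curvature \<kappa> D p y x z = - curvature \<kappa> D p x y z"
  unfolding curvature_def by simp

lemma linear_curvature1: "linear (\<lambda>x. curvature \<kappa> D p x y z)"
proof (rule linearI)
  have c: "smooth_vf_at p (cfield \<kappa> p w)" for w by (auto intro: smooth_vf_at_cfield)
  have eq: "curvature \<kappa> D p x y z = curv_op (cfield \<kappa> p x) (cfield \<kappa> p y) (cfield \<kappa> p z) p" for x
    using curvature_field[OF c c c] by (simp add: cfield_self)
  show "curvature \<kappa> D p (x + x') y z = curvature \<kappa> D p x y z + curvature \<kappa> D p x' y z" for x x'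
    using curvature_field[OF smooth_vf_at_add[OF c c] c c, of x x' y z]
    by (simp add: cfield_self curv_op_add1 c eq)
  show "curvature \<kappa> D p (a *\<^sub>R x) y z = a *\<^sub>R curvature \<kappa> D p x y z" for a x
    using curvature_field[OF smooth_vf_at_scaleR[OF smooth_fun_at_const c] c c, of a x y z]
    by (simp add: cfield_self curv_op_scaleR1 smooth_fun_at_const c eq)
qed

lemma linear_curvature2: "linear (\<lambda>y. curvature \<kappa> D p x y z)"
  using linear_compose_neg[OF linear_curvature1[of p x z]] curvature_swap[of p _ x z] by simp

lemma linear_curvature3: "linear (\<lambda>z. curvature \<kappa> D p x y z)"
proof (rule linearI)
  have c: "smooth_vf_at p (cfield \<kappa> p w)" for w by (auto intro: smooth_vf_at_cfield)
  have eq: "curvature \<kappa> D p x y z = curv_op (cfield \<kappa> p x) (cfield \<kappa> p y) (cfield \<kappa> p z) p" for z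
    using curvature_field[OF c c c] by (simp add: cfield_self)
  show "curvature \<kappa> D p x y (z + z') = curvature \<kappa> D p x y z + curvature \<kappa> D p x y z'" for z z'
    using curvature_field[OF c c smooth_vf_at_add[OF c c], of x y z z']
    by (simp add: cfield_self curv_op_add3 c eq)
  show "curvature \<kappa> D p x y (a *\<^sub>R z) = a *\<^sub>R curvature \<kappa> D p x y z" for a z
    using curvature_field[OF c c smooth_vf_at_scaleR[OF smooth_fun_at_const c], of x y a z]
    by (simp add: cfield_self curv_op_scaleR3 smooth_fun_at_const c eq)
qed

text \<open>In coordinate fields the six second derivatives cancel in pairs. The inner derivatives
  \<open>D (?c w) q (?c z q)\<close> must be symmetric on a whole neighbourhood of \<open>p\<close>
  for this, not only at \<open>p\<close>.\<close>

lemma curvature_bianchi: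
  "curvature \<kappa> D p x y z + curvature \<kappa> D p y z x + curvature \<kappa> D p z x y = 0"
proof -
  let ?c = "cfield \<kappa> p"
  have c: "smooth_vf_at p (?c w)" for w by (auto intro: smooth_vf_at_cfield)
  have "D (\<lambda>q. D (?c w) q (?c z q)) p v = D (\<lambda>q. D (?c z) q (?c w q)) p v" for w z v
    by (rule D_cong[OF smooth_D[OF c c]])
      (use eventually_in_cdom[OF centre_in_cdom] in eventually_elim, rule cfield_commute)
  note sw = this
  show ?thesis
    unfolding curvature_def sw[of z y x] sw[of z x y] sw[of x y z] by (simp add: cfield_self sw[of y x z])
qed

lemma ddir_cfield_commute:
  assumes "smooth_fun_at p f"
  shows "ddir \<kappa> (\<lambda>q. ddir \<kappa> f q (cfield \<kappa> p y q)) p x = ddir \<kappa> (\<lambda>q. ddir \<kappa> f q (cfield \<kappa> p x q)) p y"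
proof -
  have c: "smooth_vf_at p (cfield \<kappa> p w)" for w by (auto intro: smooth_vf_at_cfield)
  show ?thesis
    using D_torsion[OF c c assms, of x y] cfield_commute[OF centre_in_cdom, of p x y]
      linear_0[OF linear_ddir[OF assms]] by (simp add: cfield_self)
qed

text \<open>\<open>S x y\<close> is the second covariant derivative of \<open>B\<close> without the
  term containing \<open>D (cfield \<kappa> p y) p x\<close>. For coordinate fields that term is
  symmetric in \<open>x\<close> and \<open>y\<close>, so it drops out of the difference.\<close>

lemma ricci_identity:
  assumes B: "smooth_tensor2 \<kappa> UNIV B" and V: "smooth_vf_at p V" and W: "smooth_vf_at p W"
  defines "S \<equiv> \<lambda>x y. ddir \<kappa> (\<lambda>q. covd2 \<kappa> D B q (cfield \<kappa> p y q) (V q) (W q)) p x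
    - covd2 \<kappa> D B p y (D V p x) (W p) - covd2 \<kappa> D B p y (V p) (D W p x)"
  shows "S x y - S y x =
    - B p (curvature \<kappa> D p x y (V p)) (W p) - B p (V p) (curvature \<kappa> D p x y (W p))"
proof -
  have c: "smooth_vf_at p (cfield \<kappa> p w)" for w by (auto intro: smooth_vf_at_cfield)
  note sB = smooth_tensor2_at[OF B open_UNIV UNIV_I]
  have bl: "bilinear (B q)" for q using B unfolding smooth_tensor2_def by auto
  have *: "ddir \<kappa> (\<lambda>q. ddir \<kappa> (\<lambda>q. B q (V q) (W q)) q (cfield \<kappa> p y q)) p x =
      S x y + covd2 \<kappa> D B p y (D V p x) (W p) + covd2 \<kappa> D B p y (V p) (D W p x)
      + covd2 \<kappa> D B p x (D V p y) (W p) + covd2 \<kappa> D B p x (V p) (D W p y)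
      + B p (D (\<lambda>q. D V q (cfield \<kappa> p y q)) p x) (W p) + B p (V p) (D (\<lambda>q. D W q (cfield \<kappa> p y q)) p x)
      + B p (D V p y) (D W p x) + B p (D V p x) (D W p y)" for x y
  proof -
    have "eventually (\<lambda>q. covd2 \<kappa> D B q (cfield \<kappa> p y q) (V q) (W q) + B q (D V q (cfield \<kappa> p y q)) (W q)
        + B q (V q) (D W q (cfield \<kappa> p y q)) = ddir \<kappa> (\<lambda>q. B q (V q) (W q)) q (cfield \<kappa> p y q)) (nhds p)"
      using eventually_smooth_vf_at[OF V] eventually_smooth_vf_at[OF W]
      by eventually_elim (simp add: covd2_field[OF B])
    from ddir_cong[OF _ this, of x]
    show ?thesis
      unfolding S_def
      by (simp add: ddir_add smooth_fun_at_add smooth_covd2[OF B] sB V W c smooth_D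
          covd2_field[OF B] cfield_self)
  qed
  have R: "curvature \<kappa> D p x y (Z p) = D (\<lambda>r. D Z r (cfield \<kappa> p y r)) p x - D (\<lambda>r. D Z r (cfield \<kappa> p x r)) p y"
    if "smooth_vf_at p Z" for Z
    using curvature_cfield[OF centre_in_cdom that, of x y] by (simp add: cfield_self)
  show ?thesis
    using ddir_cfield_commute[OF sB[OF V W], of y x] unfolding *[of x y] *[of y x] R[OF V] R[OF W]
    by (simp add: bilinear_lsub[OF bl] bilinear_rsub[OF bl])
qed

text \<open>The Ricci identity for the metric: its covariant derivative vanishes identically, and so
  does the left side.\<close>

lemma curvature_skew: "g p (curvature \<kappa> D p x y v) w = - g p v (curvature \<kappa> D p x y w)"
proof -
  have gT: "smooth_tensor2 \<kappa> UNIV g" using metric unfolding riemannian_metric_def by blast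
  have "covd2 \<kappa> D g q v w z = 0" for q v w z
    unfolding covd2_def using D_metric[OF smooth_vf_at_cfield smooth_vf_at_cfield, of q q q w z v]
    by (simp add: cfield_self)
  then show ?thesis
    using ricci_identity[OF gT smooth_vf_at_cfield[OF centre_in_cdom, of p v]
        smooth_vf_at_cfield[OF centre_in_cdom, of p w], of y x] by (simp add: cfield_self ddir_const)
qed

text \<open>For coordinate fields, \<open>K a b c\<close> is the double commutator [D_a, [D_b, D_c]]
  applied to \<open>V\<close>, that is the derivative of the curvature acting on \<open>V\<close>.
  The claim is the Jacobi identity.\<close>

lemma second_bianchi:
  fixes a b c :: 'v
  assumes V: "smooth_vf_at p V"
  defines "E \<equiv> cfield \<kappa> p"
  defines "K \<equiv> \<lambda>a b c. D (\<lambda>q. D (\<lambda>r. D V r (E c r)) q (E b q) - D (\<lambda>r. D V r (E b r)) q (E c q)) p a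
    - (D (\<lambda>q. D (\<lambda>r. D V r (E a r)) q (E c q)) p b - D (\<lambda>q. D (\<lambda>r. D V r (E a r)) q (E b q)) p c)"
  shows "K a b c + K b c a + K c a b = 0"
proof -
  have c: "smooth_vf_at p (E w)" for w unfolding E_def by (auto intro: smooth_vf_at_cfield)
  show ?thesis
    unfolding K_def by (simp add: D_diff smooth_D c V)
qed

end

section \<open>Linear algebra of one tangent space\<close>

locale onb_space =
  fixes G :: "'v::euclidean_space \<Rightarrow> 'v \<Rightarrow> real" and E :: "'v set"
  assumes bilinear_G: "bilinear G" and G_sym: "G v w = G w v" and G_pos: "v \<noteq> 0 \<Longrightarrow> G v v > 0"
    and onb_E: "orthonormal_basis G E"
begin

lemma G_simps [simp]:
  "G (a + b) c = G a c + G b c" "G c (a + b) = G c a + G c b"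
  "G (a - b) c = G a c - G b c" "G c (a - b) = G c a - G c b"
  "G (- a) c = - G a c" "G c (- a) = - G c a"
  "G (r *\<^sub>R a) c = r * G a c" "G c (r *\<^sub>R a) = r * G c a"
  "G 0 c = 0" "G c 0 = 0"
  using bilinear_G
  by (simp_all add: bilinear_ladd bilinear_radd bilinear_lsub bilinear_rsub bilinear_lneg bilinear_rneg
      bilinear_lmul bilinear_rmul bilinear_lzero bilinear_rzero)

lemma linear_G: "linear (G a)" "linear (\<lambda>x. G x a)"
  using bilinear_G unfolding bilinear_def by auto

lemma G_sum: "G (sum f S) c = (\<Sum>i\<in>S. G (f i) c)" "G c (sum f S) = (\<Sum>i\<in>S. G c (f i))"
  using linear_sum[OF linear_G(2)] linear_sum[OF linear_G(1)] by auto

lemma finite_E: "finite E" and card_E: "card E = DIM('v)"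
  and G_E: "e \<in> E \<Longrightarrow> f \<in> E \<Longrightarrow> G e f = (if e = f then 1 else 0)"
  using onb_E unfolding orthonormal_basis_def by auto

lemma G_eqI: "(\<And>w. G x w = G y w) \<Longrightarrow> x = y"
  using G_pos[of "x - y"] by (metis G_simps(3) diff_self eq_iff_diff_eq_0 less_irrefl)

lemma expansion: "v = (\<Sum>e\<in>E. G v e *\<^sub>R e)"
proof -
  have coeff: "c f = G (\<Sum>e\<in>E. c e *\<^sub>R e) f" if "f \<in> E" for c :: "'v \<Rightarrow> real" and f
    using that finite_E by (simp add: G_sum G_E if_distrib cong: if_cong)
  have "independent E"
    unfolding independent_explicit using finite_E coeff
    by (metis G_simps(9))
  then have "UNIV \<subseteq> span E"
    using card_E by (intro card_ge_dim_independent) auto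
  then obtain c where "v = (\<Sum>e\<in>E. c e *\<^sub>R e)"
    using finite_E span_finite by blast
  then show ?thesis using coeff by simp
qed

lemma contract:
  assumes "linear \<phi>"
  shows "(\<Sum>e\<in>E. G v e * \<phi> e) = \<phi> v" "(\<Sum>e\<in>E. G e v * \<phi> e) = \<phi> v"
    "(\<Sum>e\<in>E. \<phi> e * G v e) = \<phi> v" "(\<Sum>e\<in>E. \<phi> e * G e v) = (\<phi> v :: real)"
proof -
  have "\<phi> v = \<phi> (\<Sum>e\<in>E. G v e *\<^sub>R e)" using expansion by simp
  then show *: "(\<Sum>e\<in>E. G v e * \<phi> e) = \<phi> v"
    using assms by (simp add: linear_sum linear_cmul)
  then show "(\<Sum>e\<in>E. G e v * \<phi> e) = \<phi> v" "(\<Sum>e\<in>E. \<phi> e * G v e) = \<phi> v" "(\<Sum>e\<in>E. \<phi> e * G e v) = \<phi> v"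
    by (simp_all add: G_sym[of _ v] mult.commute)
qed

lemma sharp_G:
  assumes "linear \<alpha>"
  shows "G (sharp G \<alpha>) w = \<alpha> w"
proof -
  have *: "G (\<Sum>e\<in>E. \<alpha> e *\<^sub>R e) w = \<alpha> w" for w
    using contract(4)[OF assms] by (simp add: G_sum)
  have "\<forall>w. G (sharp G \<alpha>) w = \<alpha> w"
    unfolding sharp_def
  proof (rule theI)
    show "x = (\<Sum>e\<in>E. \<alpha> e *\<^sub>R e)" if "\<forall>w. G x w = \<alpha> w" for x
      by (rule G_eqI) (simp add: * that)
  qed (simp add: *)
  then show ?thesis by simp
qed

lemma trace_adjoint:
  assumes B: "bilinear (B :: 'v \<Rightarrow> 'v \<Rightarrow> real)" and L: "\<And>v w. G (L v) w = G v (L' w)"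
  shows "(\<Sum>e\<in>E. B (L e) e) = (\<Sum>e\<in>E. B e (L' e))"
proof -
  have lin: "linear (B v)" "linear (\<lambda>v. B v w)" for v w using B unfolding bilinear_def by auto
  have "(\<Sum>e\<in>E. B (L e) e) = (\<Sum>e\<in>E. \<Sum>f\<in>E. G (L e) f * B f e)"
    using contract(1)[OF lin(2)] by simp
  also have "\<dots> = (\<Sum>f\<in>E. \<Sum>e\<in>E. B f e * G e (L' f))"
    by (subst sum.swap) (simp add: L mult.commute)
  also have "\<dots> = (\<Sum>f\<in>E. B f (L' f))" using contract(4)[OF lin(1)] by simp
  finally show ?thesis .
qed

lemma trace_onb:
  assumes "orthonormal_basis G F" and B: "bilinear (B :: 'v \<Rightarrow> 'v \<Rightarrow> real)"
  shows "(\<Sum>f\<in>F. B f f) = (\<Sum>e\<in>E. B e e)"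
proof -
  interpret F: onb_space G F
    using assms bilinear_G G_sym G_pos by unfold_locales
  have lin: "linear (B v)" "linear (\<lambda>v. B v w)" for v w using B unfolding bilinear_def by auto
  have "(\<Sum>f\<in>F. B f f) = (\<Sum>f\<in>F. \<Sum>e\<in>E. G f e * B e f)"
    using contract(1)[OF lin(2)] by simp
  also have "\<dots> = (\<Sum>e\<in>E. \<Sum>f\<in>F. B e f * G f e)"
    by (subst sum.swap) (simp add: mult.commute)
  also have "\<dots> = (\<Sum>e\<in>E. B e e)" using F.contract(4)[OF lin(1)] by simp
  finally show ?thesis .
qed

lemma E_nonempty: "\<exists>e. e \<in> E \<and> G e e = 1"
  using card_E G_E DIM_positive[where 'a = 'v] by (metis card.empty ex_in_conv less_irrefl)

abbreviation N :: real where "N \<equiv> real (card E)"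

lemma trace_G: "(\<Sum>e\<in>E. G e e) = N"
  using G_E by simp

end

section \<open>Quaternionic Hermitian vector spaces\<close>

locale quat_space = onb_space G E
  for G :: "'v::euclidean_space \<Rightarrow> 'v \<Rightarrow> real" and E +
  fixes J1 J2 J3 :: "'v \<Rightarrow> 'v"
  assumes linear_J: "linear J1" "linear J2" "linear J3"
    and J_sq: "J1 (J1 v) = - v" "J2 (J2 v) = - v" "J3 (J3 v) = - v"
    and J_prod: "J1 (J2 v) = J3 v" "J2 (J3 v) = J1 v" "J3 (J1 v) = J2 v"
      "J2 (J1 v) = - J3 v" "J3 (J2 v) = - J1 v" "J1 (J3 v) = - J2 v"
    and G_skew: "G v (J1 w) = - G (J1 v) w" "G v (J2 w) = - G (J2 v) w" "G v (J3 w) = - G (J3 v) w"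
begin

lemma cyclic: "quat_space G E J2 J3 J1"
  by (intro quat_space.intro quat_space_axioms.intro onb_space_axioms linear_J J_sq J_prod G_skew)

lemma J_simps [simp]:
  "J1 (a + b) = J1 a + J1 b" "J2 (a + b) = J2 a + J2 b" "J3 (a + b) = J3 a + J3 b"
  "J1 (a - b) = J1 a - J1 b" "J2 (a - b) = J2 a - J2 b" "J3 (a - b) = J3 a - J3 b"
  "J1 (r *\<^sub>R a) = r *\<^sub>R J1 a" "J2 (r *\<^sub>R a) = r *\<^sub>R J2 a" "J3 (r *\<^sub>R a) = r *\<^sub>R J3 a"
  "J1 (- a) = - J1 a" "J2 (- a) = - J2 a" "J3 (- a) = - J3 a"
  using linear_J by (simp_all add: linear_add linear_diff linear_cmul linear_neg)

lemmas J_calc = J_sq J_prod G_skew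

lemma G_J_self [simp]: "G (J1 v) v = 0" "G (J2 v) v = 0" "G (J3 v) v = 0"
  using G_skew[of v v] G_sym[of v] by (metis equal_neg_zero)+

text \<open>The sum of omega_i (x) omega_i for the Kaehler forms omega_i =
  \<open>G (Ji _) _\<close>. An orthogonal change of the triple leaves it unchanged.\<close>

definition M :: "'v \<Rightarrow> 'v \<Rightarrow> 'v \<Rightarrow> 'v \<Rightarrow> real" where
  "M a b c d = G (J1 a) b * G (J1 c) d + G (J2 a) b * G (J2 c) d + G (J3 a) b * G (J3 c) d"

text \<open>For fixed \<open>x\<close> and \<open>y\<close> this is the 2-form in the equation for
  \<open>u\<close>: x wedge y plus the sum of Ji x wedge Ji y, the latter expressed through
  \<open>M\<close>.\<close>

definition Phi :: "'v \<Rightarrow> 'v \<Rightarrow> 'v \<Rightarrow> 'v \<Rightarrow> real" where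
  "Phi x y z w = G x z * G y w - G x w * G y z + M x z y w - M x w y z"

lemma linear_GJ:
  "linear (\<lambda>x. G (J1 x) a)" "linear (\<lambda>x. G (J2 x) a)" "linear (\<lambda>x. G (J3 x) a)"
  by (rule linearI; simp)+

lemma trace_J:
  assumes "bilinear (B :: 'v \<Rightarrow> 'v \<Rightarrow> real)"
  shows "(\<Sum>e\<in>E. B (J1 e) e) = - (\<Sum>e\<in>E. B e (J1 e))" "(\<Sum>e\<in>E. B (J2 e) e) = - (\<Sum>e\<in>E. B e (J2 e))"
    "(\<Sum>e\<in>E. B (J3 e) e) = - (\<Sum>e\<in>E. B e (J3 e))"
  using trace_adjoint[OF assms, of J1 "\<lambda>v. - J1 v"] trace_adjoint[OF assms, of J2 "\<lambda>v. - J2 v"]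
    trace_adjoint[OF assms, of J3 "\<lambda>v. - J3 v"] assms
  by (simp_all add: G_skew bilinear_rneg sum_negf)

lemma trace_J_J:
  assumes "bilinear (B :: 'v \<Rightarrow> 'v \<Rightarrow> real)"
  shows "(\<Sum>e\<in>E. B (J1 e) (J1 e)) = (\<Sum>e\<in>E. B e e)" "(\<Sum>e\<in>E. B (J2 e) (J2 e)) = (\<Sum>e\<in>E. B e e)"
    "(\<Sum>e\<in>E. B (J3 e) (J3 e)) = (\<Sum>e\<in>E. B e e)"
proof -
  have "bilinear (\<lambda>x y. B x (J y))" if "linear J" for J
    using assms linear_compose[OF that] unfolding bilinear_def comp_def by blast
  from trace_J(1)[OF this[OF linear_J(1)]] trace_J(2)[OF this[OF linear_J(2)]] trace_J(3)[OF this[OF linear_J(3)]]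
  show "(\<Sum>e\<in>E. B (J1 e) (J1 e)) = (\<Sum>e\<in>E. B e e)" "(\<Sum>e\<in>E. B (J2 e) (J2 e)) = (\<Sum>e\<in>E. B e e)"
    "(\<Sum>e\<in>E. B (J3 e) (J3 e)) = (\<Sum>e\<in>E. B e e)"
    using assms by (simp_all add: J_sq bilinear_rneg sum_negf)
qed

text \<open>Divided by \<open>N\<close>, the right side is the projection of \<open>B\<close> to
  S2H.\<close>

lemma trace_M:
  assumes B: "bilinear (B :: 'v \<Rightarrow> 'v \<Rightarrow> real)"
  shows "(\<Sum>e\<in>E. \<Sum>f\<in>E. B e f * M e f v w) = (\<Sum>e\<in>E. B e (J1 e)) * G (J1 v) w +
    (\<Sum>e\<in>E. B e (J2 e)) * G (J2 v) w + (\<Sum>e\<in>E. B e (J3 e)) * G (J3 v) w"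
proof -
  have lin: "linear (B e)" for e using B unfolding bilinear_def by auto
  have "(\<Sum>f\<in>E. B e f * M e f v w) =
      B e (J1 e) * G (J1 v) w + B e (J2 e) * G (J2 v) w + B e (J3 e) * G (J3 v) w" for e
    unfolding M_def
    by (simp add: distrib_left sum.distrib mult.assoc[symmetric] sum_distrib_right[symmetric] contract(3)[OF lin])
  then show ?thesis by (simp add: sum.distrib sum_distrib_right)
qed

end

section \<open>Curvature tensors of quaternionic-Kaehler type\<close>

text \<open>
  The curvature tensor of a quaternionic-Kaehler manifold at one point. The last assumption expresses
  that \<open>R x y\<close> normalizes the span of \<open>J1, J2, J3\<close>, in the form that the invariant
  tensor \<open>M\<close> is annihilated.
\<close>

locale quat_curvature = quat_space G E J1 J2 J3
  for G :: "'v::euclidean_space \<Rightarrow> 'v \<Rightarrow> real" and E J1 J2 J3 +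
  fixes R :: "'v \<Rightarrow> 'v \<Rightarrow> 'v \<Rightarrow> 'v"
  assumes linear_R: "linear (\<lambda>x. R x y z)" "linear (\<lambda>y. R x y z)" "linear (\<lambda>z. R x y z)"
    and R_swap: "R y x z = - R x y z"
    and R_skew: "G (R x y z) w = - G z (R x y w)"
    and R_bianchi: "R x y z + R y z x + R z x y = 0"
    and R_M: "M (R x y a) b c d + M a (R x y b) c d + M a b (R x y c) d + M a b c (R x y d) = 0"
    and DIM_ge: "DIM('v) \<ge> 8"
begin

text \<open>These traces represent the curvature of \<open>Q\<close>: up to the factor
  \<open>2 / N\<close> they are the coefficients with which \<open>R x y\<close> acts on the span of
  the \<open>Ji\<close>, see \<open>R_commutators\<close>.\<close>

definition \<tau>1 :: "'v \<Rightarrow> 'v \<Rightarrow> real" where "\<tau>1 x y = (\<Sum>e\<in>E. G (R x y e) (J1 e))"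
definition \<tau>2 :: "'v \<Rightarrow> 'v \<Rightarrow> real" where "\<tau>2 x y = (\<Sum>e\<in>E. G (R x y e) (J2 e))"
definition \<tau>3 :: "'v \<Rightarrow> 'v \<Rightarrow> real" where "\<tau>3 x y = (\<Sum>e\<in>E. G (R x y e) (J3 e))"

lemma R_zero [simp]: "R x y 0 = 0" using linear_0[OF linear_R(3)] .

lemma R_arith [simp]:
  "R (a + b) y z = R a y z + R b y z" "R x (a + b) z = R x a z + R x b z" "R x y (a + b) = R x y a + R x y b"
  "R (- a) y z = - R a y z" "R x (- a) z = - R x a z" "R x y (- a) = - R x y a"
  "R (r *\<^sub>R a) y z = r *\<^sub>R R a y z" "R x (r *\<^sub>R a) z = r *\<^sub>R R x a z" "R x y (r *\<^sub>R a) = r *\<^sub>R R x y a"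
  by (fact linear_add[OF linear_R(1)] linear_add[OF linear_R(2)] linear_add[OF linear_R(3)]
      linear_neg[OF linear_R(1)] linear_neg[OF linear_R(2)] linear_neg[OF linear_R(3)]
      linear_cmul[OF linear_R(1)] linear_cmul[OF linear_R(2)] linear_cmul[OF linear_R(3)])+

lemma N_ge: "N \<ge> 8" using DIM_ge card_E by simp

lemma N_cancel: "N *\<^sub>R a = N *\<^sub>R b \<Longrightarrow> a = b" for a b :: 'v
  using N_ge scaleR_cancel_left[of N a b] by auto

lemma R_skew': "G a (R x y b) = - G (R x y a) b"
  using R_skew[of x y a b] by simp

text \<open>Inserting \<open>z\<close> and \<open>Ji z\<close> for a unit vector \<open>z\<close> as
  last two arguments of \<open>R_M\<close> isolates one Kaehler form and expresses the commutator of
  \<open>R x y\<close> with \<open>Ji\<close> by the scalars \<open>s\<close>. Skewness of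
  \<open>R\<close> makes the matrix of these scalars skew; tracing the commutator against another
  structure identifies the entries.\<close>

lemma R_commutators:
  shows "N *\<^sub>R (R x y (J1 v) - J1 (R x y v)) = 2 *\<^sub>R (\<tau>3 x y *\<^sub>R J2 v - \<tau>2 x y *\<^sub>R J3 v)"
    and "N *\<^sub>R (R x y (J2 v) - J2 (R x y v)) = 2 *\<^sub>R (\<tau>1 x y *\<^sub>R J3 v - \<tau>3 x y *\<^sub>R J1 v)"
    and "N *\<^sub>R (R x y (J3 v) - J3 (R x y v)) = 2 *\<^sub>R (\<tau>2 x y *\<^sub>R J1 v - \<tau>1 x y *\<^sub>R J2 v)"
proof -
  obtain z where z: "G z z = 1" using E_nonempty by blast
  let ?R = "R x y"
  have Jz: "G (J1 z) (J1 z) = 1" "G (J2 z) (J2 z) = 1" "G (J3 z) (J3 z) = 1"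
    "G (J1 z) (J2 z) = 0" "G (J2 z) (J3 z) = 0" "G (J3 z) (J1 z) = 0"
    "G (J2 z) (J1 z) = 0" "G (J3 z) (J2 z) = 0" "G (J1 z) (J3 z) = 0"
    using z by (simp_all add: J_calc)
  define s where "s J J' = G (J (?R z)) (J' z) + G (J z) (?R (J' z))" for J J'
  have Rzz: "G (?R w) w = 0" for w using R_skew[of x y w w] G_sym[of w] by (metis equal_neg_zero)
  have Rsw: "G (a z) (?R (b z)) = - G (b z) (?R (a z))" for a b
    using R_skew'[of "a z" x y "b z"] G_sym by metis
  have s_diag: "s J1 J1 = 0" "s J2 J2 = 0" "s J3 J3 = 0"
    unfolding s_def using Rzz Rsw[of J1 J1] Rsw[of J2 J2] Rsw[of J3 J3] by (simp_all add: J_calc)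
  have s_skew: "s J2 J1 = - s J1 J2" "s J3 J1 = - s J1 J3" "s J3 J2 = - s J2 J3"
    unfolding s_def using Rsw[of J2 J1] Rsw[of J3 J1] Rsw[of J3 J2]
    by (simp_all add: G_skew(1-3)[of "J1 (?R z)"] G_skew(1-3)[of "J2 (?R z)"] G_skew(1-3)[of "J3 (?R z)"] J_prod)
  have c0: "G (?R (J1 v) - J1 (?R v)) w = G (J1 v) w * s J1 J1 + G (J2 v) w * s J2 J1 + G (J3 v) w * s J3 J1"
    "G (?R (J2 v) - J2 (?R v)) w = G (J1 v) w * s J1 J2 + G (J2 v) w * s J2 J2 + G (J3 v) w * s J3 J2"
    "G (?R (J3 v) - J3 (?R v)) w = G (J1 v) w * s J1 J3 + G (J2 v) w * s J2 J3 + G (J3 v) w * s J3 J3" for v w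
    using R_M[of x y v w z "J1 z"] R_M[of x y v w z "J2 z"] R_M[of x y v w z "J3 z"]
    unfolding M_def s_def by (simp_all add: Jz R_skew'[of _ x y w] algebra_simps)
  have bil: "bilinear (\<lambda>v w. G (?R v) (J1 w))" "bilinear (\<lambda>v w. G (?R v) (J2 w))"
    "bilinear (\<lambda>v w. G (?R v) (J3 w))"
    by (auto simp: bilinear_def intro!: linearI)
  \<comment> \<open>Since \<open>J2 = J3 J1\<close>, conjugating the trace of the first term by
    \<open>J1\<close> turns it into \<tau>3; the second term is \<tau>3 as well, which explains the
    factor 2.\<close>
  have s21: "N * s J2 J1 = 2 * \<tau>3 x y"
  proof -
    have "(\<Sum>e\<in>E. G (?R (J1 e) - J1 (?R e)) (J2 e)) = N * s J2 J1"
      unfolding c0 s_diag using trace_G by (simp add: J_calc sum_distrib_right[symmetric])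
    moreover have "G (J1 (?R e)) (J2 e) = - G (?R e) (J3 e)" for e by (simp add: J_calc)
    ultimately show ?thesis
      using trace_J_J(1)[OF bil(3)] unfolding \<tau>3_def by (simp add: sum.distrib J_prod)
  qed
  have s32: "N * s J3 J2 = 2 * \<tau>1 x y"
  proof -
    have "(\<Sum>e\<in>E. G (?R (J2 e) - J2 (?R e)) (J3 e)) = N * s J3 J2"
      unfolding c0 s_diag using trace_G by (simp add: J_calc sum_distrib_right[symmetric])
    moreover have "G (J2 (?R e)) (J3 e) = - G (?R e) (J1 e)" for e by (simp add: J_calc)
    ultimately show ?thesis
      using trace_J_J(2)[OF bil(1)] unfolding \<tau>1_def by (simp add: sum.distrib J_prod)
  qed
  have s13: "N * s J1 J3 = 2 * \<tau>2 x y"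
  proof -
    have "(\<Sum>e\<in>E. G (?R (J3 e) - J3 (?R e)) (J1 e)) = N * s J1 J3"
      unfolding c0 s_diag using trace_G by (simp add: J_calc sum_distrib_right[symmetric])
    moreover have "G (J3 (?R e)) (J1 e) = - G (?R e) (J2 e)" for e by (simp add: J_calc)
    ultimately show ?thesis
      using trace_J_J(3)[OF bil(2)] unfolding \<tau>2_def by (simp add: sum.distrib J_prod)
  qed
  have 1: "N * (G (J1 v) w * s J1 J1 + G (J2 v) w * s J2 J1 + G (J3 v) w * s J3 J1) =
      2 * (\<tau>3 x y * G (J2 v) w - \<tau>2 x y * G (J3 v) w)"
    and 2: "N * (G (J1 v) w * s J1 J2 + G (J2 v) w * s J2 J2 + G (J3 v) w * s J3 J2) =
      2 * (\<tau>1 x y * G (J3 v) w - \<tau>3 x y * G (J1 v) w)"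
    and 3: "N * (G (J1 v) w * s J1 J3 + G (J2 v) w * s J2 J3 + G (J3 v) w * s J3 J3) =
      2 * (\<tau>2 x y * G (J1 v) w - \<tau>1 x y * G (J2 v) w)" for v w
  proof -
    have n: "N * s J2 J1 = 2 * \<tau>3 x y" "N * s J1 J2 = - 2 * \<tau>3 x y"
      "N * s J3 J2 = 2 * \<tau>1 x y" "N * s J2 J3 = - 2 * \<tau>1 x y"
      "N * s J1 J3 = 2 * \<tau>2 x y" "N * s J3 J1 = - 2 * \<tau>2 x y"
      using s21 s32 s13 s_skew by simp_all
    have d: "N * (a * 0 + b * t + c * u) = b * (N * t) + c * (N * u)"
      "N * (b * t + a * 0 + c * u) = b * (N * t) + c * (N * u)"
      "N * (b * t + c * u + a * 0) = b * (N * t) + c * (N * u)" for a b c t u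
      by (simp_all add: algebra_simps)
    show "N * (G (J1 v) w * s J1 J1 + G (J2 v) w * s J2 J1 + G (J3 v) w * s J3 J1) =
      2 * (\<tau>3 x y * G (J2 v) w - \<tau>2 x y * G (J3 v) w)"
      "N * (G (J1 v) w * s J1 J2 + G (J2 v) w * s J2 J2 + G (J3 v) w * s J3 J2) =
      2 * (\<tau>1 x y * G (J3 v) w - \<tau>3 x y * G (J1 v) w)"
      "N * (G (J1 v) w * s J1 J3 + G (J2 v) w * s J2 J3 + G (J3 v) w * s J3 J3) =
      2 * (\<tau>2 x y * G (J1 v) w - \<tau>1 x y * G (J2 v) w)"
      unfolding s_diag d n by simp_all
  qed
  show "N *\<^sub>R (R x y (J1 v) - J1 (R x y v)) = 2 *\<^sub>R (\<tau>3 x y *\<^sub>R J2 v - \<tau>2 x y *\<^sub>R J3 v)"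
    by (rule G_eqI, unfold G_simps(7) c0 1) simp
  show "N *\<^sub>R (R x y (J2 v) - J2 (R x y v)) = 2 *\<^sub>R (\<tau>1 x y *\<^sub>R J3 v - \<tau>3 x y *\<^sub>R J1 v)"
    by (rule G_eqI, unfold G_simps(7) c0 2) simp
  show "N *\<^sub>R (R x y (J3 v) - J3 (R x y v)) = 2 *\<^sub>R (\<tau>2 x y *\<^sub>R J1 v - \<tau>1 x y *\<^sub>R J2 v)"
    by (rule G_eqI, unfold G_simps(7) c0 3) simp
qed

text \<open>The classical consequence of skewness in both pairs and four instances of the first
  Bianchi identity.\<close>

lemma R_pair: "G (R x y z) w = G (R z w x) y"
proof -
  have B: "G (R a b c) d + G (R b c a) d + G (R c a b) d = 0" for a b c d
    using arg_cong[OF R_bianchi[of a b c], of "\<lambda>v. G v d"] by simp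
  have s: "G (R a b c) d = - G (R a b d) c" for a b c d
    using R_skew G_sym by metis
  have t: "G (R a b c) d = - G (R b a c) d" for a b c d
    using R_swap[of b a c] by simp
  show ?thesis
    using B[of x y z w] B[of y z w x] B[of z w x y] B[of w x y z]
      s[of y z w x] s[of z w y x] s[of w x z y] s[of x y w z]
      t[of w y z x] s[of y w z x] t[of z x y w] s[of x z y w]
    by linarith
qed

section \<open>The Ricci tensor and the Einstein property\<close>

definition ric :: "'v \<Rightarrow> 'v \<Rightarrow> real" where "ric y z = (\<Sum>e\<in>E. G (R e y z) e)"

lemma ric_sym: "ric y z = ric z y"
proof -
  have "G (R e y z) e = G (R e z y) e" for e
    using R_pair[of e y z e] R_swap[of z e e] R_skew'[of y e z e] G_sym[of _ y] by simp
  then show ?thesis unfolding ric_def by simp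
qed

lemma bilinear_ric: "bilinear ric"
  unfolding bilinear_def ric_def by (auto intro!: linearI simp: sum.distrib sum_distrib_left)

lemma bilinear_\<tau>: "bilinear \<tau>1" "bilinear \<tau>2" "bilinear \<tau>3"
  unfolding bilinear_def \<tau>1_def \<tau>2_def \<tau>3_def by (auto intro!: linearI simp: sum.distrib sum_distrib_left)

lemma \<tau>_swap: "\<tau>1 y x = - \<tau>1 x y" "\<tau>2 y x = - \<tau>2 x y" "\<tau>3 y x = - \<tau>3 x y"
  unfolding \<tau>1_def \<tau>2_def \<tau>3_def by (simp_all add: R_swap[of y x] sum_negf)

text \<open>The trace \<open>?S\<close> is computed twice. Moving \<open>J1\<close> out of
  \<open>R\<close> by the commutator gives the Ricci tensor and the two other \<tau>; the first
  Bianchi identity together with pair symmetry gives half of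
  \<open>\<tau>1 (J1 z) y\<close>.\<close>

lemma ric_\<tau>1: "- N * \<tau>1 y (J1 z) = 2 * N * ric y z + 4 * \<tau>2 y (J2 z) + 4 * \<tau>3 y (J3 z)"
proof -
  let ?S = "\<Sum>e\<in>E. G (R e y (J1 z)) (J1 e)"
  have "N * ?S = (\<Sum>e\<in>E. N * G (J1 (R e y z)) (J1 e) + 2 * (\<tau>3 e y * G (J2 z) (J1 e) - \<tau>2 e y * G (J3 z) (J1 e)))"
    unfolding sum_distrib_left
  proof (rule sum.cong[OF refl])
    fix e
    show "N * G (R e y (J1 z)) (J1 e) = N * G (J1 (R e y z)) (J1 e) +
        2 * (\<tau>3 e y * G (J2 z) (J1 e) - \<tau>2 e y * G (J3 z) (J1 e))"
      using arg_cong[OF R_commutators(1)[of e y z], of "\<lambda>v. G v (J1 e)"] by (simp add: algebra_simps)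
  qed
  also have "\<dots> = (\<Sum>e\<in>E. N * G (R e y z) e + 2 * (- (\<tau>3 e y * G (J3 z) e) - \<tau>2 e y * G (J2 z) e))"
    by (simp add: J_calc)
  also have "\<dots> = N * ric y z - 2 * (\<Sum>e\<in>E. \<tau>3 e y * G (J3 z) e) - 2 * (\<Sum>e\<in>E. \<tau>2 e y * G (J2 z) e)"
    unfolding ric_def by (simp add: sum.distrib sum_subtractf sum_distrib_left sum_negf algebra_simps)
  also have "(\<Sum>e\<in>E. \<tau>3 e y * G (J3 z) e) = \<tau>3 (J3 z) y"
    using bilinear_\<tau>(3) unfolding bilinear_def by (intro contract) auto
  also have "(\<Sum>e\<in>E. \<tau>2 e y * G (J2 z) e) = \<tau>2 (J2 z) y"
    using bilinear_\<tau>(2) unfolding bilinear_def by (intro contract) auto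
  finally have 1: "N * ?S = N * ric y z + 2 * \<tau>3 y (J3 z) + 2 * \<tau>2 y (J2 z)"
    using \<tau>_swap(2)[of "J2 z" y] \<tau>_swap(3)[of "J3 z" y] by simp
  let ?T = "\<lambda>p q. G (R (J1 z) p q) y"
  have "bilinear ?T" by (auto simp: bilinear_def intro!: linearI)
  from trace_J(1)[OF this] have "2 * (\<Sum>e\<in>E. ?T (J1 e) e) = (\<Sum>e\<in>E. ?T (J1 e) e - ?T e (J1 e))"
    by (simp add: sum_subtractf)
  also have "\<dots> = (\<Sum>e\<in>E. G (R (J1 z) y e) (J1 e))"
  proof (rule sum.cong[OF refl])
    fix e
    have "G (R (J1 z) (J1 e) e) y + G (R (J1 e) e (J1 z)) y + G (R e (J1 z) (J1 e)) y = 0"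
      using arg_cong[OF R_bianchi[of "J1 z" "J1 e" e], of "\<lambda>v. G v y"] by simp
    then show "?T (J1 e) e - ?T e (J1 e) = G (R (J1 z) y e) (J1 e)"
      using R_swap[of e "J1 z" "J1 e"] R_swap[of "J1 e" e "J1 z"] R_pair[of e "J1 e" "J1 z" y] by simp
  qed
  finally have "2 * ?S = \<tau>1 (J1 z) y"
    unfolding \<tau>1_def using R_pair[of _ y "J1 z"] by simp
  then have "2 * (N * ?S) = N * (- \<tau>1 y (J1 z))"
    unfolding mult.left_commute[of 2 N] \<tau>_swap(1)[of "J1 z" y] by (rule arg_cong)
  then show ?thesis unfolding 1 by simp
qed

lemma quat_curvature_cyclic: "quat_curvature G E J2 J3 J1 R"
proof -
  interpret c: quat_space G E J2 J3 J1 by (rule cyclic)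
  have "c.M a b c d = M a b c d" for a b c d
    unfolding c.M_def M_def by simp
  then show ?thesis
    by (intro quat_curvature.intro quat_curvature_axioms.intro c.quat_space_axioms linear_R R_swap
        R_skew R_bianchi DIM_ge) (simp add: R_M)
qed

text \<open>The three cyclic versions of \<open>ric_\<tau>1\<close> form a linear system.
  Differences of its unknowns carry the factor \<open>N - 4\<close>, so the unknowns coincide in
  dimension at least eight; their common value then follows after division by
  \<open>N + 8\<close>.\<close>

lemma \<tau>_ric: "\<tau>1 x y = 2 * N / (N + 8) * ric x (J1 y)" "\<tau>2 x y = 2 * N / (N + 8) * ric x (J2 y)"
  "\<tau>3 x y = 2 * N / (N + 8) * ric x (J3 y)"
proof -
  interpret c: quat_curvature G E J2 J3 J1 R by (rule quat_curvature_cyclic)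
  interpret d: quat_curvature G E J3 J1 J2 R by (rule c.quat_curvature_cyclic)
  have defs: "c.\<tau>1 = \<tau>2" "c.\<tau>2 = \<tau>3" "c.\<tau>3 = \<tau>1" "d.\<tau>1 = \<tau>3" "d.\<tau>2 = \<tau>1" "d.\<tau>3 = \<tau>2"
    by (auto simp: fun_eq_iff c.\<tau>1_def c.\<tau>2_def c.\<tau>3_def d.\<tau>1_def d.\<tau>2_def d.\<tau>3_def
        \<tau>1_def \<tau>2_def \<tau>3_def)
  have eq: "a = - 2 * N / (N + 8) * r \<and> b = - 2 * N / (N + 8) * r \<and> c = - 2 * N / (N + 8) * r"
    if "- N * a = 2 * N * r + 4 * b + 4 * c" "- N * b = 2 * N * r + 4 * c + 4 * a"
      "- N * c = 2 * N * r + 4 * a + 4 * b" for a b c r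
  proof -
    have "(N - 4) * (a - b) = 0" "(N - 4) * (b - c) = 0"
      using that by (simp_all add: algebra_simps)
    then have "a = b" "b = c" using N_ge by auto
    then show ?thesis using that(1) N_ge by (simp add: field_simps)
  qed
  have *: "\<tau>1 x (J1 y) = - 2 * N / (N + 8) * ric x y \<and> \<tau>2 x (J2 y) = - 2 * N / (N + 8) * ric x y
      \<and> \<tau>3 x (J3 y) = - 2 * N / (N + 8) * ric x y" for x y
    using eq[OF ric_\<tau>1[of x y] c.ric_\<tau>1[of x y, unfolded defs] d.ric_\<tau>1[of x y, unfolded defs]] .
  show "\<tau>1 x y = 2 * N / (N + 8) * ric x (J1 y)" "\<tau>2 x y = 2 * N / (N + 8) * ric x (J2 y)"
    "\<tau>3 x y = 2 * N / (N + 8) * ric x (J3 y)"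
    using *[of x "J1 y"] *[of x "J2 y"] *[of x "J3 y"] bilinear_\<tau>
    by (simp_all add: J_sq bilinear_rneg)
qed

text \<open>The \<tau>i are skew while \<open>ric\<close> is symmetric, so \<open>\<tau>_ric\<close>
  forces \<open>ric\<close> to be Hermitian for each \<open>Ji\<close>.\<close>

lemma ric_skew_J: "ric x (J1 y) = - ric (J1 x) y" "ric x (J2 y) = - ric (J2 x) y" "ric x (J3 y) = - ric (J3 x) y"
proof -
  define k where "k = 2 * N / (N + 8)"
  have k: "k \<noteq> 0" using N_ge unfolding k_def by auto
  have "k * ric x (J1 y) = k * (- ric (J1 x) y)" "k * ric x (J2 y) = k * (- ric (J2 x) y)"
    "k * ric x (J3 y) = k * (- ric (J3 x) y)"
    using \<tau>_swap[of x y] unfolding \<tau>_ric[folded k_def] ric_sym[of y] by simp_all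
  then show "ric x (J1 y) = - ric (J1 x) y" "ric x (J2 y) = - ric (J2 x) y" "ric x (J3 y) = - ric (J3 x) y"
    unfolding mult_left_cancel[OF k] by simp_all
qed

definition scal :: real where "scal = (\<Sum>e\<in>E. ric e e)"
text \<open>For \<open>N = 4n\<close> this is the scalar curvature divided by
  \<open>4n(n+2)\<close>, the reduced scalar curvature.\<close>

definition nu :: real where "nu = 4 * scal / (N * (N + 8))"

text \<open>
  Taking the part of \<open>R x y\<close> that does not commute with \<open>J1\<close> in both pairs of arguments, the pair
  symmetry of \<open>R\<close> forces the forms \<open>ric x (J2 y)\<close> to be multiples of the Kaehler forms.
\<close>

lemma ric_einstein: "ric x y = (N + 8) / 4 * nu * G x y"
proof -
  let ?k = "4 / (N + 8)"
  have comm: "R a b (J1 v) = J1 (R a b v) + ?k *\<^sub>R (ric a (J3 b) *\<^sub>R J2 v - ric a (J2 b) *\<^sub>R J3 v)" for a b v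
  proof -
    have "N *\<^sub>R (R a b (J1 v) - J1 (R a b v)) = N *\<^sub>R (?k *\<^sub>R (ric a (J3 b) *\<^sub>R J2 v - ric a (J2 b) *\<^sub>R J3 v))"
      unfolding R_commutators(1) \<tau>_ric by (simp add: algebra_simps)
    from N_cancel[OF this] show ?thesis by (simp add: algebra_simps)
  qed
  define K where "K a b c d = ric a (J2 b) * G (J2 c) d + ric a (J3 b) * G (J3 c) d" for a b c d
  have 1: "G (R a b c) d - G (R a b (J1 c)) (J1 d) = ?k * K a b c d" for a b c d
    unfolding comm K_def by (simp add: J_calc algebra_simps)
  have 2: "G (R a b c) d - G (R (J1 a) (J1 b) c) d = ?k * K c d a b" for a b c d
    using 1[of c d a b] R_pair[of a b c d] R_pair[of "J1 a" "J1 b" c d] by simp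
  have rneg: "ric (- a) b = - ric a b" "ric a (- b) = - ric a b" for a b
    using bilinear_lneg[OF bilinear_ric] bilinear_rneg[OF bilinear_ric] by auto
  have 3: "K (J1 a) (J1 b) c d = - K a b c d" for a b c d
    unfolding K_def by (simp add: J_prod ric_skew_J rneg J_sq)
  have sym: "K a b c d = K c d a b" for a b c d
  proof -
    have "?k * K a b c d - ?k * K (J1 a) (J1 b) c d = ?k * K c d a b - ?k * K (J1 c) (J1 d) a b"
      using 1[of a b c d] 1[of "J1 a" "J1 b" c d] 2[of a b c d] 2[of a b "J1 c" "J1 d"] by linarith
    then show ?thesis using 3 N_ge by simp
  qed
  \<comment> \<open>With \<open>v\<close>, \<open>J2 v\<close> as one pair of arguments only the
    \<open>J2\<close> term of \<open>K\<close> survives, and the symmetry of \<open>K\<close>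
    compares \<open>ric x y\<close> with \<open>ric v v\<close> times the metric.\<close>
  obtain v where v: "G v v = 1" using E_nonempty by blast
  have "ric v (J1 v) = 0" using ric_skew_J(1)[of v v] ric_sym[of v "J1 v"] by simp
  then have "K v (J2 v) x (J2 y) = - (ric v v * G x y)" for x y
    unfolding K_def by (simp add: J_calc rneg)
  moreover have "K x (J2 y) v (J2 v) = - ric x y" for x y
    unfolding K_def using v by (simp add: J_calc rneg)
  moreover define l where "l = ric v v"
  ultimately have r: "ric x y = l * G x y" for x y
    using sym[of x "J2 y" v "J2 v"] by simp
  then have "scal = l * N"
    unfolding scal_def using trace_G by (simp add: sum_distrib_left[symmetric])
  moreover have "l = (m + 8) / 4 * (4 * (l * m) / (m * (m + 8)))" if "m \<ge> 8" for m :: real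
    using that by (simp add: divide_simps)
  ultimately show ?thesis
    unfolding r[of x y] nu_def using N_ge by metis
qed

lemma \<tau>_nu: "\<tau>1 x y = - (N / 2) * nu * G (J1 x) y" "\<tau>2 x y = - (N / 2) * nu * G (J2 x) y"
  "\<tau>3 x y = - (N / 2) * nu * G (J3 x) y"
  unfolding \<tau>_ric ric_einstein using N_ge by (simp_all add: G_skew)

text \<open>The normalisation of \<open>nu\<close> removes every dimensional factor: the curvature
  of \<open>Q\<close> is \<open>nu\<close> times the Kaehler forms.\<close>

lemma R_comm:
  "R x y (J1 v) - J1 (R x y v) = nu *\<^sub>R (G (J2 x) y *\<^sub>R J3 v - G (J3 x) y *\<^sub>R J2 v)"
  "R x y (J2 v) - J2 (R x y v) = nu *\<^sub>R (G (J3 x) y *\<^sub>R J1 v - G (J1 x) y *\<^sub>R J3 v)"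
  "R x y (J3 v) - J3 (R x y v) = nu *\<^sub>R (G (J1 x) y *\<^sub>R J2 v - G (J2 x) y *\<^sub>R J1 v)"
proof -
  show "R x y (J1 v) - J1 (R x y v) = nu *\<^sub>R (G (J2 x) y *\<^sub>R J3 v - G (J3 x) y *\<^sub>R J2 v)"
    by (rule N_cancel) (unfold R_commutators \<tau>_nu, simp add: algebra_simps)
  show "R x y (J2 v) - J2 (R x y v) = nu *\<^sub>R (G (J3 x) y *\<^sub>R J1 v - G (J1 x) y *\<^sub>R J3 v)"
    by (rule N_cancel) (unfold R_commutators \<tau>_nu, simp add: algebra_simps)
  show "R x y (J3 v) - J3 (R x y v) = nu *\<^sub>R (G (J1 x) y *\<^sub>R J2 v - G (J2 x) y *\<^sub>R J1 v)"
    by (rule N_cancel) (unfold R_commutators \<tau>_nu, simp add: algebra_simps)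
qed

text \<open>Contraction with \<open>M\<close> sees only the part of \<open>R x y\<close> in S2H,
  whose coefficients are the \<tau>i. The formula serves both the constancy of \<open>nu\<close> and
  the derivative of the S2H part of \<nabla>X.\<close>

lemma trace_R_M: "(\<Sum>e\<in>E. \<Sum>f\<in>E. G (R x y e) f * M e f v w) = - (N / 2) * nu * M x y v w"
proof -
  have "bilinear (\<lambda>e f. G (R x y e) f)" by (auto simp: bilinear_def intro!: linearI)
  note * = trace_M[OF this, folded \<tau>1_def \<tau>2_def \<tau>3_def]
  show ?thesis
    unfolding * \<tau>_nu unfolding M_def by (simp add: algebra_simps)
qed

end

section \<open>Algebra of the contracted conformal-Killing equation\<close>

context quat_space
begin

lemma G_J_swap: "G (J1 y) x = - G (J1 x) y" "G (J2 y) x = - G (J2 x) y" "G (J3 y) x = - G (J3 x) y"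
  using G_skew[of x y] G_sym[of x] by simp_all

lemma Phi_J1: "Phi x y (J1 z) (J1 w) = Phi x y z w"
  unfolding Phi_def M_def by (simp add: J_calc algebra_simps)

lemma Phi_skew: "Phi x y w z = - Phi x y z w"
  unfolding Phi_def by simp

text \<open>Symmetrising in \<open>y\<close> and \<open>z\<close> removes \<open>M x w y z\<close>,
  which is skew in these arguments. What remains is the metric part of the symmetrised
  conformal-Killing equation, together with the terms that balance the contribution of
  \<open>h\<close>.\<close>

lemma Phi_polarized: "Phi x y z w + Phi x z y w =
    G x z * G y w + G x y * G z w - 2 * G x w * G y z + M x z y w + M x y z w"
proof -
  have "M x w y z + M x w z y = 0"
    unfolding M_def G_J_swap[of z y] by simp
  then show ?thesis unfolding Phi_def using G_sym[of z y] by (simp add: algebra_simps)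
qed

lemma trace_Phi: "(\<Sum>e\<in>E. Phi x e e w) = - (N + 2) * G x w"
proof -
  have t: "Phi x e e w = G x e * G e w - G x w * G e e + G (J1 x) e * G (J1 e) w + G (J2 x) e * G (J2 e) w
      + G (J3 x) e * G (J3 e) w" for e
    unfolding Phi_def M_def by simp
  show ?thesis
    unfolding t sum.distrib sum_subtractf sum_distrib_left[symmetric] contract(1)[OF linear_G(2)]
      contract(1)[OF linear_GJ(1)] contract(1)[OF linear_GJ(2)] contract(1)[OF linear_GJ(3)] trace_G
    by (simp add: J_sq algebra_simps)
qed

text \<open>\<open>star\<close> is the conformal-Killing equation symmetrised in its first two
  arguments; \<open>A\<close> stands for the derivative of \<open>u\<close>, and the \<theta>i are
  the coefficients of the derivative of \<open>h\<close>. It is contracted with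
  \<open>z = e\<close>, \<open>w = J1 e\<close>, where the trace of \<open>A y\<close> drops
  out.\<close>

lemma theta_trace1:
  fixes A :: "'v \<Rightarrow> 'v \<Rightarrow> 'v \<Rightarrow> real"
  assumes lin: "\<And>z w. linear (\<lambda>y. A y z w)" "\<And>y w. linear (\<lambda>z. A y z w)" "\<And>y z. linear (\<lambda>w. A y z w)"
    and \<theta>: "linear \<theta>1" "linear \<theta>2" "linear \<theta>3"
    and skew: "\<And>y z w. A y z w = - A y w z"
    and inv: "\<And>y z w. A y (J1 z) (J1 w) = A y z w" "\<And>y z w. A y (J2 z) (J2 w) = A y z w"
    and star: "\<And>y z w. A y z w + A z y w
      + \<theta>1 y * G (J1 z) w + \<theta>2 y * G (J2 z) w + \<theta>3 y * G (J3 z) w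
      + \<theta>1 z * G (J1 y) w + \<theta>2 z * G (J2 y) w + \<theta>3 z * G (J3 y) w
      = c * (G X z * G y w + G X y * G z w - 2 * G X w * G y z)"
  shows "(N + 1) * \<theta>1 (J1 y) - \<theta>2 (J2 y) - \<theta>3 (J3 y) = (\<Sum>e\<in>E. A e e y) + 3 * c * G X y"
proof -
  have n2: "A y z (- w) = - A y z w" "A y (- z) w = - A y z w" for y z w
    using linear_neg[OF lin(3)] linear_neg[OF lin(2)] by auto
  \<comment> \<open>\<open>J1\<close> anticommutes with \<open>J2\<close>, so conjugation by
    \<open>J2\<close> both preserves this trace and reverses its sign.\<close>
  have tr0: "(\<Sum>e\<in>E. A y e (J1 e)) = 0" for y
  proof -
    have "bilinear (\<lambda>p q. A y p (J1 q))"
      using lin linear_compose[OF linear_J(1), of "A y _"] by (auto simp: bilinear_def comp_def)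
    from trace_J_J(2)[OF this] have "(\<Sum>e\<in>E. A y (J2 e) (J3 e)) = (\<Sum>e\<in>E. A y e (J1 e))"
      by (simp add: J_prod)
    moreover have "A y (J2 e) (J3 e) = - A y e (J1 e)" for e
      using inv(2)[of y e "J1 e"] by (simp add: J_prod n2)
    ultimately show ?thesis by (simp add: sum_negf)
  qed
  have 2: "A e y (J1 e) = A e e (J1 y)" for e y
    using inv(1)[of e y "J1 e"] skew[of e "J1 y" e] by (simp add: J_sq n2)
  have "(\<Sum>e\<in>E. A y e (J1 e) + A e y (J1 e)
      + \<theta>1 y * G (J1 e) (J1 e) + \<theta>2 y * G (J2 e) (J1 e) + \<theta>3 y * G (J3 e) (J1 e)
      + \<theta>1 e * G (J1 y) (J1 e) + \<theta>2 e * G (J2 y) (J1 e) + \<theta>3 e * G (J3 y) (J1 e)) =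
      (\<Sum>e\<in>E. c * (G X e * G y (J1 e) + G X y * G e (J1 e) - 2 * G X (J1 e) * G y e))" for y
    by (simp only: star)
  moreover have "(\<Sum>e\<in>E. A y e (J1 e) + A e y (J1 e)
      + \<theta>1 y * G (J1 e) (J1 e) + \<theta>2 y * G (J2 e) (J1 e) + \<theta>3 y * G (J3 e) (J1 e)
      + \<theta>1 e * G (J1 y) (J1 e) + \<theta>2 e * G (J2 y) (J1 e) + \<theta>3 e * G (J3 y) (J1 e)) =
      (\<Sum>e\<in>E. A e e (J1 y)) + N * \<theta>1 y + \<theta>1 y - \<theta>2 (J3 y) + \<theta>3 (J2 y)" for y
    using tr0 trace_G contract(3)[OF \<theta>(1), of y] contract(3)[OF \<theta>(2), of "J3 y"] contract(3)[OF \<theta>(3), of "J2 y"]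
    by (simp add: J_calc sum.distrib 2 sum_distrib_left[symmetric] sum_negf sum_subtractf)
  moreover have "(\<Sum>e\<in>E. c * (G X e * G y (J1 e) + G X y * G e (J1 e) - 2 * G X (J1 e) * G y e)) =
      c * (- 3 * G X (J1 y))" for y
  proof -
    have t: "G X e * G y (J1 e) + G X y * G e (J1 e) - 2 * G X (J1 e) * G y e =
        2 * (G (J1 X) e * G y e) - G X e * G (J1 y) e" for e
      by (simp add: J_calc)
    have "(\<Sum>e\<in>E. G (J1 X) e * G y e) = - G (J1 y) X" "(\<Sum>e\<in>E. G X e * G (J1 y) e) = G (J1 y) X"
      using contract(1)[OF linear_G(1)] by (simp_all add: J_calc)
    then show ?thesis
      using G_sym[of X "J1 y"] unfolding t sum_distrib_left[symmetric] sum_subtractf by simp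
  qed
  ultimately have *: "(\<Sum>e\<in>E. A e e (J1 y)) + N * \<theta>1 y + \<theta>1 y - \<theta>2 (J3 y) + \<theta>3 (J2 y) =
      c * (- 3 * G X (J1 y))" for y
    by simp
  have n: "A e e (- y) = - A e e y" for e by (rule n2)
  show ?thesis
    using *[of "J1 y"] linear_neg[OF \<theta>(3)] n by (simp add: J_sq J_prod sum_negf algebra_simps)
qed

text \<open>Three contractions with the Kaehler forms and one with the metric determine the
  \<theta>i, after division by \<open>N + 2\<close> and \<open>N - 4\<close>. With these values the
  remainder \<open>d\<close> of \<open>A\<close> becomes totally skew, while its last two arguments
  inherit the invariance under \<open>J1\<close>; together these force \<open>d = 0\<close>.\<close>

lemma killing_forward:
  fixes A :: "'v \<Rightarrow> 'v \<Rightarrow> 'v \<Rightarrow> real"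
  assumes N: "N \<ge> 8" and c: "c = 1 / (N - 1)"
    and lin: "\<And>z w. linear (\<lambda>y. A y z w)" "\<And>y w. linear (\<lambda>z. A y z w)" "\<And>y z. linear (\<lambda>w. A y z w)"
    and \<theta>: "linear \<theta>1" "linear \<theta>2" "linear \<theta>3"
    and skew: "\<And>y z w. A y z w = - A y w z"
    and inv: "\<And>y z w. A y (J1 z) (J1 w) = A y z w" "\<And>y z w. A y (J2 z) (J2 w) = A y z w"
      "\<And>y z w. A y (J3 z) (J3 w) = A y z w"
    and star: "\<And>y z w. A y z w + A z y w
      + \<theta>1 y * G (J1 z) w + \<theta>2 y * G (J2 z) w + \<theta>3 y * G (J3 z) w
      + \<theta>1 z * G (J1 y) w + \<theta>2 z * G (J2 y) w + \<theta>3 z * G (J3 y) w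
      = c * (G X z * G y w + G X y * G z w - 2 * G X w * G y z)"
  shows "\<theta>1 y = c * G X (J1 y)" "\<theta>2 y = c * G X (J2 y)" "\<theta>3 y = c * G X (J3 y)"
    "A y z w = c * Phi X y z w"
proof -
  interpret c2: quat_space G E J2 J3 J1 by (rule cyclic)
  interpret c3: quat_space G E J3 J1 J2 by (rule c2.cyclic)
  let ?a = "\<lambda>y. \<Sum>e\<in>E. A e e y"
  have e1: "(N + 1) * \<theta>1 (J1 y) - \<theta>2 (J2 y) - \<theta>3 (J3 y) = ?a y + 3 * c * G X y" for y
    by (rule theta_trace1[OF lin \<theta> skew inv(1,2) star])
  have e2: "(N + 1) * \<theta>2 (J2 y) - \<theta>3 (J3 y) - \<theta>1 (J1 y) = ?a y + 3 * c * G X y" for y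
  proof (rule c2.theta_trace1[OF lin \<theta>(2,3,1) skew inv(2,3)])
    show "A y z w + A z y w + \<theta>2 y * G (J2 z) w + \<theta>3 y * G (J3 z) w + \<theta>1 y * G (J1 z) w
      + \<theta>2 z * G (J2 y) w + \<theta>3 z * G (J3 y) w + \<theta>1 z * G (J1 y) w
      = c * (G X z * G y w + G X y * G z w - 2 * G X w * G y z)" for y z w
      using star[of y z w] by linarith
  qed
  have e3: "(N + 1) * \<theta>3 (J3 y) - \<theta>1 (J1 y) - \<theta>2 (J2 y) = ?a y + 3 * c * G X y" for y
  proof (rule c3.theta_trace1[OF lin \<theta>(3,1,2) skew inv(3,1)])
    show "A y z w + A z y w + \<theta>3 y * G (J3 z) w + \<theta>1 y * G (J1 z) w + \<theta>2 y * G (J2 z) w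
      + \<theta>3 z * G (J3 y) w + \<theta>1 z * G (J1 y) w + \<theta>2 z * G (J2 y) w
      = c * (G X z * G y w + G X y * G z w - 2 * G X w * G y z)" for y z w
      using star[of y z w] by linarith
  qed
  have c1: "c * (1 - N) = - 1" using N c by (simp add: field_simps)
  have a: "?a w - \<theta>1 (J1 w) - \<theta>2 (J2 w) - \<theta>3 (J3 w) = - G X w" for w
  proof -
    have "(\<Sum>e\<in>E. A e e w + A e e w + \<theta>1 e * G (J1 e) w + \<theta>2 e * G (J2 e) w + \<theta>3 e * G (J3 e) w
      + \<theta>1 e * G (J1 e) w + \<theta>2 e * G (J2 e) w + \<theta>3 e * G (J3 e) w) =
      (\<Sum>e\<in>E. c * (G X e * G e w + G X e * G e w - 2 * G X w * G e e))"
      by (simp only: star)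
    moreover have "(\<Sum>e\<in>E. c * (G X e * G e w + G X e * G e w - 2 * G X w * G e e)) = 2 * (c * (1 - N)) * G X w"
    proof -
      have t: "c * (G X e * G e w + G X e * G e w - 2 * G X w * G e e) =
          2 * c * (G X e * G e w) - 2 * c * G X w * G e e" for e
        by (simp add: algebra_simps)
      show ?thesis
        unfolding t sum_subtractf sum_distrib_left[symmetric] contract(1)[OF linear_G(2)] trace_G
        by (simp add: algebra_simps)
    qed
    moreover have "\<theta> e * G (J e) w = - (\<theta> e * G e (J w))" if "\<And>v w. G v (J w) = - G (J v) w" for \<theta> J e
      using that by simp
    note t = this[OF G_skew(1)] this[OF G_skew(2)] this[OF G_skew(3)]
    ultimately show ?thesis
      unfolding c1 t using contract(4)[OF \<theta>(1), of "J1 w"] contract(4)[OF \<theta>(2), of "J2 w"] contract(4)[OF \<theta>(3), of "J3 w"]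
      by (simp add: sum.distrib sum_negf sum_subtractf sum_distrib_left[symmetric])
  qed
  have \<phi>: "\<theta>1 (J1 y) = - c * G X y" "\<theta>2 (J2 y) = - c * G X y" "\<theta>3 (J3 y) = - c * G X y" for y
  proof -
    have "(N + 2) * (\<theta>1 (J1 y) - \<theta>2 (J2 y)) = 0" "(N + 2) * (\<theta>2 (J2 y) - \<theta>3 (J3 y)) = 0"
      using e1[of y] e2[of y] e3[of y] by (simp_all add: algebra_simps)
    then have eq: "\<theta>1 (J1 y) = \<theta>2 (J2 y)" "\<theta>2 (J2 y) = \<theta>3 (J3 y)" using N by auto
    have "(N - 4) * \<theta>1 (J1 y) = (3 * c - 1) * G X y"
      using e1[of y] a[of y] unfolding eq by (simp add: algebra_simps)
    also have "3 * c - 1 = (N - 4) * (- c)" using c1 by (simp add: algebra_simps)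
    finally have "(N - 4) * (\<theta>1 (J1 y) - (- c * G X y)) = 0" by (simp only: right_diff_distrib)
    then show "\<theta>1 (J1 y) = - c * G X y" using N by simp
    then show "\<theta>2 (J2 y) = - c * G X y" "\<theta>3 (J3 y) = - c * G X y" using eq by auto
  qed
  show \<theta>_eq: "\<theta>1 y = c * G X (J1 y)" "\<theta>2 y = c * G X (J2 y)" "\<theta>3 y = c * G X (J3 y)" for y
    using \<phi>(1)[of "J1 y"] \<phi>(2)[of "J2 y"] \<phi>(3)[of "J3 y"] \<theta>
    by (simp_all add: J_sq linear_neg)
  define d where "d y z w = A y z w - c * Phi X y z w" for y z w
  have d1: "d y z w = - d z y w" for y z w
  proof -
    have "A y z w + A z y w = c * (Phi X y z w + Phi X z y w)"
      using star[of y z w] unfolding \<theta>_eq Phi_polarized M_def by (simp add: G_skew algebra_simps)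
    then show ?thesis unfolding d_def by (simp add: algebra_simps)
  qed
  have d2: "d y z w = - d y w z" for y z w
    unfolding d_def using skew[of y z w] Phi_skew[of X y z w] by simp
  have d3: "d y (J1 z) w = - d y z (J1 w)" for y z w
  proof -
    have "d y (J1 z) (J1 (J1 w)) = d y z (J1 w)" unfolding d_def by (simp only: inv Phi_J1)
    moreover have "Phi X y z (- w) = - Phi X y z w" for y z w
      by (simp add: Phi_def M_def algebra_simps)
    then have "d y z (- w) = - d y z w" for y z w
      unfolding d_def using linear_neg[OF lin(3)] by simp
    ultimately show ?thesis by (simp add: J_sq)
  qed
  \<comment> \<open>Each move of \<open>J1\<close> from one argument to another changes the sign.
    Moving it from the first to the second argument directly, or by way of the third, gives opposite
    results.\<close>
  have "d (J1 y) z w = 0" for y z w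
  proof -
    have "d (J1 y) z w = d y (J1 z) w"
      using d1[of "J1 y" z w] d3[of z y w] d1[of z y "J1 w"] d3[of y z w] by linarith
    moreover have "d (J1 y) z w = - d y (J1 z) w"
      using d1[of "J1 y" z w] d2[of z "J1 y" w] d1[of z w "J1 y"] d3[of w z y] d1[of w "J1 z" y]
        d2[of "J1 z" w y] d1[of y "J1 z" w] by linarith
    ultimately show ?thesis by simp
  qed
  from this[of "- J1 y" z w] show "A y z w = c * Phi X y z w" unfolding d_def by (simp add: J_sq)
qed

end

section \<open>Consequences of the Ricci identities for u and h\<close>

context quat_curvature
begin

text \<open>The hypothesis is the Ricci identity for a solution \<open>u\<close>, with
  \<open>P\<close> the derivative of its vector field. After contraction over
  \<open>y = v = e\<close> the curvature side is skew: one term is a multiple of \<open>u\<close> by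
  the Einstein property, the other is \<open>T\<close>, skew by pair symmetry. So the symmetric part
  \<open>s\<close> of \<open>P\<close> satisfies a homogeneous linear equation, which makes it first
  invariant under the \<open>Ji\<close>, then a multiple of the metric, and finally zero by its
  trace.\<close>

lemma integrability_killing:
  assumes c: "c \<noteq> 0" and u: "bilinear u" "\<And>v w. u v w = - u w v" and P: "linear P"
    and eq: "\<And>y z v w. - u (R y z v) w - u v (R y z w) = c * (Phi (P y) z v w - Phi (P z) y v w)"
  shows "G (P z) w = - G z (P w)"
proof -
  have lu: "linear (u v)" "linear (\<lambda>v. u v w)" for v w using u(1) unfolding bilinear_def by auto
  define T where "T z w = (\<Sum>e\<in>E. u e (R e z w))" for z w
  have T: "T z w = (\<Sum>e\<in>E. \<Sum>f\<in>E. G (R e z w) f * u e f)" for z w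
    unfolding T_def using contract(1)[OF lu(1)] by simp
  have T_skew: "T w z = - T z w" for z w
  proof -
    have r: "G (R e w z) f = G (R f z w) e" for e f
      using R_pair[of e w z f] R_swap[of z f e] R_skew'[of w f z e] G_sym[of _ w] by simp
    have "T w z = (\<Sum>f\<in>E. \<Sum>e\<in>E. G (R f z w) e * u e f)"
      unfolding T r by (rule sum.swap)
    also have "\<dots> = (\<Sum>f\<in>E. \<Sum>e\<in>E. - (G (R f z w) e * u f e))"
    proof (intro sum.cong refl)
      show "G (R f z w) e * u e f = - (G (R f z w) e * u f e)" for e f
        using u(2)[of e f] by simp
    qed
    finally show ?thesis unfolding T by (simp add: sum_negf)
  qed
  define k where "k = (N + 8) / 4 * nu"
  have S: "(\<Sum>e\<in>E. u (R e z e) w) = - k * u z w" for z w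
  proof -
    have "(\<Sum>e\<in>E. u (R e z e) w) = (\<Sum>e\<in>E. \<Sum>f\<in>E. G (R e z e) f * u f w)"
      using contract(1)[OF lu(2)] by simp
    also have "\<dots> = (\<Sum>f\<in>E. \<Sum>e\<in>E. - G (R e z f) e * u f w)"
      by (subst sum.swap) (simp add: R_skew'[symmetric] G_sym[of _ "R _ _ _"])
    also have "\<dots> = (\<Sum>f\<in>E. - ric z f * u f w)"
      unfolding ric_def by (simp add: sum_distrib_right sum_negf)
    also have "\<dots> = - k * (\<Sum>f\<in>E. G z f * u f w)"
      unfolding ric_einstein k_def[symmetric] by (simp add: sum_distrib_left mult.assoc sum_negf)
    finally show ?thesis using contract(1)[OF lu(2)] by simp
  qed
  define t where "t = (\<Sum>e\<in>E. G (P e) e)"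
  define t1 where "t1 = (\<Sum>e\<in>E. G (J1 (P e)) e)"
  define t2 where "t2 = (\<Sum>e\<in>E. G (J2 (P e)) e)"
  define t3 where "t3 = (\<Sum>e\<in>E. G (J3 (P e)) e)"
  have lp: "linear (\<lambda>e. G (P e) w)" "linear (\<lambda>e. G (J1 (P e)) w)" "linear (\<lambda>e. G (J2 (P e)) w)"
    "linear (\<lambda>e. G (J3 (P e)) w)" for w
    using linear_compose[OF P linear_G(2)[of w]] linear_compose[OF P linear_GJ(1)[of w]]
      linear_compose[OF P linear_GJ(2)[of w]] linear_compose[OF P linear_GJ(3)[of w]]
    by (auto simp: comp_def)
  have 1: "(\<Sum>e\<in>E. Phi (P e) z e w) = t * G z w - G (P z) w + t1 * G (J1 z) w + t2 * G (J2 z) w + t3 * G (J3 z) w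
      + G (P (J1 z)) (J1 w) + G (P (J2 z)) (J2 w) + G (P (J3 z)) (J3 w)" for z w
    unfolding Phi_def M_def t_def t1_def t2_def t3_def
    by (simp add: sum.distrib sum_subtractf sum_distrib_right[symmetric] contract(3)[OF lp(1)]
        contract(3)[OF lp(2)] contract(3)[OF lp(3)] contract(3)[OF lp(4)] J_calc)
  have main: "t * G z w + (N + 1) * G (P z) w + t1 * G (J1 z) w + t2 * G (J2 z) w + t3 * G (J3 z) w
      + G (P (J1 z)) (J1 w) + G (P (J2 z)) (J2 w) + G (P (J3 z)) (J3 w) = (k * u z w - T z w) / c" for z w
  proof -
    have "(\<Sum>e\<in>E. - u (R e z e) w - u e (R e z w)) = c * ((\<Sum>e\<in>E. Phi (P e) z e w) - (\<Sum>e\<in>E. Phi (P z) e e w))"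
      unfolding eq by (simp add: sum_distrib_left[symmetric] sum_subtractf)
    then have "k * u z w - T z w = c * ((\<Sum>e\<in>E. Phi (P e) z e w) - (\<Sum>e\<in>E. Phi (P z) e e w))"
      using S[of z w] unfolding T_def by (simp add: sum_subtractf sum_negf)
    then show ?thesis unfolding 1 trace_Phi using c by (simp add: field_simps)
  qed
  define s where "s z w = G (P z) w + G (P w) z" for z w
  have sym: "2 * t * G z w + (N + 1) * s z w + s (J1 z) (J1 w) + s (J2 z) (J2 w) + s (J3 z) (J3 w) = 0" for z w
  proof -
    have "(k * u z w - T z w) / c + (k * u w z - T w z) / c = 0"
      using T_skew[of w z] u(2)[of w z] by (simp add: add_divide_distrib[symmetric])
    moreover have "G (J1 w) z = - G (J1 z) w" "G (J2 w) z = - G (J2 z) w" "G (J3 w) z = - G (J3 z) w"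
      using G_skew G_sym by metis+
    ultimately show ?thesis
      using main[of z w] main[of w z] G_sym[of w z] unfolding s_def by (simp add: algebra_simps)
  qed
  have sneg: "s (- z) (- w) = s z w" for z w
    unfolding s_def using linear_neg[OF P] by simp
  have Gn: "G (- z) (- w) = G z w" "G (J1 z) (J1 w) = G z w" "G (J2 z) (J2 w) = G z w" "G (J3 z) (J3 w) = G z w" for z w
    by (simp_all add: J_calc)
  \<comment> \<open>Replacing \<open>z\<close>, \<open>w\<close> by their images under one
    \<open>Ji\<close> permutes the four values of \<open>s\<close>; subtracting the two equations
    leaves \<open>N\<close> times a single difference.\<close>
  have sJ: "s (J1 z) (J1 w) = s z w" "s (J2 z) (J2 w) = s z w" "s (J3 z) (J3 w) = s z w" for z w
  proof -
    have "N * (s z w - s (J1 z) (J1 w)) = 0"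
      using sym[of z w] sym[of "J1 z" "J1 w"]
      unfolding J_sq J_prod sneg Gn distrib_right right_diff_distrib by linarith
    moreover have "N * (s z w - s (J2 z) (J2 w)) = 0"
      using sym[of z w] sym[of "J2 z" "J2 w"]
      unfolding J_sq J_prod sneg Gn distrib_right right_diff_distrib by linarith
    moreover have "N * (s z w - s (J3 z) (J3 w)) = 0"
      using sym[of z w] sym[of "J3 z" "J3 w"]
      unfolding J_sq J_prod sneg Gn distrib_right right_diff_distrib by linarith
    ultimately show "s (J1 z) (J1 w) = s z w" "s (J2 z) (J2 w) = s z w" "s (J3 z) (J3 w) = s z w"
      using N_ge by auto
  qed
  have s4: "(N + 4) * s z w = - (2 * t) * G z w" for z w
    using sym[of z w] unfolding sJ by (simp add: algebra_simps)
  have "(\<Sum>e\<in>E. (N + 4) * s e e) = (\<Sum>e\<in>E. - (2 * t) * G e e)"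
    by (simp only: s4)
  then have "(N + 4) * (\<Sum>e\<in>E. s e e) = - (2 * t) * N"
    using trace_G by (simp only: sum_distrib_left[symmetric])
  moreover have "(\<Sum>e\<in>E. s e e) = 2 * t"
    unfolding s_def t_def by (simp add: sum_distrib_left)
  ultimately have "(2 * N + 4) * (2 * t) = 0" by (simp only: algebra_simps) simp
  then have "t = 0" using N_ge by auto
  then have "s z w = 0" using s4[of z w] N_ge by auto
  then show ?thesis unfolding s_def using G_sym[of "P w" z] by simp
qed

text \<open>The hypothesis is the Ricci identity for the form with components \<open>f1\<close>,
  \<open>f2\<close>, \<open>f3\<close>. On \<open>v\<close>, \<open>J2 v\<close> with
  \<open>v\<close> of unit length it reduces to its omega_2 component, where only \<open>f1\<close>
  and \<open>f3\<close> occur; the trace over \<open>z = J3 y\<close> then removes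
  \<open>f3\<close>.\<close>

lemma integrability_S2H1:
  assumes P: "linear P"
    and eq: "\<And>y z v w. - (f1 * G (J1 (R y z v)) w + f2 * G (J2 (R y z v)) w + f3 * G (J3 (R y z v)) w)
      - (f1 * G (J1 v) (R y z w) + f2 * G (J2 v) (R y z w) + f3 * G (J3 v) (R y z w)) =
      c * (M z (P y) v w - M y (P z) v w)"
  shows "nu * f1 * N = - 2 * c * (\<Sum>e\<in>E. G (P e) (J1 e))"
proof -
  obtain v where v: "G v v = 1" using E_nonempty by blast
  have Jv: "G (J1 v) (J2 v) = 0" "G (J3 v) (J2 v) = 0" "G (J2 v) (J2 v) = 1"
    using v by (simp_all add: J_calc)
  have comm: "G (R y z (J1 v)) w = G (J1 (R y z v)) w + nu * (G (J2 y) z * G (J3 v) w - G (J3 y) z * G (J2 v) w)"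
    "G (R y z (J2 v)) w = G (J2 (R y z v)) w + nu * (G (J3 y) z * G (J1 v) w - G (J1 y) z * G (J3 v) w)"
    "G (R y z (J3 v)) w = G (J3 (R y z v)) w + nu * (G (J1 y) z * G (J2 v) w - G (J2 y) z * G (J1 v) w)" for y z v w
    using arg_cong[OF R_comm(1)[of y z v], of "\<lambda>v. G v w"] arg_cong[OF R_comm(2)[of y z v], of "\<lambda>v. G v w"]
      arg_cong[OF R_comm(3)[of y z v], of "\<lambda>v. G v w"] by simp_all
  have *: "nu * (f3 * G (J1 y) z - f1 * G (J3 y) z) = c * (G (J2 z) (P y) - G (J2 y) (P z))" for y z
    using eq[of y z v "J2 v"] unfolding R_skew' comm M_def Jv by (simp add: algebra_simps)
  have "(\<Sum>e\<in>E. nu * (f3 * G (J1 e) (J3 e) - f1 * G (J3 e) (J3 e))) = c * ((\<Sum>e\<in>E. G (J2 (J3 e)) (P e)) - (\<Sum>e\<in>E. G (J2 e) (P (J3 e))))"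
    unfolding * by (simp add: sum_distrib_left[symmetric] sum_subtractf)
  moreover have "bilinear (\<lambda>p q. G (J2 p) (P q))"
    using P by (auto simp: bilinear_def linear_add linear_cmul intro!: linearI)
  note trace_J(3)[OF this]
  moreover have "(\<Sum>e\<in>E. nu * (f3 * G (J1 e) (J3 e) - f1 * G (J3 e) (J3 e))) = - nu * f1 * N"
    using trace_G by (simp add: J_calc sum_distrib_left[symmetric] sum_negf)
  ultimately show ?thesis using G_sym by (simp add: J_prod algebra_simps)
qed

end

subsection \<open>Change of the admissible triple\<close>

lemma sum_1_3: "(\<Sum>i=1..3. f i) = f 1 + f 2 + f (3::nat)"
  by (simp add: eval_nat_numeral)

lemma admissibleD:
  assumes "admissible_triple G Q I"
  shows "i \<in> {1..3} \<Longrightarrow> linear (I i)" "i \<in> {1..3} \<Longrightarrow> I i (I i v) = - v"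
    "i \<in> {1..3} \<Longrightarrow> G (I i v) (I i w) = G v w"
    "i \<in> {1..3} \<Longrightarrow> j \<in> {1..3} \<Longrightarrow> i \<noteq> j \<Longrightarrow> I i (I j v) = - I j (I i v)"
    "I 3 v = I 1 (I 2 v)"
    "Q = {A. \<exists>a :: nat \<Rightarrow> real. \<forall>v. A v = (\<Sum>i=1..3. a i *\<^sub>R I i v)}"
proof -
  note * = assms[unfolded admissible_triple_def]
  note 1 = *[THEN conjunct1, THEN bspec]
  note 2 = *[THEN conjunct2, THEN conjunct1, THEN bspec, THEN bspec, THEN mp, THEN spec]
  show "i \<in> {1..3} \<Longrightarrow> linear (I i)" "i \<in> {1..3} \<Longrightarrow> I i (I i v) = - v"
    "i \<in> {1..3} \<Longrightarrow> G (I i v) (I i w) = G v w"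
    using 1[of i] by simp_all
  show "i \<in> {1..3} \<Longrightarrow> j \<in> {1..3} \<Longrightarrow> i \<noteq> j \<Longrightarrow> I i (I j v) = - I j (I i v)"
    by (rule 2)
  show "I 3 v = I 1 (I 2 v)" "Q = {A. \<exists>a :: nat \<Rightarrow> real. \<forall>v. A v = (\<Sum>i=1..3. a i *\<^sub>R I i v)}"
    using *[THEN conjunct2, THEN conjunct2] by simp_all
qed

lemma (in onb_space) quat_space_admissible:
  assumes "admissible_triple G Q I"
  shows "quat_space G E (I 1) (I 2) (I 3)"
proof -
  have lin: "linear (I 1)" "linear (I 2)" "linear (I 3)"
    and sq: "I 1 (I 1 v) = - v" "I 2 (I 2 v) = - v" "I 3 (I 3 v) = - v"
    and iso: "G (I 1 v) (I 1 w) = G v w" "G (I 2 v) (I 2 w) = G v w" "G (I 3 v) (I 3 w) = G v w"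
    and anti: "I 2 (I 1 v) = - I 1 (I 2 v)" "I 3 (I 1 v) = - I 1 (I 3 v)" "I 3 (I 2 v) = - I 2 (I 3 v)"
    and prod: "I 3 v = I 1 (I 2 v)" for v w
    using admissibleD(1,2,3)[OF assms, of 1] admissibleD(1,2,3)[OF assms, of 2] admissibleD(1,2,3)[OF assms, of 3]
      admissibleD(4)[OF assms, of 2 1] admissibleD(4)[OF assms, of 3 1] admissibleD(4)[OF assms, of 3 2]
      admissibleD(5)[OF assms] by simp_all
  have n: "I 1 (- v) = - I 1 v" "I 2 (- v) = - I 2 v" for v
    using lin linear_neg by blast+
  have p13: "I 1 (I 3 v) = - I 2 v" for v
    unfolding prod sq ..
  have p32: "I 3 (I 2 v) = - I 1 v" for v
    unfolding prod sq n ..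
  show ?thesis
  proof (intro quat_space.intro quat_space_axioms.intro onb_space_axioms lin sq)
    fix v w
    show "I 1 (I 2 v) = I 3 v" "I 1 (I 3 v) = - I 2 v" "I 3 (I 2 v) = - I 1 v" "I 2 (I 1 v) = - I 3 v"
      using prod p13 p32 anti by simp_all
    show "I 3 (I 1 v) = I 2 v" using anti(2) p13 by simp
    show "I 2 (I 3 v) = I 1 v" using anti(3)[of v] p32[of v] by (metis neg_equal_iff_equal)
    show "G v (I 1 w) = - G (I 1 v) w" using iso(1)[of v "I 1 w"] sq by simp
    show "G v (I 2 w) = - G (I 2 v) w" using iso(2)[of v "I 2 w"] sq by simp
    show "G v (I 3 w) = - G (I 3 v) w" using iso(3)[of v "I 3 w"] sq by simp
  qed
qed

lemma admissible_orthonormal: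
  assumes I: "admissible_triple G Q I" and G: "onb_space G E" and ij: "i \<in> {1..3}" "j \<in> {1..3}"
  shows "G (I i v) (I j v) = (if i = j then G v v else 0)"
proof -
  interpret onb_space G E by (rule G)
  interpret quat_space G E "I 1" "I 2" "I 3" by (rule quat_space_admissible[OF I])
  have "i = 1 \<or> i = 2 \<or> i = 3" "j = 1 \<or> j = 2 \<or> j = 3" using ij by auto
  then show ?thesis by (elim disjE; simp add: J_calc del: One_nat_def)
qed

lemma admissible_mem:
  assumes "admissible_triple G Q I" "i \<in> {1..3}"
  shows "I i \<in> Q"
proof -
  have "I i v = (\<Sum>j=1..3. (if j = i then 1 else 0) *\<^sub>R I j v)" for v
    using assms(2) by (simp add: if_distrib[of "\<lambda>a. a *\<^sub>R _"] cong: if_cong)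
  then show ?thesis
    unfolding admissibleD(6)[OF assms(1)] by (intro CollectI exI[of _ "\<lambda>j. if j = i then 1 else 0"] allI)
qed

text \<open>For a unit vector \<open>z\<close> the vectors \<open>I j z\<close> are orthonormal, so
  the coefficients of an element of \<open>Q\<close> can be read off at \<open>z\<close>
  alone.\<close>

lemma admissible_expand:
  assumes I: "admissible_triple G Q I" and G: "onb_space G E" and A: "A \<in> Q" and z: "G z z = 1"
  shows "A v = (\<Sum>j=1..3. G (A z) (I j z) *\<^sub>R I j v)"
proof -
  interpret onb_space G E by (rule G)
  obtain a :: "nat \<Rightarrow> real" where a: "\<And>v. A v = (\<Sum>j=1..3. a j *\<^sub>R I j v)"
    using A unfolding admissibleD(6)[OF I] by auto
  have "G (A z) (I j z) = a j" if "j \<in> {1..3}" for j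
  proof -
    have "G (A z) (I j z) = (\<Sum>i=1..3. a i * (if i = j then 1 else 0))"
      unfolding a G_sum using z that
      by (intro sum.cong refl) (simp only: admissible_orthonormal[OF I G _ that] G_simps)
    also have "\<dots> = a j"
      using that by (simp add: if_distrib[of "\<lambda>b. _ * b"] cong: if_cong)
    finally show ?thesis .
  qed
  then show ?thesis using a by simp
qed

text \<open>Two admissible triples differ by an orthogonal matrix. Orthogonality is recorded for
  rows and for columns because both kinds of sums occur.\<close>

definition triple_change ::
    "(nat \<Rightarrow> 'v::real_vector \<Rightarrow> 'v) \<Rightarrow> (nat \<Rightarrow> 'v \<Rightarrow> 'v) \<Rightarrow> (nat \<Rightarrow> nat \<Rightarrow> real) \<Rightarrow> bool" where
  "triple_change I I' C \<longleftrightarrow>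
    (\<forall>i\<in>{1..3}. \<forall>v. I' i v = (\<Sum>j=1..3. C i j *\<^sub>R I j v)) \<and>
    (\<forall>i\<in>{1..3}. \<forall>k\<in>{1..3}. (\<Sum>j=1..3. C i j * C k j) = (if i = k then 1 else 0)) \<and>
    (\<forall>j\<in>{1..3}. \<forall>k\<in>{1..3}. (\<Sum>i=1..3. C i j * C i k) = (if j = k then 1 else 0))"

lemma triple_changeD:
  assumes "triple_change I I' C"
  shows "i \<in> {1..3} \<Longrightarrow> I' i v = (\<Sum>j=1..3. C i j *\<^sub>R I j v)"
    "i \<in> {1..3} \<Longrightarrow> k \<in> {1..3} \<Longrightarrow> (\<Sum>j=1..3. C i j * C k j) = (if i = k then 1 else 0)"
    "j \<in> {1..3} \<Longrightarrow> k \<in> {1..3} \<Longrightarrow> (\<Sum>i=1..3. C i j * C i k) = (if j = k then 1 else 0)"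
  using assms unfolding triple_change_def by simp_all

lemma admissible_change:
  assumes I: "admissible_triple G Q I" and I': "admissible_triple G Q I'" and G: "onb_space G E"
  shows "\<exists>C. triple_change I I' C"
proof -
  interpret onb_space G E by (rule G)
  obtain z where z: "G z z = 1" using E_nonempty by blast
  define C where "C i j = G (I' i z) (I j z)" for i j
  have 1: "I' i v = (\<Sum>j=1..3. C i j *\<^sub>R I j v)" if "i \<in> {1..3}" for i v
    unfolding C_def by (rule admissible_expand[OF I G admissible_mem[OF I' that] z])
  have 2: "I j v = (\<Sum>i=1..3. C i j *\<^sub>R I' i v)" if "j \<in> {1..3}" for j v
    unfolding C_def G_sym[of "I' _ z"] by (rule admissible_expand[OF I' G admissible_mem[OF I that] z])
  have 3: "(\<Sum>j=1..3. C i j * C k j) = (if i = k then 1 else 0)" if "i \<in> {1..3}" "k \<in> {1..3}" for i k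
  proof -
    have "(\<Sum>j=1..3. C i j * C k j) = G (I' i z) (\<Sum>j=1..3. C k j *\<^sub>R I j z)"
      unfolding G_sum by (simp add: C_def mult.commute)
    then show ?thesis
      unfolding 1[OF that(2), symmetric] admissible_orthonormal[OF I' G that] z .
  qed
  have 4: "(\<Sum>i=1..3. C i j * C i k) = (if j = k then 1 else 0)" if "j \<in> {1..3}" "k \<in> {1..3}" for j k
  proof -
    have "(\<Sum>i=1..3. C i j * C i k) = G (\<Sum>i=1..3. C i j *\<^sub>R I' i z) (I k z)"
      unfolding G_sum by (simp add: C_def)
    then show ?thesis
      unfolding 2[OF that(1), symmetric] admissible_orthonormal[OF I G that] z .
  qed
  show ?thesis unfolding triple_change_def by (intro exI[of _ C] conjI ballI allI 1 3 4)
qed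

lemma orthogonal_sum:
  fixes C :: "nat \<Rightarrow> nat \<Rightarrow> real"
  assumes "\<And>j k. j \<in> S \<Longrightarrow> k \<in> S \<Longrightarrow> (\<Sum>i\<in>S. C i j * C i k) = (if j = k then 1 else 0)" "finite S"
  shows "(\<Sum>i\<in>S. \<Sum>j\<in>S. \<Sum>k\<in>S. C i j * C i k * b j k) = (\<Sum>j\<in>S. b j j)"
proof -
  have "(\<Sum>i\<in>S. \<Sum>j\<in>S. \<Sum>k\<in>S. C i j * C i k * b j k) = (\<Sum>j\<in>S. \<Sum>i\<in>S. \<Sum>k\<in>S. C i j * C i k * b j k)"
    by (rule sum.swap)
  also have "\<dots> = (\<Sum>j\<in>S. \<Sum>k\<in>S. (\<Sum>i\<in>S. C i j * C i k) * b j k)"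
    by (rule sum.cong[OF refl], subst sum.swap) (simp add: sum_distrib_right)
  also have "\<dots> = (\<Sum>j\<in>S. \<Sum>k\<in>S. (if j = k then 1 else 0) * b j k)"
    by (intro sum.cong refl) (simp add: assms(1))
  also have "\<dots> = (\<Sum>j\<in>S. b j j)"
    using assms(2) by (simp add: if_distrib[of "\<lambda>a. a * _"] cong: if_cong)
  finally show ?thesis .
qed

lemma M_change:
  assumes I: "admissible_triple G Q I" and I': "admissible_triple G Q I'" and G: "onb_space G E"
  shows "(\<Sum>i=1..3. G (I' i a) b * G (I' i c) d) = (\<Sum>i=1..3. G (I i a) b * G (I i c) d)"
proof -
  interpret onb_space G E by (rule G)
  obtain C where "triple_change I I' C" using admissible_change[OF I I' G] ..
  note C = triple_changeD[OF this]
  have "(\<Sum>i=1..3. G (I' i a) b * G (I' i c) d) =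
      (\<Sum>i=1..3. \<Sum>j=1..3. \<Sum>k=1..3. C i j * C i k * (G (I j a) b * G (I k c) d))"
    by (intro sum.cong refl) (simp only: C(1) G_sum G_simps sum_product mult.assoc mult.left_commute)
  also have "\<dots> = (\<Sum>i=1..3. G (I i a) b * G (I i c) d)"
    by (rule orthogonal_sum[OF C(3)]) auto
  finally show ?thesis .
qed

lemma bilinear_sum2:
  assumes "bilinear B"
  shows "B (\<Sum>j\<in>S. a j *\<^sub>R x j) (\<Sum>k\<in>T. b k *\<^sub>R y k) = (\<Sum>j\<in>S. \<Sum>k\<in>T. a j * b k * (B (x j) (y k) :: real))"
proof -
  have l: "linear (\<lambda>x. B x y)" "linear (B x)" for x y using assms unfolding bilinear_def by auto
  show ?thesis
    by (simp add: linear_sum[OF l(1)] linear_cmul[OF l(1)] linear_sum[OF l(2)] linear_cmul[OF l(2)]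
        sum_distrib_left mult.assoc) (subst sum.swap, simp add: mult.left_commute)
qed

text \<open>Anticommutation cancels \<open>B (I j v) (I k w)\<close> against
  \<open>B (I k v) (I j w)\<close> for distinct indices, so invariance under each \<open>I j\<close>
  passes to every combination whose coefficients have unit length.\<close>

lemma invariant_change:
  assumes I: "admissible_triple G Q I" and I': "admissible_triple G Q I'" and G: "onb_space G E" and B: "bilinear B"
    and inv: "\<And>i v w. i \<in> {1..3} \<Longrightarrow> B (I i v) (I i w) = (B v w :: real)" and i: "i \<in> {1..3}"
  shows "B (I' i v) (I' i w) = B v w"
proof -
  obtain C where "triple_change I I' C" using admissible_change[OF I I' G] ..
  note C = triple_changeD[OF this]
  note sq = admissibleD(2)[OF I] and anti = admissibleD(4)[OF I]
  have sym: "B (I j v) (I k w) + B (I k v) (I j w) = (if j = k then 2 * B v w else 0)"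
    if jk: "j \<in> {1..3}" "k \<in> {1..3}" for j k
  proof (cases "j = k")
    case False
    have "B (I j v) (I k w) = B (I j (I j v)) (I j (I k w))" using inv[OF jk(1)] by simp
    moreover have "B (I k v) (I j w) = B (I k (I k v)) (I k (I j w))" using inv[OF jk(2)] by simp
    ultimately show ?thesis
      using False sq[OF jk(1)] sq[OF jk(2)] anti[OF jk False] by (simp add: bilinear_lneg[OF B] bilinear_rneg[OF B])
  next
    case True
    then show ?thesis using inv[OF jk(1), of v w] by simp
  qed
  let ?S = "\<lambda>b. \<Sum>j=1..3. \<Sum>k=1..3. C i j * C i k * b j k"
  have "B (I' i v) (I' i w) = ?S (\<lambda>j k. B (I j v) (I k w))"
    by (simp only: C(1)[OF i] bilinear_sum2[OF B])
  moreover have "?S (\<lambda>j k. B (I j v) (I k w)) = ?S (\<lambda>j k. B (I k v) (I j w))"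
    by (subst sum.swap) (simp only: mult.commute[of "C i _" "C i _"])
  ultimately have "2 * B (I' i v) (I' i w) = ?S (\<lambda>j k. B (I j v) (I k w) + B (I k v) (I j w))"
    by (simp only: distrib_left sum.distrib)
  also have "\<dots> = ?S (\<lambda>j k. if j = k then 2 * B v w else 0)"
    by (intro sum.cong refl) (simp only: sym)
  also have "\<dots> = (\<Sum>j=1..3. C i j * C i j) * (2 * B v w)"
    by (simp add: if_distrib sum_distrib_right cong: if_cong)
  also have "\<dots> = 2 * B v w" using C(2)[OF i i] by simp
  finally show ?thesis by simp
qed

lemma S2H_change:
  assumes I: "admissible_triple G Q I" and G: "onb_space G E" 
  shows "B \<in> S2H G Q \<longleftrightarrow> (\<exists>a :: nat \<Rightarrow> real. \<forall>v w. B v w = (\<Sum>i=1..3. a i * G (I i v) w))"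
proof
  assume "B \<in> S2H G Q"
  then obtain I' and a :: "nat \<Rightarrow> real" where I': "admissible_triple G Q I'"
    and a: "\<And>v w. B v w = (\<Sum>i=1..3. a i * G (I' i v) w)"
    unfolding S2H_def by blast
  interpret onb_space G E by (rule G)
  obtain C where "triple_change I I' C" using admissible_change[OF I I' G] ..
  note C = triple_changeD[OF this]
  have "B v w = (\<Sum>j=1..3. (\<Sum>i=1..3. a i * C i j) * G (I j v) w)" for v w
  proof -
    have "B v w = (\<Sum>i=1..3. \<Sum>j=1..3. a i * (C i j * G (I j v) w))"
      unfolding a by (intro sum.cong refl) (simp only: C(1) G_sum G_simps sum_distrib_left)
    then show ?thesis by (subst (asm) sum.swap) (simp only: sum_distrib_right mult.assoc)
  qed
  then show "\<exists>a :: nat \<Rightarrow> real. \<forall>v w. B v w = (\<Sum>i=1..3. a i * G (I i v) w)"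
    by (intro exI[of _ "\<lambda>j. \<Sum>i=1..3. a i * C i j"]) blast
qed (use I S2H_def in blast)

section \<open>Local orthonormal frames\<close>

context levi_civita_manifold
begin

text \<open>The process runs on coordinate fields of the chart of \<open>p\<close>. The condition on
  \<open>span S\<close> concerns only \<open>p\<close>, where these fields are the basis vectors
  themselves; it guarantees that the next vector is non-zero there before it is normalised.\<close>

lemma gram_schmidt:
  assumes "finite S" "S \<subseteq> Basis"
  shows "\<exists>F. (\<forall>b\<in>S. smooth_vf_at p (F b)) \<and> (\<forall>b\<in>S. F b p \<in> span S) \<and>
    eventually (\<lambda>q. \<forall>a\<in>S. \<forall>b\<in>S. g q (F a q) (F b q) = (if a = b then 1 else 0)) (nhds p)"
  using assms
proof induction
  case empty
  then show ?case by simp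
next
  case (insert b S)
  then obtain F where F: "\<And>a. a \<in> S \<Longrightarrow> smooth_vf_at p (F a)" "\<And>a. a \<in> S \<Longrightarrow> F a p \<in> span S"
    and on: "eventually (\<lambda>q. \<forall>a\<in>S. \<forall>b\<in>S. g q (F a q) (F b q) = (if a = b then 1 else 0)) (nhds p)"
    by auto
  let ?c = "cfield \<kappa> p b"
  define Y where "Y q = ?c q - (\<Sum>a\<in>S. g q (?c q) (F a q) *\<^sub>R F a q)" for q
  define h where "h q = g q (Y q) (Y q)" for q
  define Z where "Z q = (h q powr (-1/2)) *\<^sub>R Y q" for q
  have c: "smooth_vf_at p ?c" by (simp add: smooth_vf_at_cfield)
  have Y: "smooth_vf_at p Y"
    unfolding Y_def[abs_def] by (intro smooth_vf_at_diff c smooth_vf_at_sum smooth_vf_at_scaleR smooth_g F(1))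
  have h: "smooth_fun_at p h"
    unfolding h_def[abs_def] by (intro smooth_g Y)
  have sum_span: "(\<Sum>a\<in>S. g p b (F a p) *\<^sub>R F a p) \<in> span S"
    by (intro span_sum span_scale F(2))
  have "Y p \<noteq> 0"
  proof
    assume "Y p = 0"
    then have "b \<in> span S" using sum_span unfolding Y_def by (simp add: cfield_self)
    moreover have "b \<notin> span S"
      using independent_mono[OF independent_Basis insert.prems] insert.hyps(2)
      by (simp add: independent_insert)
    ultimately show False by simp
  qed
  then have hp: "h p > 0" unfolding h_def by (rule g_pos)
  have Z: "smooth_vf_at p Z"
    unfolding Z_def[abs_def] by (intro smooth_vf_at_scaleR smooth_fun_at_powr h hp Y)
  let ?F = "F(b := Z)"
  have "\<forall>a\<in>insert b S. smooth_vf_at p (?F a)" using F(1) Z by simp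
  moreover have "\<forall>a\<in>insert b S. ?F a p \<in> span (insert b S)"
  proof -
    have "Y p \<in> span (insert b S)"
      unfolding Y_def cfield_self
      by (intro span_diff span_base subsetD[OF span_mono sum_span]) auto
    then show ?thesis
      using F(2) span_mono[of S "insert b S"] unfolding Z_def by (auto intro: span_scale)
  qed
  moreover have "eventually (\<lambda>q. \<forall>a\<in>insert b S. \<forall>c\<in>insert b S.
      g q (?F a q) (?F c q) = (if a = c then 1 else 0)) (nhds p)"
    using on eventually_smooth_fun_at_gt[OF h hp]
  proof eventually_elim
    case (elim q)
    have bl: "linear (g q v)" "linear (\<lambda>v. g q v w)" for v w
      using g_bilinear unfolding bilinear_def by auto
    have orth: "g q (Y q) (F a q) = 0" if "a \<in> S" for a
    proof -
      have "g q (Y q) (F a q) = g q (?c q) (F a q) - (\<Sum>d\<in>S. g q (?c q) (F d q) * (if d = a then 1 else 0))"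
        unfolding Y_def using that elim(1)
        by (simp add: linear_diff[OF bl(2)] linear_sum[OF bl(2)] linear_cmul[OF bl(2)])
      also have "\<dots> = 0" using that insert.hyps(1) by (simp add: if_distrib cong: if_cong)
      finally show ?thesis .
    qed
    have "g q (Z q) (Z q) = (h q powr (-1/2)) * (h q powr (-1/2)) * h q"
      unfolding Z_def h_def[of q] by (simp add: linear_cmul[OF bl(1)] linear_cmul[OF bl(2)])
    also have "\<dots> = h q powr (-1) * h q"
      by (simp add: powr_add[symmetric])
    also have "\<dots> = 1" using elim(2) by (simp add: powr_minus)
    finally have "g q (Z q) (Z q) = 1" .
    moreover have "g q (Z q) (F a q) = 0" "g q (F a q) (Z q) = 0" if "a \<in> S" for a
      using orth[OF that] g_sym[of q "F a q"] unfolding Z_def by (simp_all add: linear_cmul[OF bl(2)])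
    ultimately show ?case using elim(1) insert.hyps(2) by auto
  qed
  ultimately show ?case by blast
qed

definition orthonormal_frame_at :: "'a \<Rightarrow> ('v \<Rightarrow> ('a, 'v) vfield) \<Rightarrow> bool" where
  "orthonormal_frame_at p F \<longleftrightarrow> (\<forall>b\<in>Basis. smooth_vf_at p (F b)) \<and>
    eventually (\<lambda>q. \<forall>a\<in>Basis. \<forall>b\<in>Basis. g q (F a q) (F b q) = (if a = b then 1 else 0)) (nhds p)"

lemma orthonormal_frame_exists: "\<exists>F. orthonormal_frame_at p F"
  using gram_schmidt[OF finite_Basis subset_refl, of p] unfolding orthonormal_frame_at_def by blast

lemma orthonormal_frame_smooth: "orthonormal_frame_at p F \<Longrightarrow> b \<in> Basis \<Longrightarrow> smooth_vf_at p (F b)"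
  unfolding orthonormal_frame_at_def by blast

lemma orthonormal_frame_image:
  fixes F :: "'v \<Rightarrow> ('a, 'v) vfield"
  assumes "\<forall>a\<in>Basis. \<forall>b\<in>Basis. g q (F a q) (F b q) = (if a = b then 1 else 0)"
  shows "orthonormal_basis (g q) ((\<lambda>b. F b q) ` Basis)" "inj_on (\<lambda>b. F b q) Basis"
proof -
  show inj: "inj_on (\<lambda>b. F b q) Basis"
    using assms by (intro inj_onI) (metis zero_neq_one)
  show "orthonormal_basis (g q) ((\<lambda>b. F b q) ` Basis)"
    unfolding orthonormal_basis_def using assms inj_onD[OF inj] by (auto simp: card_image[OF inj])
qed

lemma onb_space_onb: "onb_space (g p) (onb (g p))"
proof -
  obtain F where "orthonormal_frame_at p F" using orthonormal_frame_exists by blast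
  then have "\<forall>a\<in>Basis. \<forall>b\<in>Basis. g p (F a p) (F b p) = (if a = b then 1 else 0)"
    unfolding orthonormal_frame_at_def using eventually_nhds_x_imp_x by blast
  then have "\<exists>E. orthonormal_basis (g p) E"
    using orthonormal_frame_image(1) by blast
  then have "orthonormal_basis (g p) (onb (g p))"
    unfolding onb_def by (rule someI_ex)
  then show ?thesis
    using g_bilinear g_sym g_pos by (intro onb_space.intro)
qed

text \<open>\<open>onb (g q)\<close> is selected separately at every \<open>q\<close>. Since traces
  do not depend on the orthonormal basis, a smooth frame may replace it, on one neighbourhood for
  all \<open>B\<close>.\<close>

lemma trace_frame:
  assumes "orthonormal_frame_at p F"
  shows "eventually (\<lambda>q. \<forall>B :: 'v \<Rightarrow> 'v \<Rightarrow> real. bilinear B \<longrightarrow>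
    (\<Sum>e\<in>onb (g q). B e e) = (\<Sum>b\<in>Basis. B (F b q) (F b q))) (nhds p)"
  using assms[unfolded orthonormal_frame_at_def, THEN conjunct2]
proof eventually_elim
  case (elim q)
  interpret onb_space "g q" "onb (g q)" by (rule onb_space_onb)
  show ?case
  proof (intro allI impI)
    fix B :: "'v \<Rightarrow> 'v \<Rightarrow> real" assume "bilinear B"
    from trace_onb[OF orthonormal_frame_image(1)[where F = F, OF elim] this]
    show "(\<Sum>e\<in>onb (g q). B e e) = (\<Sum>b\<in>Basis. B (F b q) (F b q))"
      by (simp add: sum.reindex[OF orthonormal_frame_image(2)[where F = F, OF elim]])
  qed
qed

text \<open>
  The derivative of an orthonormal frame is given by a skew matrix, so the derivatives of the
  frame do not contribute to the derivative of a trace.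
\<close>

lemma trace_D_frame:
  assumes F: "orthonormal_frame_at p F" and B: "bilinear (B :: 'v \<Rightarrow> 'v \<Rightarrow> real)"
  shows "(\<Sum>b\<in>Basis. B (D (F b) p v) (F b p) + B (F b p) (D (F b) p v)) = 0"
proof -
  interpret onb_space "g p" "onb (g p)" by (rule onb_space_onb)
  have on: "\<forall>a\<in>Basis. \<forall>b\<in>Basis. g p (F a p) (F b p) = (if a = b then 1 else 0)"
    using F unfolding orthonormal_frame_at_def using eventually_nhds_x_imp_x by blast
  interpret F: onb_space "g p" "(\<lambda>b. F b p) ` Basis"
    using orthonormal_frame_image(1)[where F = F, OF on] bilinear_G G_sym G_pos by (intro onb_space.intro)
  note inj = orthonormal_frame_image(2)[where F = F, OF on]
  define m where "m a b = g p (D (F a) p v) (F b p)" for a b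
  have skew: "m a b = - m b a" if ab: "a \<in> Basis" "b \<in> Basis" for a b
  proof -
    have "eventually (\<lambda>q. (if a = b then 1 else 0) = g q (F a q) (F b q)) (nhds p)"
      using F[unfolded orthonormal_frame_at_def, THEN conjunct2] by eventually_elim (use ab in auto)
    from ddir_cong[OF smooth_fun_at_const this]
    have "ddir \<kappa> (\<lambda>q. g q (F a q) (F b q)) p v = 0" by (simp add: ddir_const)
    then show ?thesis
      using D_metric[OF orthonormal_frame_smooth[OF F ab(1)] orthonormal_frame_smooth[OF F ab(2)], of v]
        g_sym[of p "F a p" "D (F b) p v"]
      unfolding m_def by simp
  qed
  have l: "linear (\<lambda>x. B x y)" "linear (B x)" for x y using B unfolding bilinear_def by auto
  have ex: "D (F a) p v = (\<Sum>b\<in>Basis. m a b *\<^sub>R F b p)" for a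
    unfolding m_def by (subst F.expansion) (simp add: sum.reindex[OF inj])
  have 1: "(\<Sum>b\<in>Basis. B (D (F b) p v) (F b p)) = (\<Sum>a\<in>Basis. \<Sum>b\<in>Basis. m a b * B (F b p) (F a p))"
    by (simp add: ex linear_sum[OF l(1)] linear_cmul[OF l(1)])
  have "(\<Sum>b\<in>Basis. B (F b p) (D (F b) p v)) = (\<Sum>b\<in>Basis. \<Sum>a\<in>Basis. m b a * B (F b p) (F a p))"
    by (simp add: ex linear_sum[OF l(2)] linear_cmul[OF l(2)])
  also have "\<dots> = (\<Sum>a\<in>Basis. \<Sum>b\<in>Basis. - (m a b * B (F b p) (F a p)))"
  proof (subst sum.swap, intro sum.cong refl)
    fix a b :: 'v assume "a \<in> Basis" "b \<in> Basis"
    from skew[OF this] show "m b a * B (F b p) (F a p) = - (m a b * B (F b p) (F a p))" by simp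
  qed
  finally show ?thesis
    unfolding sum.distrib 1 by (simp add: sum_negf)
qed

section \<open>Codifferential and exterior derivative in terms of the connection\<close>

lemma linear_covd2_args_on:
  assumes B: "smooth_tensor2 \<kappa> U B" "open U" "p \<in> U"
  shows "linear (\<lambda>w. covd2 \<kappa> D B p v w z)" "linear (\<lambda>z. covd2 \<kappa> D B p v w z)"
proof -
  have c: "smooth_vf_at p (cfield \<kappa> p w)" for w by (simp add: smooth_vf_at_cfield)
  note sB = smooth_tensor2_at[OF B]
  note ddir_B = ddir_tensor2_linear[OF B]
  have bl: "bilinear (B p)" using B unfolding smooth_tensor2_def by auto
  note bl = bilinear_ladd[OF bl] bilinear_radd[OF bl] bilinear_lmul[OF bl] bilinear_rmul[OF bl]
  show "linear (\<lambda>w. covd2 \<kappa> D B p v w z)"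
  proof (rule linearI)
    show "covd2 \<kappa> D B p v (w + w') z = covd2 \<kappa> D B p v w z + covd2 \<kappa> D B p v w' z" for w w'
      using covd2_field_on[OF B smooth_vf_at_add[OF c[of w] c[of w']] c[of z], of v]
        covd2_field_on[OF B c[of w] c[of z], of v] covd2_field_on[OF B c[of w'] c[of z], of v]
      by (simp add: cfield_self bl ddir_B ddir_add sB c D_add)
    show "covd2 \<kappa> D B p v (r *\<^sub>R w) z = r *\<^sub>R covd2 \<kappa> D B p v w z" for r w
      using covd2_field_on[OF B smooth_vf_at_scaleR[OF smooth_fun_at_const[of p r] c[of w]] c[of z], of v]
        covd2_field_on[OF B c[of w] c[of z], of v]
      by (simp add: cfield_self bl ddir_B smooth_fun_at_const ddir_cmult sB c D_cmult algebra_simps)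
  qed
  show "linear (\<lambda>z. covd2 \<kappa> D B p v w z)"
  proof (rule linearI)
    show "covd2 \<kappa> D B p v w (z + z') = covd2 \<kappa> D B p v w z + covd2 \<kappa> D B p v w z'" for z z'
      using covd2_field_on[OF B c[of w] smooth_vf_at_add[OF c[of z] c[of z']], of v]
        covd2_field_on[OF B c[of w] c[of z], of v] covd2_field_on[OF B c[of w] c[of z'], of v]
      by (simp add: cfield_self bl ddir_B ddir_add sB c D_add)
    show "covd2 \<kappa> D B p v w (r *\<^sub>R z) = r *\<^sub>R covd2 \<kappa> D B p v w z" for r z
      using covd2_field_on[OF B c[of w] smooth_vf_at_scaleR[OF smooth_fun_at_const[of p r] c[of z]], of v]
        covd2_field_on[OF B c[of w] c[of z], of v]
      by (simp add: cfield_self bl ddir_B smooth_fun_at_const ddir_cmult sB c D_cmult algebra_simps)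
  qed
qed

lemmas linear_covd2_args = linear_covd2_args_on[OF _ open_UNIV UNIV_I]

lemma codiff_G:
  assumes B: "smooth_tensor2 \<kappa> UNIV B"
  shows "g p (codiff \<kappa> g D B p) w = - (\<Sum>e\<in>onb (g p). covd2 \<kappa> D B p e e w)"
proof -
  interpret onb_space "g p" "onb (g p)" by (rule onb_space_onb)
  have "linear (\<lambda>w. - (\<Sum>e\<in>onb (g p). covd2 \<kappa> D B p e e w))"
    by (intro linear_compose_neg linear_compose_sum ballI linear_covd2_args[OF B])
  from sharp_G[OF this] show ?thesis unfolding codiff_def .
qed

lemma smooth_codiff:
  assumes B: "smooth_tensor2 \<kappa> UNIV B"
  shows "smooth_vf_at p (codiff \<kappa> g D B)"
proof -
  obtain F where F: "orthonormal_frame_at p F" using orthonormal_frame_exists by blast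
  let ?X = "\<lambda>q. \<Sum>b\<in>Basis. (- (\<Sum>a\<in>Basis. covd2 \<kappa> D B q (F a q) (F a q) (F b q))) *\<^sub>R F b q"
  show ?thesis
  proof (rule smooth_vf_at_cong)
    show "smooth_vf_at p ?X"
      by (intro smooth_vf_at_sum smooth_vf_at_scaleR smooth_fun_at_minus smooth_fun_at_sum
          smooth_covd2[OF B] orthonormal_frame_smooth[OF F])
    show "eventually (\<lambda>q. ?X q = codiff \<kappa> g D B q) (nhds p)"
      using trace_frame[OF F] F[unfolded orthonormal_frame_at_def, THEN conjunct2]
    proof eventually_elim
      case (elim q)
      interpret onb_space "g q" "onb (g q)" by (rule onb_space_onb)
      note on = orthonormal_frame_image[where F = F, OF elim(2)]
      interpret F: onb_space "g q" "(\<lambda>b. F b q) ` Basis"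
        using on(1) bilinear_G G_sym G_pos by (intro onb_space.intro)
      have "bilinear (\<lambda>x y. covd2 \<kappa> D B q x y w)" for w
        unfolding bilinear_def using linear_covd2[OF B] linear_covd2_args[OF B] by blast
      from elim(1)[rule_format, OF this] have "g q (codiff \<kappa> g D B q) w = - (\<Sum>a\<in>Basis. covd2 \<kappa> D B q (F a q) (F a q) w)" for w
        unfolding codiff_G[OF B] by simp
      then show ?case
        by (subst F.expansion) (simp add: sum.reindex[OF on(2)])
    qed
  qed
qed

lemma covd2_skew:
  assumes "two_form \<kappa> \<psi>"
  shows "covd2 \<kappa> D \<psi> p v w z = - covd2 \<kappa> D \<psi> p v z w"
proof -
  have B: "smooth_tensor2 \<kappa> UNIV \<psi>" and sk: "\<psi> q x y = - \<psi> q y x" for q x y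
    using assms unfolding two_form_def by blast+
  have c: "smooth_vf_at p (cfield \<kappa> p w)" for w by (simp add: smooth_vf_at_cfield)
  have "ddir \<kappa> (\<lambda>q. \<psi> q (cfield \<kappa> p w q) (cfield \<kappa> p z q)) p v =
      - ddir \<kappa> (\<lambda>q. \<psi> q (cfield \<kappa> p z q) (cfield \<kappa> p w q)) p v"
    by (subst sk) (rule ddir_minus[OF smooth_tensor2_at[OF B open_UNIV UNIV_I c c]])
  then show ?thesis
    unfolding covd2_def using sk[of p "D (cfield \<kappa> p w) p v" z] sk[of p w "D (cfield \<kappa> p z) p v"] by simp
qed

text \<open>The connection terms cancel in pairs: they are symmetric for coordinate fields, while
  the form is skew.\<close>

lemma ext_deriv_covd2:
  assumes "two_form \<kappa> \<psi>"
  shows "ext_deriv \<kappa> \<psi> p x y z =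
    covd2 \<kappa> D \<psi> p x y z + covd2 \<kappa> D \<psi> p y z x + covd2 \<kappa> D \<psi> p z x y"
proof -
  have sk: "\<psi> q x y = - \<psi> q y x" for q x y
    using assms unfolding two_form_def by blast
  have comm: "D (cfield \<kappa> p a) p b = D (cfield \<kappa> p b) p a" for a b
    using cfield_commute[OF centre_in_cdom, of p a b] by (simp add: cfield_self)
  show ?thesis
    unfolding ext_deriv_def covd2_def comm[of z x] comm[of y x] comm[of z y]
    using sk[of p "D (cfield \<kappa> p x) p z"] sk[of p "D (cfield \<kappa> p x) p y"] sk[of p "D (cfield \<kappa> p y) p z"] by simp
qed

end

section \<open>The invariant tensor of a quaternionic-Kaehler manifold\<close>

lemma (in quat_space) linear_M:
  "linear (\<lambda>a. M a b c d)" "linear (\<lambda>b. M a b c d)" "linear (\<lambda>c. M a b c d)" "linear (\<lambda>d. M a b c d)"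
  by (rule linearI; simp add: M_def algebra_simps)+

locale qk_manifold = levi_civita_manifold \<kappa> g D
  for \<kappa> :: "('a::t2_space, 'v::euclidean_space) atlas" and g D +
  fixes Q :: "'a \<Rightarrow> ('v \<Rightarrow> 'v) set"
  assumes admissible: "\<exists>U J. p \<in> U \<and> admissible_basis \<kappa> g Q U J"
    and parallel: "parallel_subbundle \<kappa> D Q"
    and dim_ge: "DIM('v) \<ge> 8"
begin

definition triple :: "'a \<Rightarrow> nat \<Rightarrow> 'v \<Rightarrow> 'v" where
  "triple p = some_triple (g p) (Q p)"

lemma admissible_triple: "admissible_triple (g p) (Q p) (triple p)"
proof -
  obtain U J where "p \<in> U" "admissible_basis \<kappa> g Q U J" using admissible by blast
  then have "admissible_triple (g p) (Q p) (\<lambda>i. J i p)"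
    unfolding admissible_basis_def by simp
  then show ?thesis
    unfolding triple_def some_triple_def by (rule someI[where P = "admissible_triple (g p) (Q p)"])
qed

lemma quat: "quat_space (g p) (onb (g p)) (triple p 1) (triple p 2) (triple p 3)"
  by (rule onb_space.quat_space_admissible[OF onb_space_onb admissible_triple])

definition M4 :: "'a \<Rightarrow> 'v \<Rightarrow> 'v \<Rightarrow> 'v \<Rightarrow> 'v \<Rightarrow> real" where
  "M4 p = quat_space.M (g p) (triple p 1) (triple p 2) (triple p 3)"

definition Phi4 :: "'a \<Rightarrow> 'v \<Rightarrow> 'v \<Rightarrow> 'v \<Rightarrow> 'v \<Rightarrow> real" where
  "Phi4 p = quat_space.Phi (g p) (triple p 1) (triple p 2) (triple p 3)"

lemma Phi4_eq:
  "Phi4 p x y z w = g p x z * g p y w - g p x w * g p y z + M4 p x z y w - M4 p x w y z"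
  unfolding Phi4_def M4_def by (rule quat_space.Phi_def[OF quat])

lemma M4_admissible:
  assumes "admissible_triple (g p) (Q p) I"
  shows "M4 p a b c d = (\<Sum>i=1..3. g p (I i a) b * g p (I i c) d)"
proof -
  have "M4 p a b c d = (\<Sum>i=1..3. g p (triple p i a) b * g p (triple p i c) d)"
    unfolding M4_def quat_space.M_def[OF quat] sum_1_3 by simp
  then show ?thesis using M_change[OF admissible_triple assms onb_space_onb] by simp
qed

lemma linear_M4:
  "linear (\<lambda>a. M4 p a b c d)" "linear (\<lambda>b. M4 p a b c d)"
  "linear (\<lambda>c. M4 p a b c d)" "linear (\<lambda>d. M4 p a b c d)"
  unfolding M4_def by (rule quat_space.linear_M[OF quat])+

text \<open>\<open>Q\<close> is parallel, so the derivative of each \<open>J i\<close> stays in the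
  span of the basis. Differentiating the Clifford relations, whose right side is constant, makes the
  coefficient matrix skew.\<close>

lemma covd_endo_coefficients:
  assumes J: "admissible_basis \<kappa> g Q U J" and p: "p \<in> U"
  obtains a :: "nat \<Rightarrow> nat \<Rightarrow> real" where
    "\<And>i w. i \<in> {1..3} \<Longrightarrow> covd_endo \<kappa> D (J i) p v w = (\<Sum>j=1..3. a i j *\<^sub>R J j p w)"
    "\<And>i j. i \<in> {1..3} \<Longrightarrow> j \<in> {1..3} \<Longrightarrow> a i j = - a j i"
proof -
  have U: "open U" and sm: "smooth_endofield \<kappa> U (J i)" if "i \<in> {1..3}" for i
    using J that unfolding admissible_basis_def by auto
  have U: "open U" using J unfolding admissible_basis_def by auto
  have trip: "admissible_triple (g q) (Q q) (\<lambda>i. J i q)" if "q \<in> U" for q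
    using J that unfolding admissible_basis_def by auto
  note tp = trip[OF p]
  interpret onb_space "g p" "onb (g p)" by (rule onb_space_onb)
  obtain z where z: "g p z z = 1" using E_nonempty by blast
  have lin: "linear (J i q)" if "i \<in> {1..3}" "q \<in> U" for i q
    using admissibleD(1)[OF trip[OF that(2)] that(1)] .
  define a where "a i j = g p (covd_endo \<kappa> D (J i) p v z) (J j p z)" for i j
  have a: "covd_endo \<kappa> D (J i) p v w = (\<Sum>j=1..3. a i j *\<^sub>R J j p w)" if i: "i \<in> {1..3}" for i w
  proof -
    have "\<forall>q\<in>U. J i q \<in> Q q"
      using admissible_mem[OF trip i] by simp
    then have "covd_endo \<kappa> D (J i) p v \<in> Q p"
      using parallel[unfolded parallel_subbundle_def, THEN spec, THEN spec, THEN mp,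
          OF conjI[OF U conjI[OF sm[OF i]]], THEN bspec, OF _ p] by simp
    from admissible_expand[OF tp onb_space_onb this z]
    show ?thesis unfolding a_def .
  qed
  have "a i j = - a j i" if i: "i \<in> {1..3}" and j: "j \<in> {1..3}" for i j
  proof -
    let ?W = "cfield \<kappa> p z"
    let ?r = "if i = j then - 2 else (0::real)"
    have W: "smooth_vf_at p ?W" by (simp add: smooth_vf_at_cfield)
    have sJ: "smooth_vf_at p (\<lambda>q. J k q (X q))" if "k \<in> {1..3}" "smooth_vf_at p X" for k X
      by (rule smooth_endofield_at[OF sm[OF that(1)] U p that(2)])
    have DJ: "D (\<lambda>q. J k q (X q)) p v = covd_endo \<kappa> D (J k) p v (X p) + J k p (D X p v)"
      if "k \<in> {1..3}" "smooth_vf_at p X" for k X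
      by (rule covd_endo_field[OF sm[OF that(1)] U p that(2)])
    have cliff: "J k q (J l q w) + J l q (J k q w) = (if k = l then - 2 else 0) *\<^sub>R w"
      if "k \<in> {1..3}" "l \<in> {1..3}" "q \<in> U" for k l q w
      using admissibleD(2)[OF trip[OF that(3)] that(1)] admissibleD(4)[OF trip[OF that(3)] that(1,2)]
      by (cases "k = l") (auto simp: scaleR_2)
    have "eventually (\<lambda>q. ?r *\<^sub>R ?W q = J i q (J j q (?W q)) + J j q (J i q (?W q))) (nhds p)"
      using eventually_nhds_in_open[OF U p] by eventually_elim (simp only: cliff[OF i j])
    from D_cong[OF smooth_vf_at_scaleR[OF smooth_fun_at_const W] this, of v]
    have "D (\<lambda>q. J i q (J j q (?W q)) + J j q (J i q (?W q))) p v = ?r *\<^sub>R D ?W p v"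
      using D_cmult[OF W, of ?r] by simp
    then have "covd_endo \<kappa> D (J i) p v (J j p z) + J i p (covd_endo \<kappa> D (J j) p v z)
        + (covd_endo \<kappa> D (J j) p v (J i p z) + J j p (covd_endo \<kappa> D (J i) p v z)) = 0"
      using cliff[OF i j p, of "D ?W p v"] i j
      by (simp add: D_add sJ W DJ cfield_self linear_add[OF lin[OF i p]] linear_add[OF lin[OF j p]] algebra_simps)
    then have "(\<Sum>k=1..3. a i k *\<^sub>R (J k p (J j p z) + J j p (J k p z)))
        + (\<Sum>k=1..3. a j k *\<^sub>R (J k p (J i p z) + J i p (J k p z))) = 0"
      by (simp add: a[OF i] a[OF j] linear_sum[OF lin[OF i p]] linear_sum[OF lin[OF j p]]
          linear_cmul[OF lin[OF i p]] linear_cmul[OF lin[OF j p]] sum.distrib algebra_simps)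
    moreover have "(\<Sum>k=1..3. a i k *\<^sub>R (J k p (J l p z) + J l p (J k p z))) = (- 2 * a i l) *\<^sub>R z"
      if l: "l \<in> {1..3}" for i l
    proof -
      have "(\<Sum>k=1..3. a i k *\<^sub>R (J k p (J l p z) + J l p (J k p z))) =
          (\<Sum>k=1..3. (if k = l then - 2 * a i k else 0) *\<^sub>R z)"
        by (intro sum.cong refl) (simp add: cliff[OF _ l p])
      then show ?thesis using l by (simp add: if_distrib[of "\<lambda>a. a *\<^sub>R _"] cong: if_cong)
    qed
    ultimately have "(- 2 * a i j) *\<^sub>R z + (- 2 * a j i) *\<^sub>R z = 0" using i j by simp
    then have "(- 2 * a i j + - 2 * a j i) *\<^sub>R z = 0" by (simp only: scaleR_left_distrib)
    moreover have "z \<noteq> 0" using z by auto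
    ultimately show ?thesis by simp
  qed
  with a show thesis by (rule that)
qed

text \<open>Near \<open>p\<close>, \<open>M4\<close> may be computed from a smooth admissible basis.
  The derivatives of its members contribute the sum of
  \<open>a i j * (?x j * ?y i + ?x i * ?y j)\<close>, a skew matrix contracted with a symmetric
  one.\<close>

lemma M4_field:
  assumes A: "smooth_vf_at p A" and B: "smooth_vf_at p B" and C: "smooth_vf_at p C" and E: "smooth_vf_at p E"
  shows "smooth_fun_at p (\<lambda>q. M4 q (A q) (B q) (C q) (E q))"
    and "ddir \<kappa> (\<lambda>q. M4 q (A q) (B q) (C q) (E q)) p v = M4 p (D A p v) (B p) (C p) (E p) +
      M4 p (A p) (D B p v) (C p) (E p) + M4 p (A p) (B p) (D C p v) (E p) + M4 p (A p) (B p) (C p) (D E p v)"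
proof -
  obtain U J where p: "p \<in> U" and J: "admissible_basis \<kappa> g Q U J" using admissible by blast
  have sm: "smooth_endofield \<kappa> U (J i)" if "i \<in> {1..3}" for i
    using J that unfolding admissible_basis_def by auto
  have U: "open U" using J unfolding admissible_basis_def by auto
  have trip: "admissible_triple (g q) (Q q) (\<lambda>i. J i q)" if "q \<in> U" for q
    using J that unfolding admissible_basis_def by auto
  obtain a :: "nat \<Rightarrow> nat \<Rightarrow> real" where
    a: "\<And>i w. i \<in> {1..3} \<Longrightarrow> covd_endo \<kappa> D (J i) p v w = (\<Sum>j=1..3. a i j *\<^sub>R J j p w)"
    and skew: "\<And>i j. i \<in> {1..3} \<Longrightarrow> j \<in> {1..3} \<Longrightarrow> a i j = - a j i"
    by (rule covd_endo_coefficients[OF J p, of v]) blast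
  interpret onb_space "g p" "onb (g p)" by (rule onb_space_onb)
  have sJ: "smooth_vf_at p (\<lambda>q. J k q (X q))" if "k \<in> {1..3}" "smooth_vf_at p X" for k X
    by (rule smooth_endofield_at[OF sm[OF that(1)] U p that(2)])
  have DJ: "D (\<lambda>q. J k q (X q)) p v = (\<Sum>j=1..3. a k j *\<^sub>R J j p (X p)) + J k p (D X p v)"
    if "k \<in> {1..3}" "smooth_vf_at p X" for k X
    using covd_endo_field[OF sm[OF that(1)] U p that(2)] a[OF that(1)] by simp
  let ?f = "\<lambda>q. \<Sum>i=1..3. g q (J i q (A q)) (B q) * g q (J i q (C q)) (E q)"
  have ev: "eventually (\<lambda>q. ?f q = M4 q (A q) (B q) (C q) (E q)) (nhds p)"
    using eventually_nhds_in_open[OF U p] by eventually_elim (simp add: M4_admissible[OF trip])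
  have sf: "smooth_fun_at p (\<lambda>q. g q (J i q (X q)) (Y q))" if "i \<in> {1..3}" "smooth_vf_at p X" "smooth_vf_at p Y" for i X Y
    by (intro smooth_g sJ that)
  have sp: "smooth_fun_at p (\<lambda>q. g q (J i q (A q)) (B q) * g q (J i q (C q)) (E q))" if "i \<in> {1..3}" for i
    by (intro smooth_fun_at_mult sf that A B C E)
  have s: "smooth_fun_at p ?f"
    by (intro smooth_fun_at_sum sp)
  show "smooth_fun_at p (\<lambda>q. M4 q (A q) (B q) (C q) (E q))"
    by (rule smooth_fun_at_cong[OF s ev])
  have dg: "ddir \<kappa> (\<lambda>q. g q (J i q (X q)) (Y q)) p v =
      (\<Sum>j=1..3. a i j * g p (J j p (X p)) (Y p)) + g p (J i p (D X p v)) (Y p) + g p (J i p (X p)) (D Y p v)"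
    if "i \<in> {1..3}" "smooth_vf_at p X" "smooth_vf_at p Y" for i X Y
    using D_metric[OF sJ[OF that(1,2)] that(3), of v] DJ[OF that(1,2)] by (simp add: G_sum)
  let ?x = "\<lambda>i. g p (J i p (A p)) (B p)" and ?y = "\<lambda>i. g p (J i p (C p)) (E p)"
  have "ddir \<kappa> (\<lambda>q. M4 q (A q) (B q) (C q) (E q)) p v = ddir \<kappa> ?f p v"
    by (rule ddir_cong[OF s ev])
  also have "\<dots> = (\<Sum>i=1..3. ddir \<kappa> (\<lambda>q. g q (J i q (A q)) (B q) * g q (J i q (C q)) (E q)) p v)"
    by (rule ddir_sum[OF sp])
  also have "\<dots> = (\<Sum>i=1..3. (g p (J i p (D A p v)) (B p) + g p (J i p (A p)) (D B p v)) * ?y i +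
      ?x i * (g p (J i p (D C p v)) (E p) + g p (J i p (C p)) (D E p v)) +
      ((\<Sum>j=1..3. a i j * ?x j) * ?y i + ?x i * (\<Sum>j=1..3. a i j * ?y j)))"
    by (intro sum.cong refl) (simp add: ddir_mult sf A B C E dg algebra_simps)
  also have "\<dots> = M4 p (D A p v) (B p) (C p) (E p) +
      M4 p (A p) (D B p v) (C p) (E p) + M4 p (A p) (B p) (D C p v) (E p) + M4 p (A p) (B p) (C p) (D E p v)
      + (\<Sum>i=1..3. (\<Sum>j=1..3. a i j * ?x j) * ?y i + ?x i * (\<Sum>j=1..3. a i j * ?y j))"
    unfolding M4_admissible[OF trip[OF p]] by (simp add: sum.distrib[symmetric] algebra_simps)
  also have "(\<Sum>i=1..3. (\<Sum>j=1..3. a i j * ?x j) * ?y i + ?x i * (\<Sum>j=1..3. a i j * ?y j)) = 0"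
  proof -
    have "(\<Sum>i=1..3. ?x i * (\<Sum>j=1..3. a i j * ?y j)) = (\<Sum>i=1..3. \<Sum>j=1..3. a i j * ?x i * ?y j)"
      by (simp only: sum_distrib_left mult.assoc mult.left_commute)
    also have "\<dots> = (\<Sum>j=1..3. \<Sum>i=1..3. a i j * ?x i * ?y j)" by (rule sum.swap)
    also have "\<dots> = (\<Sum>j=1..3. \<Sum>i=1..3. - (a j i * ?x i * ?y j))"
    proof (intro sum.cong refl)
      fix i j :: nat assume "j \<in> {1..3}" "i \<in> {1..3}"
      from skew[OF this(2,1)] show "a i j * ?x i * ?y j = - (a j i * ?x i * ?y j)" by simp
    qed
    finally show ?thesis by (simp add: sum.distrib sum_distrib_right sum_negf)
  qed
  finally show "ddir \<kappa> (\<lambda>q. M4 q (A q) (B q) (C q) (E q)) p v = M4 p (D A p v) (B p) (C p) (E p) +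
      M4 p (A p) (D B p v) (C p) (E p) + M4 p (A p) (B p) (D C p v) (E p) + M4 p (A p) (B p) (C p) (D E p v)"
    by simp
qed

lemma Phi4_field:
  assumes s: "smooth_vf_at p A" "smooth_vf_at p B" "smooth_vf_at p C" "smooth_vf_at p E"
  shows "ddir \<kappa> (\<lambda>q. Phi4 q (A q) (B q) (C q) (E q)) p v = Phi4 p (D A p v) (B p) (C p) (E p) +
      Phi4 p (A p) (D B p v) (C p) (E p) + Phi4 p (A p) (B p) (D C p v) (E p) + Phi4 p (A p) (B p) (C p) (D E p v)"
    and "smooth_fun_at p (\<lambda>q. Phi4 q (A q) (B q) (C q) (E q))"
proof -
  show "smooth_fun_at p (\<lambda>q. Phi4 q (A q) (B q) (C q) (E q))"
    unfolding Phi4_eq by (intro smooth_fun_at_add smooth_fun_at_diff smooth_fun_at_mult smooth_g M4_field s)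
  show "ddir \<kappa> (\<lambda>q. Phi4 q (A q) (B q) (C q) (E q)) p v = Phi4 p (D A p v) (B p) (C p) (E p) +
      Phi4 p (A p) (D B p v) (C p) (E p) + Phi4 p (A p) (B p) (D C p v) (E p) + Phi4 p (A p) (B p) (C p) (D E p v)"
    unfolding Phi4_eq
    by (simp add: ddir_add ddir_diff ddir_mult smooth_fun_at_add smooth_fun_at_diff smooth_fun_at_mult
        smooth_g M4_field s D_metric algebra_simps)
qed

text \<open>The Leibniz rule for \<open>M4\<close> is applied twice. Terms with one derivative on
  each of two arguments agree in both orders, and since coordinate derivatives commute, only the
  curvature terms are left.\<close>

lemma M4_curvature:
  "M4 p (curvature \<kappa> D p x y a) b c d + M4 p a (curvature \<kappa> D p x y b) c d +
    M4 p a b (curvature \<kappa> D p x y c) d + M4 p a b c (curvature \<kappa> D p x y d) = 0"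
proof -
  let ?c = "cfield \<kappa> p"
  have c: "smooth_vf_at p (?c w)" for w by (simp add: smooth_vf_at_cfield)
  have ev: "eventually (\<lambda>q. smooth_vf_at q (?c w)) (nhds p)" for w
    using eventually_smooth_vf_at[OF c] .
  have R: "curvature \<kappa> D p x y w = D (\<lambda>r. D (?c w) r (?c y r)) p x - D (\<lambda>r. D (?c w) r (?c x r)) p y" for w x y
    unfolding curvature_def ..
  let ?f = "\<lambda>q. M4 q (?c a q) (?c b q) (?c c q) (?c d q)"
  let ?D = "\<lambda>w y q. D (?c w) q (?c y q)"
  have 1: "ddir \<kappa> (\<lambda>q. ddir \<kappa> ?f q (?c y q)) p x =
      ddir \<kappa> (\<lambda>q. M4 q (?D a y q) (?c b q) (?c c q) (?c d q) + M4 q (?c a q) (?D b y q) (?c c q) (?c d q)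
        + M4 q (?c a q) (?c b q) (?D c y q) (?c d q) + M4 q (?c a q) (?c b q) (?c c q) (?D d y q)) p x" for x y
  proof (rule ddir_cong)
    show "smooth_fun_at p (\<lambda>q. M4 q (?D a y q) (?c b q) (?c c q) (?c d q) + M4 q (?c a q) (?D b y q) (?c c q) (?c d q)
        + M4 q (?c a q) (?c b q) (?D c y q) (?c d q) + M4 q (?c a q) (?c b q) (?c c q) (?D d y q))"
      by (intro smooth_fun_at_add M4_field smooth_D c)
    show "eventually (\<lambda>q. M4 q (?D a y q) (?c b q) (?c c q) (?c d q) + M4 q (?c a q) (?D b y q) (?c c q) (?c d q)
        + M4 q (?c a q) (?c b q) (?D c y q) (?c d q) + M4 q (?c a q) (?c b q) (?c c q) (?D d y q) =
        ddir \<kappa> ?f q (?c y q)) (nhds p)"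
      using ev[of a] ev[of b] ev[of c] ev[of d] by eventually_elim (simp add: M4_field)
  qed
  show ?thesis
    using ddir_cfield_commute[OF M4_field(1)[OF c c c c], of a b c d y x]
    unfolding 1[of x y] 1[of y x] R[of x y]
    by (simp add: ddir_add smooth_fun_at_add M4_field smooth_D c cfield_self
        linear_diff[OF linear_M4(1)] linear_diff[OF linear_M4(2)] linear_diff[OF linear_M4(3)] linear_diff[OF linear_M4(4)])
qed

lemma quat_curv: "quat_curvature (g p) (onb (g p)) (triple p 1) (triple p 2) (triple p 3) (curvature \<kappa> D p)"
proof (intro quat_curvature.intro quat_curvature_axioms.intro quat linear_curvature1 linear_curvature2
    linear_curvature3 curvature_swap curvature_skew curvature_bianchi dim_ge)
  show "quat_space.M (g p) (triple p 1) (triple p 2) (triple p 3) (curvature \<kappa> D p x y a) b c d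
    + quat_space.M (g p) (triple p 1) (triple p 2) (triple p 3) a (curvature \<kappa> D p x y b) c d
    + quat_space.M (g p) (triple p 1) (triple p 2) (triple p 3) a b (curvature \<kappa> D p x y c) d
    + quat_space.M (g p) (triple p 1) (triple p 2) (triple p 3) a b c (curvature \<kappa> D p x y d) = 0" for x y a b c d
    using M4_curvature[of p x y a b c d] unfolding M4_def .
qed

section \<open>Traces against parallel tensors\<close>

text \<open>Linearity is required only in the two arguments that will be contracted; for the other
  two the Leibniz rule is enough.\<close>

definition parallel4 :: "('a \<Rightarrow> 'v \<Rightarrow> 'v \<Rightarrow> 'v \<Rightarrow> 'v \<Rightarrow> real) \<Rightarrow> bool" where
  "parallel4 T \<longleftrightarrow>
    (\<forall>p a b c d. linear (\<lambda>a. T p a b c d) \<and> linear (\<lambda>b. T p a b c d)) \<and>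
    (\<forall>p A B C E. smooth_vf_at p A \<and> smooth_vf_at p B \<and> smooth_vf_at p C \<and> smooth_vf_at p E \<longrightarrow>
      smooth_fun_at p (\<lambda>q. T q (A q) (B q) (C q) (E q)) \<and>
      (\<forall>v. ddir \<kappa> (\<lambda>q. T q (A q) (B q) (C q) (E q)) p v = T p (D A p v) (B p) (C p) (E p) +
        T p (A p) (D B p v) (C p) (E p) + T p (A p) (B p) (D C p v) (E p) + T p (A p) (B p) (C p) (D E p v)))"

lemma parallel4D:
  assumes "parallel4 T"
  shows "linear (\<lambda>a. T p a b c d)" "linear (\<lambda>b. T p a b c d)"
    "smooth_vf_at p A \<Longrightarrow> smooth_vf_at p B \<Longrightarrow> smooth_vf_at p C \<Longrightarrow> smooth_vf_at p E \<Longrightarrow>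
      smooth_fun_at p (\<lambda>q. T q (A q) (B q) (C q) (E q))"
    "smooth_vf_at p A \<Longrightarrow> smooth_vf_at p B \<Longrightarrow> smooth_vf_at p C \<Longrightarrow> smooth_vf_at p E \<Longrightarrow>
      ddir \<kappa> (\<lambda>q. T q (A q) (B q) (C q) (E q)) p v = T p (D A p v) (B p) (C p) (E p) +
        T p (A p) (D B p v) (C p) (E p) + T p (A p) (B p) (D C p v) (E p) + T p (A p) (B p) (C p) (D E p v)"
  using assms unfolding parallel4_def by simp_all

lemma parallel4_M4: "parallel4 M4"
  unfolding parallel4_def using linear_M4 M4_field by simp

text \<open>In this order of arguments, contraction with \<open>B\<close> gives the sum of the
  \<open>B (Ji v) (Ji w)\<close> and hence the projection to S2E; the original order gives the
  projection to S2H.\<close>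

lemma parallel4_M4': "parallel4 (\<lambda>p a b c d. M4 p c a d b)"
  unfolding parallel4_def using linear_M4 M4_field by simp

lemma trace2_frame:
  assumes F: "orthonormal_frame_at p F"
  shows "eventually (\<lambda>q. \<forall>B T. bilinear (B :: 'v \<Rightarrow> 'v \<Rightarrow> real) \<longrightarrow> bilinear (T :: 'v \<Rightarrow> 'v \<Rightarrow> real) \<longrightarrow>
    (\<Sum>e\<in>onb (g q). \<Sum>f\<in>onb (g q). B e f * T e f) =
    (\<Sum>k\<in>Basis. \<Sum>l\<in>Basis. B (F k q) (F l q) * T (F k q) (F l q))) (nhds p)"
  using trace_frame[OF F]
proof eventually_elim
  case (elim q)
  show ?case
  proof (intro allI impI)
    fix B T :: "'v \<Rightarrow> 'v \<Rightarrow> real" assume "bilinear B" "bilinear T"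
    then have l: "linear (B x)" "linear (T x)" "linear (\<lambda>x. B x y)" "linear (\<lambda>x. T x y)" for x y
      unfolding bilinear_def by auto
    note ls = linear_add[OF l(1)] linear_add[OF l(2)] linear_add[OF l(3)] linear_add[OF l(4)]
      linear_cmul[OF l(1)] linear_cmul[OF l(2)] linear_cmul[OF l(3)] linear_cmul[OF l(4)]
    have "bilinear (\<lambda>x y. B e x * T e y)" for e
      by (auto simp: bilinear_def ls algebra_simps intro!: linearI)
    from elim[rule_format, OF this]
    have "(\<Sum>e\<in>onb (g q). \<Sum>f\<in>onb (g q). B e f * T e f) =
        (\<Sum>e\<in>onb (g q). \<Sum>l\<in>Basis. B e (F l q) * T e (F l q))" by simp
    also have "\<dots> = (\<Sum>l\<in>Basis. \<Sum>e\<in>onb (g q). B e (F l q) * T e (F l q))"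
      by (rule sum.swap)
    also have "\<dots> = (\<Sum>l\<in>Basis. \<Sum>k\<in>Basis. B (F k q) (F l q) * T (F k q) (F l q))"
    proof (rule sum.cong[OF refl])
      fix l
      have "bilinear (\<lambda>x y. B x (F l q) * T y (F l q))"
        by (auto simp: bilinear_def ls algebra_simps intro!: linearI)
      from elim[rule_format, OF this]
      show "(\<Sum>e\<in>onb (g q). B e (F l q) * T e (F l q)) = (\<Sum>k\<in>Basis. B (F k q) (F l q) * T (F k q) (F l q))" .
    qed
    also have "\<dots> = (\<Sum>k\<in>Basis. \<Sum>l\<in>Basis. B (F k q) (F l q) * T (F k q) (F l q))"
      by (rule sum.swap)
    finally show "(\<Sum>e\<in>onb (g q). \<Sum>f\<in>onb (g q). B e f * T e f) =
        (\<Sum>k\<in>Basis. \<Sum>l\<in>Basis. B (F k q) (F l q) * T (F k q) (F l q))" .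
  qed
qed

text \<open>The trace is differentiated in a smooth orthonormal frame. The parallel tensor
  contributes no term of its own, and the derivatives of the frame cancel by
  \<open>trace_D_frame\<close>, separately for each summation index. The domain \<open>U\<close> is
  general because the curvature forms below are used on a single chart.\<close>

lemma parallel_trace:
  assumes B: "smooth_tensor2 \<kappa> U B" "open U" "p \<in> U" and T: "parallel4 T"
    and V: "smooth_vf_at p V" and W: "smooth_vf_at p W"
  shows "smooth_fun_at p (\<lambda>q. \<Sum>e\<in>onb (g q). \<Sum>f\<in>onb (g q). B q e f * T q e f (V q) (W q))"
    and "ddir \<kappa> (\<lambda>q. \<Sum>e\<in>onb (g q). \<Sum>f\<in>onb (g q). B q e f * T q e f (V q) (W q)) p y =
      (\<Sum>e\<in>onb (g p). \<Sum>f\<in>onb (g p). covd2 \<kappa> D B p y e f * T p e f (V p) (W p)) +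
      (\<Sum>e\<in>onb (g p). \<Sum>f\<in>onb (g p). B p e f * T p e f (D V p y) (W p)) +
      (\<Sum>e\<in>onb (g p). \<Sum>f\<in>onb (g p). B p e f * T p e f (V p) (D W p y))"
proof -
  obtain F where F: "orthonormal_frame_at p F" using orthonormal_frame_exists by blast
  note sF = orthonormal_frame_smooth[OF F] and sB = smooth_tensor2_at[OF B]
  note pT = parallel4D[OF T]
  let ?h = "\<lambda>q. \<Sum>e\<in>onb (g q). \<Sum>f\<in>onb (g q). B q e f * T q e f (V q) (W q)"
  let ?f = "\<lambda>q. \<Sum>k\<in>Basis. \<Sum>l\<in>Basis. B q (F k q) (F l q) * T q (F k q) (F l q) (V q) (W q)"
  have bT: "bilinear (\<lambda>x y. T q x y v w)" for q v w
    unfolding bilinear_def using pT(1,2) by simp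
  have bB: "bilinear (B q)" if "q \<in> U" for q
    using B that unfolding smooth_tensor2_def by blast
  have ev: "eventually (\<lambda>q. ?f q = ?h q) (nhds p)"
    using trace2_frame[OF F] eventually_nhds_in_open[OF B(2,3)]
    by eventually_elim (simp add: bT bB)
  have at: "(\<Sum>e\<in>onb (g p). \<Sum>f\<in>onb (g p). A e f * T p e f v w) =
      (\<Sum>k\<in>Basis. \<Sum>l\<in>Basis. A (F k p) (F l p) * T p (F k p) (F l p) v w)" if "bilinear A" for A v w
    using eventually_nhds_x_imp_x[OF trace2_frame[OF F]] that bT by blast
  have s: "smooth_fun_at p ?f"
    by (intro smooth_fun_at_sum smooth_fun_at_mult sB pT(3) sF V W)
  show "smooth_fun_at p ?h" by (rule smooth_fun_at_cong[OF s ev])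
  let ?F = "\<lambda>k. F k p" and ?dF = "\<lambda>k. D (F k) p y" and ?v = "V p" and ?w = "W p"
  have "ddir \<kappa> ?h p y = ddir \<kappa> ?f p y" by (rule ddir_cong[OF s ev])
  also have "\<dots> = (\<Sum>k\<in>Basis. \<Sum>l\<in>Basis.
      ddir \<kappa> (\<lambda>q. B q (F k q) (F l q) * T q (F k q) (F l q) (V q) (W q)) p y)"
    by (simp add: ddir_sum smooth_fun_at_sum smooth_fun_at_mult sB pT(3) sF V W)
  also have "\<dots> = (\<Sum>k\<in>Basis. \<Sum>l\<in>Basis.
      (covd2 \<kappa> D B p y (?F k) (?F l) * T p (?F k) (?F l) ?v ?w
      + B p (?F k) (?F l) * T p (?F k) (?F l) (D V p y) ?w
      + B p (?F k) (?F l) * T p (?F k) (?F l) ?v (D W p y))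
      + (B p (?dF k) (?F l) * T p (?F k) (?F l) ?v ?w + B p (?F k) (?F l) * T p (?dF k) (?F l) ?v ?w)
      + (B p (?F k) (?dF l) * T p (?F k) (?F l) ?v ?w + B p (?F k) (?F l) * T p (?F k) (?dF l) ?v ?w))"
    by (intro sum.cong refl)
      (simp add: ddir_mult sB pT(3) sF V W covd2_field_on[OF B] pT(4) algebra_simps)
  also have "\<dots> = (\<Sum>k\<in>Basis. \<Sum>l\<in>Basis. covd2 \<kappa> D B p y (?F k) (?F l) * T p (?F k) (?F l) ?v ?w)
      + (\<Sum>k\<in>Basis. \<Sum>l\<in>Basis. B p (?F k) (?F l) * T p (?F k) (?F l) (D V p y) ?w)
      + (\<Sum>k\<in>Basis. \<Sum>l\<in>Basis. B p (?F k) (?F l) * T p (?F k) (?F l) ?v (D W p y))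
      + (\<Sum>k\<in>Basis. \<Sum>l\<in>Basis. B p (?dF k) (?F l) * T p (?F k) (?F l) ?v ?w + B p (?F k) (?F l) * T p (?dF k) (?F l) ?v ?w)
      + (\<Sum>k\<in>Basis. \<Sum>l\<in>Basis. B p (?F k) (?dF l) * T p (?F k) (?F l) ?v ?w + B p (?F k) (?F l) * T p (?F k) (?dF l) ?v ?w)"
    by (simp only: sum.distrib)
  also have "(\<Sum>k\<in>Basis. \<Sum>l\<in>Basis. B p (?dF k) (?F l) * T p (?F k) (?F l) ?v ?w + B p (?F k) (?F l) * T p (?dF k) (?F l) ?v ?w) = 0"
  proof (subst sum.swap, rule sum.neutral, rule ballI)
    fix l
    have "bilinear (\<lambda>x z. B p x (?F l) * T p z (?F l) ?v ?w)"
      using bB[OF B(3)] bT unfolding bilinear_def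
      by (auto simp: linear_iff algebra_simps)
    from trace_D_frame[OF F this]
    show "(\<Sum>k\<in>Basis. B p (?dF k) (?F l) * T p (?F k) (?F l) ?v ?w + B p (?F k) (?F l) * T p (?dF k) (?F l) ?v ?w) = 0"
      by simp
  qed
  also have "(\<Sum>k\<in>Basis. \<Sum>l\<in>Basis. B p (?F k) (?dF l) * T p (?F k) (?F l) ?v ?w + B p (?F k) (?F l) * T p (?F k) (?dF l) ?v ?w) = 0"
  proof (rule sum.neutral, rule ballI)
    fix k
    have "bilinear (\<lambda>x z. B p (?F k) x * T p (?F k) z ?v ?w)"
      using bB[OF B(3)] bT unfolding bilinear_def
      by (auto simp: linear_iff algebra_simps)
    from trace_D_frame[OF F this]
    show "(\<Sum>l\<in>Basis. B p (?F k) (?dF l) * T p (?F k) (?F l) ?v ?w + B p (?F k) (?F l) * T p (?F k) (?dF l) ?v ?w) = 0"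
      by simp
  qed
  finally have eq: "ddir \<kappa> ?h p y =
      (\<Sum>k\<in>Basis. \<Sum>l\<in>Basis. covd2 \<kappa> D B p y (?F k) (?F l) * T p (?F k) (?F l) ?v ?w)
      + (\<Sum>k\<in>Basis. \<Sum>l\<in>Basis. B p (?F k) (?F l) * T p (?F k) (?F l) (D V p y) ?w)
      + (\<Sum>k\<in>Basis. \<Sum>l\<in>Basis. B p (?F k) (?F l) * T p (?F k) (?F l) ?v (D W p y)) + 0 + 0" .
  have "bilinear (\<lambda>e f. covd2 \<kappa> D B p y e f)"
    unfolding bilinear_def using linear_covd2_args_on[OF B] by simp
  from at[OF this] at[OF bB[OF B(3)]] eq
  show "ddir \<kappa> ?h p y =
      (\<Sum>e\<in>onb (g p). \<Sum>f\<in>onb (g p). covd2 \<kappa> D B p y e f * T p e f (V p) (W p)) +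
      (\<Sum>e\<in>onb (g p). \<Sum>f\<in>onb (g p). B p e f * T p e f (D V p y) (W p)) +
      (\<Sum>e\<in>onb (g p). \<Sum>f\<in>onb (g p). B p e f * T p e f (V p) (D W p y))"
    by simp
qed

section \<open>The reduced scalar curvature is constant\<close>

definition nu :: "'a \<Rightarrow> real" where
  "nu p = 4 * scalar_curvature \<kappa> g D p / (real DIM('v) * (real DIM('v) + 8))"

lemma nu_eq: "nu p = quat_curvature.nu (g p) (onb (g p)) (curvature \<kappa> D p)"
proof -
  interpret q: quat_curvature "g p" "onb (g p)" "triple p 1" "triple p 2" "triple p 3" "curvature \<kappa> D p"
    by (rule quat_curv)
  have "ricci \<kappa> g D p = q.ric"
    by (intro ext) (simp add: ricci_def q.ric_def)
  then have "scalar_curvature \<kappa> g D p = q.scal"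
    by (simp add: scalar_curvature_def q.scal_def)
  then show ?thesis
    unfolding nu_def q.nu_def by (simp add: q.card_E)
qed

lemma smooth_nu: "smooth_fun_at p nu"
proof -
  obtain F where F: "orthonormal_frame_at p F" using orthonormal_frame_exists by blast
  note sF = orthonormal_frame_smooth[OF F]
  let ?f = "\<lambda>q. \<Sum>a\<in>Basis. \<Sum>b\<in>Basis. g q (curv_op (F b) (F a) (F a) q) (F b q)"
  have s: "smooth_fun_at p ?f"
    by (intro smooth_fun_at_sum smooth_g smooth_curv_op sF)
  have evF: "eventually (\<lambda>q. \<forall>b\<in>Basis. smooth_vf_at q (F b)) (nhds p)"
    by (intro eventually_ball_finite finite_Basis ballI eventually_smooth_vf_at sF)
  have "eventually (\<lambda>q. ?f q = scalar_curvature \<kappa> g D q) (nhds p)"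
    using trace_frame[OF F] evF
  proof eventually_elim
    case (elim q)
    interpret q: quat_curvature "g q" "onb (g q)" "triple q 1" "triple q 2" "triple q 3" "curvature \<kappa> D q"
      by (rule quat_curv)
    have ric: "ricci \<kappa> g D q = q.ric"
      by (intro ext) (simp add: ricci_def q.ric_def)
    have "bilinear (\<lambda>x z. g q (curvature \<kappa> D q x a b) z)" for a b
      by (auto simp: bilinear_def intro!: linearI)
    from elim(1)[rule_format, OF this]
    have "ricci \<kappa> g D q (F a q) (F a q) = (\<Sum>b\<in>Basis. g q (curv_op (F b) (F a) (F a) q) (F b q))" if "a \<in> Basis" for a
      unfolding ricci_def using that elim(2) by (simp add: curvature_field[symmetric])
    moreover have "scalar_curvature \<kappa> g D q = (\<Sum>a\<in>Basis. ricci \<kappa> g D q (F a q) (F a q))"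
      unfolding scalar_curvature_def using elim(1)[rule_format, OF q.bilinear_ric] unfolding ric .
    ultimately show ?case by simp
  qed
  from smooth_fun_at_cong[OF s this] show ?thesis
    unfolding nu_def[abs_def]
    using smooth_fun_at_mult[OF smooth_fun_at_const[of p "4 / (real DIM('v) * (real DIM('v) + 8))"]] by simp
qed

text \<open>Otherwise the simplifier rewrites the index of \<open>triple p 1\<close> and the pointwise lemmas no longer match.\<close>

declare One_nat_def [simp del]

lemma bilinear_curvature_form: "bilinear (\<lambda>x z. g p (curvature \<kappa> D p b c x) z)"
  using linear_compose[OF linear_curvature3, where g = "\<lambda>x. g p x _"] g_bilinear
  unfolding bilinear_def comp_def by blast

text \<open>Two arguments of the curvature are frozen to coordinate fields of the chart of
  \<open>p\<close>, which are meaningful only on its domain. The result is a 2-tensor field to which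
  \<open>parallel_trace\<close> applies.\<close>

lemma smooth_curvature_form:
  "smooth_tensor2 \<kappa> (cdom \<kappa> p) (\<lambda>q x z. g q (curvature \<kappa> D q (cfield \<kappa> p b q) (cfield \<kappa> p c q) x) z)"
  unfolding smooth_tensor2_def smooth_in_chart_iff[OF open_cdom]
proof (intro conjI ballI allI bilinear_curvature_form)
  fix d w z q assume q: "q \<in> cdom \<kappa> p \<inter> cdom \<kappa> d"
  let ?f = "\<lambda>q. g q (curvature \<kappa> D q (cfield \<kappa> p b q) (cfield \<kappa> p c q) (cfield \<kappa> d w q)) (cfield \<kappa> d z q)"
  have c: "smooth_vf_at r (cfield \<kappa> p u)" "smooth_vf_at r (cfield \<kappa> d u)" if "r \<in> cdom \<kappa> p" "r \<in> cdom \<kappa> d" for r u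
    using that by (simp_all add: smooth_vf_at_cfield)
  have qq: "q \<in> cdom \<kappa> p" "q \<in> cdom \<kappa> d" using q by auto
  have "smooth_fun_at q ?f"
  proof (rule smooth_fun_at_cong)
    show "smooth_fun_at q (\<lambda>q. g q (curv_op (cfield \<kappa> p b) (cfield \<kappa> p c) (cfield \<kappa> d w) q) (cfield \<kappa> d z q))"
      by (intro smooth_g smooth_curv_op c qq)
    show "eventually (\<lambda>q. g q (curv_op (cfield \<kappa> p b) (cfield \<kappa> p c) (cfield \<kappa> d w) q) (cfield \<kappa> d z q) = ?f q) (nhds q)"
      using eventually_in_cdom[OF qq(1)] eventually_in_cdom[OF qq(2)]
      by eventually_elim (simp add: curvature_field[OF c(1) c(1) c(2)])
  qed
  then show "smooth_near (crd \<kappa> d q) (\<lambda>x. ?f (crd_inv \<kappa> d x))"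
    using smooth_fun_at_chart[OF qq(2)] by simp
qed

text \<open>
  The cyclic sum of the covariant derivatives of the curvature vanishes, and the contraction of the
  curvature with \<open>M4\<close> is \<open>nu\<close> times the parallel tensor \<open>M4\<close>. Hence the wedge product of
  \<open>d nu\<close> with each Kaehler form is zero.
\<close>

lemma d_nu_wedge:
  "ddir \<kappa> nu p a * M4 p b c v w + ddir \<kappa> nu p b * M4 p c a v w + ddir \<kappa> nu p c * M4 p a b v w = 0"
proof -
  let ?E = "cfield \<kappa> p" and ?N = "real DIM('v)" and ?O = "onb (g p)"
  have cq: "smooth_vf_at q (?E u)" if "q \<in> cdom \<kappa> p" for q u
    using that by (simp add: smooth_vf_at_cfield)
  note c = cq[OF centre_in_cdom]
  define K where "K b c = (\<lambda>q x z. g q (curvature \<kappa> D q (?E b q) (?E c q) x) z)" for b c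
  have K: "smooth_tensor2 \<kappa> (cdom \<kappa> p) (K b c)" for b c
    unfolding K_def by (rule smooth_curvature_form)
  have trM: "(\<Sum>e\<in>onb (g q). \<Sum>f\<in>onb (g q). K b c q e f * M4 q e f v w) =
      - (?N / 2) * (nu q * M4 q (?E b q) (?E c q) v w)" for b c q v w
  proof -
    interpret q: quat_curvature "g q" "onb (g q)" "triple q 1" "triple q 2" "triple q 3" "curvature \<kappa> D q"
      by (rule quat_curv)
    show ?thesis unfolding K_def M4_def nu_eq q.trace_R_M by (simp add: q.card_E)
  qed
  let ?V = "?E v" and ?W = "?E w"
  \<comment> \<open>This is the derivative of \<open>trM\<close>. Terms in which the fields through
    \<open>v\<close> and \<open>w\<close> are differentiated occur on both sides and cancel; those
    for \<open>b\<close> and \<open>c\<close> remain.\<close>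
  have main: "(\<Sum>e\<in>?O. \<Sum>f\<in>?O. covd2 \<kappa> D (K b c) p a e f * M4 p e f v w) =
      - (?N / 2) * (ddir \<kappa> nu p a * M4 p b c v w + nu p * (M4 p (D (?E b) p a) c v w + M4 p b (D (?E c) p a) v w))"
    for a b c
  proof -
    have "ddir \<kappa> (\<lambda>q. - (?N / 2) * (nu q * M4 q (?E b q) (?E c q) (?V q) (?W q))) p a =
        - (?N / 2) * (ddir \<kappa> nu p a * M4 p b c v w + nu p * (M4 p (D (?E b) p a) c v w + M4 p b (D (?E c) p a) v w
          + M4 p b c (D ?V p a) w + M4 p b c v (D ?W p a)))"
      unfolding ddir_cmult[OF smooth_fun_at_mult[OF smooth_nu M4_field(1)[OF c c c c]]]
      by (simp add: ddir_mult smooth_nu M4_field c cfield_self algebra_simps)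
    with parallel_trace(2)[OF K[of b c] open_cdom centre_in_cdom parallel4_M4 c[of v] c[of w], of a]
    show ?thesis
      unfolding trM by (simp add: cfield_self algebra_simps)
  qed
  have cov: "covd2 \<kappa> D (K b c) p a x z = g p (D (\<lambda>q. D (\<lambda>r. D (?E x) r (?E c r)) q (?E b q)
      - D (\<lambda>r. D (?E x) r (?E b r)) q (?E c q)) p a - curvature \<kappa> D p b c (D (?E x) p a)) z" for a b c x z
  proof -
    let ?Y = "\<lambda>q. D (\<lambda>r. D (?E x) r (?E c r)) q (?E b q) - D (\<lambda>r. D (?E x) r (?E b r)) q (?E c q)"
    have Y: "smooth_vf_at p ?Y" by (intro smooth_vf_at_diff smooth_D c)
    have "eventually (\<lambda>q. g q (?Y q) (?E z q) = K b c q (?E x q) (?E z q)) (nhds p)"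
      using eventually_in_cdom[OF centre_in_cdom]
      by eventually_elim (simp add: K_def curvature_cfield[OF _ cq])
    from ddir_cong[OF smooth_g[OF Y c] this, of a]
    have "ddir \<kappa> (\<lambda>q. K b c q (?E x q) (?E z q)) p a = g p (D ?Y p a) (?E z p) + g p (?Y p) (D (?E z) p a)"
      unfolding D_metric[OF Y c] .
    moreover have "?Y p = curvature \<kappa> D p b c x"
      using curvature_cfield[OF centre_in_cdom c, of b c x] by (simp add: cfield_self)
    ultimately have h: "ddir \<kappa> (\<lambda>q. K b c q (?E x q) (?E z q)) p a =
        g p (D ?Y p a) z + g p (curvature \<kappa> D p b c x) (D (?E z) p a)"
      by (simp only: cfield_self)
    show ?thesis
      unfolding covd2_def h bilinear_lsub[OF g_bilinear] by (simp add: K_def cfield_self)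
  qed
  have cyc: "covd2 \<kappa> D (K b c) p a x z + covd2 \<kappa> D (K c a) p b x z + covd2 \<kappa> D (K a b) p c x z = 0" for x z
  proof -
    have R: "curvature \<kappa> D p b c (D (?E x) p a) = D (\<lambda>q. D (\<lambda>r. D (?E x) r (?E a r)) q (?E c q)) p b
        - D (\<lambda>q. D (\<lambda>r. D (?E x) r (?E a r)) q (?E b q)) p c" for a b c
      using curvature_cfield[OF centre_in_cdom smooth_D[OF c c], of b c x a] by (simp add: cfield_self)
    show ?thesis
      unfolding cov bilinear_ladd[OF g_bilinear, symmetric] R
      unfolding second_bianchi[OF c[of x], where a = a and b = b and c = c] by (rule bilinear_lzero[OF g_bilinear])
  qed
  have Ecomm: "D (?E x) p y = D (?E y) p x" for x y
    using cfield_commute[OF centre_in_cdom, of p x y] by (simp add: cfield_self)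
  have Msk: "M4 p x y v w = - M4 p y x v w" for x y
    unfolding M4_def quat_space.M_def[OF quat] quat_space.G_J_swap[OF quat[of p], of x y] by simp
  have "(\<Sum>e\<in>?O. \<Sum>f\<in>?O. covd2 \<kappa> D (K b c) p a e f * M4 p e f v w) +
      (\<Sum>e\<in>?O. \<Sum>f\<in>?O. covd2 \<kappa> D (K c a) p b e f * M4 p e f v w) +
      (\<Sum>e\<in>?O. \<Sum>f\<in>?O. covd2 \<kappa> D (K a b) p c e f * M4 p e f v w) = 0"
    unfolding sum.distrib[symmetric] distrib_right[symmetric] cyc by simp
  \<comment> \<open>The remaining connection terms cancel in the cyclic sum, because
    \<open>D (?E x) p y\<close> is symmetric in \<open>x\<close> and \<open>y\<close> and
    \<open>M4\<close> is skew in its first two arguments.\<close>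
  then have "- (?N / 2) * (ddir \<kappa> nu p a * M4 p b c v w + ddir \<kappa> nu p b * M4 p c a v w + ddir \<kappa> nu p c * M4 p a b v w) = 0"
    unfolding main Ecomm[of c a] Ecomm[of b a] Ecomm[of c b]
    using Msk[of "D (?E a) p b" c] Msk[of "D (?E a) p c" b] Msk[of "D (?E b) p c" a]
    by (simp add: algebra_simps)
  then show ?thesis by simp
qed

text \<open>In \<open>d_nu_wedge\<close>, evaluated on \<open>a\<close>, \<open>b\<close> and
  \<open>J1 b\<close> with \<open>b\<close> orthogonal to \<open>a\<close> and \<open>J1 a\<close>,
  two of the three terms vanish and the third is the derivative along \<open>a\<close> times the
  squared length of \<open>b\<close>. Such a non-zero \<open>b\<close> exists because the dimension
  exceeds two.\<close>

lemma ddir_nu: "ddir \<kappa> nu p a = 0"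
proof (cases "a = 0")
  case True
  then show ?thesis using linear_0[OF linear_ddir[OF smooth_nu]] by simp
next
  case False
  interpret q: quat_space "g p" "onb (g p)" "triple p 1" "triple p 2" "triple p 3" by (rule quat)
  let ?J = "triple p 1"
  have "\<exists>x. x \<notin> span {a, ?J a}"
  proof (rule ccontr)
    assume "\<nexists>x. x \<notin> span {a, ?J a}"
    then have "UNIV \<subseteq> span {a, ?J a}" by auto
    then have "DIM('v) \<le> card {a, ?J a}"
      using dim_le_card[of UNIV "{a, ?J a}"] by simp
    also have "\<dots> \<le> 2" by (simp add: card_insert_if)
    finally show False using dim_ge by simp
  qed
  then obtain x where x: "x \<notin> span {a, ?J a}" by blast
  let ?s = "g p a a"
  have s: "?s > 0" using g_pos[OF False] .
  define b where "b = x - (g p x a / ?s) *\<^sub>R a - (g p x (?J a) / ?s) *\<^sub>R ?J a"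
  have "b \<noteq> 0"
  proof
    assume "b = 0"
    then have "x = (g p x a / ?s) *\<^sub>R a + (g p x (?J a) / ?s) *\<^sub>R ?J a" unfolding b_def by (simp add: algebra_simps)
    also have "\<dots> \<in> span {a, ?J a}" by (intro span_add span_scale span_base) auto
    finally show False using x by simp
  qed
  then have bb: "g p b b > 0" by (rule g_pos)
  have JJ: "g p (?J a) (?J a) = ?s" by (simp add: q.J_calc)
  have b1: "g p b a = 0" "g p b (?J a) = 0"
    using s JJ g_sym[of p a "?J a"] unfolding b_def by simp_all
  obtain v where v: "g p v v = 1" using q.E_nonempty by blast
  have M: "M4 p x y v (?J v) = g p (?J x) y" for x y
    unfolding M4_def q.M_def using v by (simp add: q.J_calc)
  have "ddir \<kappa> nu p a * g p b b = 0"
    using d_nu_wedge[of p a b "?J b" v "?J v"] b1 g_sym[of p a] q.G_J_swap(1)[of b a] unfolding M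
    by (simp add: q.J_calc)
  then show ?thesis using bb by simp
qed

section \<open>Killing vector fields\<close>

text \<open>The second covariant derivative of \<open>X\<close>, with \<open>z\<close> extended by a
  coordinate field.\<close>

definition hess :: "('a, 'v) vfield \<Rightarrow> 'a \<Rightarrow> 'v \<Rightarrow> 'v \<Rightarrow> 'v" where
  "hess X p y z = D (\<lambda>q. D X q (cfield \<kappa> p z q)) p y - D X p (D (cfield \<kappa> p z) p y)"

lemma smooth_grad_form:
  assumes "smooth_vfield \<kappa> UNIV X"
  shows "smooth_tensor2 \<kappa> UNIV (grad_form g D X)"
proof (rule smooth_tensor2I)
  have X: "smooth_vf_at q X" for q using assms smooth_vfield_iff[OF open_UNIV] by blast
  show "bilinear (grad_form g D X q)" for q
    using linear_compose[OF linear_D[OF X], where g = "\<lambda>x. g q x _"] g_bilinear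
    unfolding bilinear_def comp_def grad_form_def by blast
  show "smooth_fun_at q (\<lambda>r. grad_form g D X r (Y r) (Z r))" if "smooth_vf_at q Y" "smooth_vf_at q Z" for q Y Z
    unfolding grad_form_def by (intro smooth_g smooth_D X that)
qed

lemma covd2_grad_form:
  assumes "smooth_vfield \<kappa> UNIV X"
  shows "covd2 \<kappa> D (grad_form g D X) p y z w = g p (hess X p y z) w"
proof -
  have X: "smooth_vf_at q X" for q using assms smooth_vfield_iff[OF open_UNIV] by blast
  have c: "smooth_vf_at p (cfield \<kappa> p w)" for w by (simp add: smooth_vf_at_cfield)
  show ?thesis
    unfolding covd2_def grad_form_def D_metric[OF smooth_D[OF X c] c] hess_def
    by (simp add: cfield_self bilinear_lsub[OF g_bilinear])
qed

text \<open>Kostant's formula. The commutator of second derivatives and the first Bianchi identity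
  make the difference \<open>b\<close> of the two sides symmetric in its first two arguments, and
  the Killing condition makes it skew in the last two. A trilinear expression with both symmetries
  is zero.\<close>

lemma killing_hess:
  assumes sX: "smooth_vfield \<kappa> UNIV X"
    and kill: "\<And>q z w. g q (D X q z) w = - g q z (D X q w)"
  shows "hess X p y z = - curvature \<kappa> D p (X p) y z"
proof -
  have X: "smooth_vf_at q X" for q using sX smooth_vfield_iff[OF open_UNIV] by blast
  interpret q: quat_curvature "g p" "onb (g p)" "triple p 1" "triple p 2" "triple p 3" "curvature \<kappa> D p"
    by (rule quat_curv)
  have B: "smooth_tensor2 \<kappa> UNIV (grad_form g D X)" by (rule smooth_grad_form[OF sX])
  have "two_form \<kappa> (grad_form g D X)"
    unfolding two_form_def
  proof (intro conjI B allI)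
    show "grad_form g D X q v w = - grad_form g D X q w v" for q v w
      unfolding grad_form_def using kill[of q v w] g_sym[of q v "D X q w"] by simp
  qed
  from covd2_skew[OF this] have skew: "g p (hess X p y z) w = - g p (hess X p y w) z" for y z w
    unfolding covd2_grad_form[OF sX] .
  have comm: "hess X p y z - hess X p z y = curvature \<kappa> D p y z (X p)" for y z
    using curvature_cfield[OF centre_in_cdom X, of p y z] cfield_commute[OF centre_in_cdom, of p y z]
    unfolding hess_def by (simp add: cfield_self)
  define b where "b y z w = g p (hess X p y z + curvature \<kappa> D p (X p) y z) w" for y z w
  have b1: "b y z w = - b y w z" for y z w
    unfolding b_def using skew[of y z w] q.R_skew[of "X p" y z w] g_sym[of p z] by simp
  have b2: "b y z w = b z y w" for y z w
  proof -
    have "hess X p y z + curvature \<kappa> D p (X p) y z = hess X p z y + curvature \<kappa> D p (X p) z y"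
      using comm[of y z] q.R_bianchi[of "X p" y z] q.R_swap[of "X p" z y] by (simp add: algebra_simps)
    then show ?thesis unfolding b_def by simp
  qed
  have "b y z w = 0" for w
    using b1[of y z w] b2[of y w z] b1[of w y z] b2[of w z y] b1[of z w y] b2[of z y w] by linarith
  then have "hess X p y z + curvature \<kappa> D p (X p) y z = 0"
    unfolding b_def by (intro q.G_eqI) simp
  then show ?thesis by (simp add: add_eq_0_iff2)
qed

end

section \<open>Sums and multiples of 2-tensor fields\<close>

context levi_civita_manifold
begin

lemma smooth_tensor2_add:
  assumes "smooth_tensor2 \<kappa> UNIV A" "smooth_tensor2 \<kappa> UNIV B"
  shows "smooth_tensor2 \<kappa> UNIV (\<lambda>q v w. A q v w + B q v w)"
proof (rule smooth_tensor2I)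
  show "bilinear (\<lambda>v w. A q v w + B q v w)" for q
    using assms unfolding smooth_tensor2_def bilinear_def by (auto intro: linear_compose_add)
qed (intro smooth_fun_at_add smooth_tensor2_at[OF assms(1) open_UNIV UNIV_I] smooth_tensor2_at[OF assms(2) open_UNIV UNIV_I])

lemma smooth_tensor2_fmult:
  assumes "\<And>q. smooth_fun_at q f" "smooth_tensor2 \<kappa> UNIV B"
  shows "smooth_tensor2 \<kappa> UNIV (\<lambda>q v w. f q * B q v w)"
proof (rule smooth_tensor2I)
  show "bilinear (\<lambda>v w. f q * B q v w)" for q
  proof -
    have bl: "bilinear (B q)" using assms(2) unfolding smooth_tensor2_def by blast
    show ?thesis
      unfolding bilinear_def by (auto intro!: linearI simp: bilinear_ladd[OF bl] bilinear_radd[OF bl]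
          bilinear_lmul[OF bl] bilinear_rmul[OF bl] algebra_simps)
  qed
qed (intro smooth_fun_at_mult assms(1) smooth_tensor2_at[OF assms(2) open_UNIV UNIV_I])

lemma covd2_add:
  assumes "smooth_tensor2 \<kappa> UNIV A" "smooth_tensor2 \<kappa> UNIV B"
  shows "covd2 \<kappa> D (\<lambda>q v w. A q v w + B q v w) p y v w = covd2 \<kappa> D A p y v w + covd2 \<kappa> D B p y v w"
  unfolding covd2_def
  by (simp add: ddir_add smooth_tensor2_at[OF assms(1) open_UNIV UNIV_I] smooth_tensor2_at[OF assms(2) open_UNIV UNIV_I]
      smooth_vf_at_cfield)

lemma covd2_fmult:
  assumes "smooth_fun_at p f" "smooth_tensor2 \<kappa> UNIV B"
  shows "covd2 \<kappa> D (\<lambda>q v w. f q * B q v w) p y v w = ddir \<kappa> f p y * B p v w + f p * covd2 \<kappa> D B p y v w"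
  unfolding covd2_def
  by (simp add: ddir_mult assms(1) smooth_tensor2_at[OF assms(2) open_UNIV UNIV_I] smooth_vf_at_cfield cfield_self
      algebra_simps)

lemma G_eqI: "(\<And>w. g p x w = g p y w) \<Longrightarrow> x = y"
  using onb_space.G_eqI[OF onb_space_onb] .

lemma two_formD:
  assumes "two_form \<kappa> \<psi>"
  shows "smooth_tensor2 \<kappa> UNIV \<psi>" "bilinear (\<psi> p)" "\<psi> p v w = - \<psi> p w v"
proof -
  show "smooth_tensor2 \<kappa> UNIV \<psi>" "\<psi> p v w = - \<psi> p w v"
    using assms unfolding two_form_def by blast+
  then show "bilinear (\<psi> p)" unfolding smooth_tensor2_def by blast
qed

end

section \<open>Projections to S2H and S2E and their covariant derivatives\<close>

lemma (in quat_space) conjugation_invariant: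
  assumes B: "bilinear B" and eq: "\<And>v w. B (J1 v) (J1 w) + B (J2 v) (J2 w) + B (J3 v) (J3 w) = 3 * (B v w :: real)"
  shows "B (J1 v) (J1 w) = B v w" "B (J2 v) (J2 w) = B v w" "B (J3 v) (J3 w) = B v w"
  \<comment> \<open>Let T_i denote conjugation by \<open>Ji\<close>. On bilinear forms T_i T_i = 1
    and T_i T_j = T_k, so applying T_1 to T_1 B + T_2 B + T_3 B = 3 B gives B + T_3 B + T_2 B = 3
    T_1 B, and comparison yields T_1 B = B.\<close>
  using eq[of v w] eq[of "J1 v" "J1 w"] eq[of "J2 v" "J2 w"] eq[of "J3 v" "J3 w"]
  by (simp_all add: J_sq J_prod bilinear_lneg[OF B] bilinear_rneg[OF B])

lemma (in quat_space) trace_M_conjugates: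
  assumes B: "bilinear (B :: 'v \<Rightarrow> 'v \<Rightarrow> real)"
  shows "(\<Sum>e\<in>E. \<Sum>f\<in>E. B e f * M v e w f) = B (J1 v) (J1 w) + B (J2 v) (J2 w) + B (J3 v) (J3 w)"
proof -
  have l: "linear (B x)" "linear (\<lambda>x. B x y)" for x y using B unfolding bilinear_def by auto
  have "(\<Sum>f\<in>E. B e f * M v e w f) =
      B e (J1 w) * G (J1 v) e + B e (J2 w) * G (J2 v) e + B e (J3 w) * G (J3 v) e" for e
  proof -
    have "B e f * M v e w f = G (J1 v) e * (B e f * G (J1 w) f) + G (J2 v) e * (B e f * G (J2 w) f)
        + G (J3 v) e * (B e f * G (J3 w) f)" for f
      unfolding M_def by (simp add: algebra_simps)
    then show ?thesis
      by (simp add: sum.distrib sum_distrib_left[symmetric] contract(3)[OF l(1)])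
  qed
  then show ?thesis by (simp add: sum.distrib contract(3)[OF l(2)])
qed

context qk_manifold
begin

text \<open>By \<open>invariant_change\<close> it suffices to test one triple, although the
  definition quantifies over all of them.\<close>

lemma S2E_iff:
  "B \<in> S2E (g p) (Q p) \<longleftrightarrow> bilinear B \<and> (\<forall>v w. B v w = - B w v) \<and>
    (\<forall>i\<in>{1..3}. \<forall>v w. B (triple p i v) (triple p i w) = B v w)"
proof
  assume "B \<in> S2E (g p) (Q p)"
  then show "bilinear B \<and> (\<forall>v w. B v w = - B w v) \<and>
    (\<forall>i\<in>{1..3}. \<forall>v w. B (triple p i v) (triple p i w) = B v w)"
    unfolding S2E_def using admissible_triple by blast
next
  assume a: "bilinear B \<and> (\<forall>v w. B v w = - B w v) \<and>
    (\<forall>i\<in>{1..3}. \<forall>v w. B (triple p i v) (triple p i w) = B v w)"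
  then have b: "bilinear B" and i: "\<And>i v w. i \<in> {1..3} \<Longrightarrow> B (triple p i v) (triple p i w) = B v w"
    by blast+
  have "B (I i v) (I i w) = B v w" if "admissible_triple (g p) (Q p) I" "i \<in> {1..3}" for I i v w
    using invariant_change[where B = B and v = v and w = w, OF admissible_triple that(1) onb_space_onb b _ that(2)] i
    by simp
  then show "B \<in> S2E (g p) (Q p)" unfolding S2E_def using a by blast
qed

lemma S2E_D:
  assumes "B \<in> S2E (g p) (Q p)"
  shows "bilinear B" "B v w = - B w v" "i \<in> {1..3} \<Longrightarrow> B (triple p i v) (triple p i w) = B v w"
  using assms unfolding S2E_iff by blast+

lemma S2H_iff:
  "B \<in> S2H (g p) (Q p) \<longleftrightarrow> (\<exists>a :: nat \<Rightarrow> real. \<forall>v w. B v w = (\<Sum>i=1..3. a i * g p (triple p i v) w))"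
  by (rule S2H_change[OF admissible_triple onb_space_onb])

lemma proj_S2E_eq:
  "proj_S2E (g p) (Q p) B v w = 1 / 4 * (B v w + (\<Sum>i=1..3. B (triple p i v) (triple p i w)))"
  unfolding proj_S2E_def triple_def Let_def ..

lemma proj_S2E_M4:
  assumes "bilinear B"
  shows "proj_S2E (g p) (Q p) B v w =
    1 / 4 * (B v w + (\<Sum>e\<in>onb (g p). \<Sum>f\<in>onb (g p). B e f * M4 p v e w f))"
  unfolding proj_S2E_eq M4_def quat_space.trace_M_conjugates[OF quat assms] sum_1_3 by simp

lemma proj_S2H_M4:
  assumes "bilinear B"
  shows "proj_S2H (g p) (Q p) B v w =
    1 / real DIM('v) * (\<Sum>e\<in>onb (g p). \<Sum>f\<in>onb (g p). B e f * M4 p e f v w)"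
  unfolding proj_S2H_def triple_def[symmetric] Let_def M4_def quat_space.trace_M[OF quat assms] sum_1_3 ..

lemma proj_S2E_mem:
  assumes B: "bilinear B" and skew: "\<And>v w. B v w = - B w v"
  shows "proj_S2E (g p) (Q p) B \<in> S2E (g p) (Q p)"
  unfolding S2E_iff
proof (intro conjI allI ballI)
  interpret q: quat_space "g p" "onb (g p)" "triple p 1" "triple p 2" "triple p 3" by (rule quat)
  note n = bilinear_lneg[OF B] bilinear_rneg[OF B]
  have e: "proj_S2E (g p) (Q p) B v w = 1 / 4 * (B v w + (B (triple p 1 v) (triple p 1 w) +
      B (triple p 2 v) (triple p 2 w) + B (triple p 3 v) (triple p 3 w)))" for v w
    unfolding proj_S2E_eq sum_1_3 ..
  show "bilinear (proj_S2E (g p) (Q p) B)"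
    unfolding bilinear_def e
    by (auto intro!: linearI simp: bilinear_ladd[OF B] bilinear_radd[OF B] bilinear_lmul[OF B] bilinear_rmul[OF B]
        add_divide_distrib algebra_simps)
  show "proj_S2E (g p) (Q p) B v w = - proj_S2E (g p) (Q p) B w v" for v w
  proof -
    have "1 / 4 * (a + (b + c + d)) = - (1 / 4 * (- a + (- b + - c + - d)))" for a b c d :: real
      by (simp add: field_simps)
    then show ?thesis
      unfolding e skew[of w v] skew[of "triple p 1 w" "triple p 1 v"] skew[of "triple p 2 w" "triple p 2 v"]
        skew[of "triple p 3 w" "triple p 3 v"] .
  qed
  fix i :: nat and v w assume "i \<in> {1..3}"
  then have "i = 1 \<or> i = 2 \<or> i = 3" by auto
  then show "proj_S2E (g p) (Q p) B (triple p i v) (triple p i w) = proj_S2E (g p) (Q p) B v w"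
    unfolding e by (elim disjE; simp add: q.J_sq q.J_prod n)
qed

text \<open>Conjugation of omega_i by \<open>Jj\<close> fixes it for j = i and changes its sign for
  the two other indices, so the four terms in the projection of an S2H form add up to zero.\<close>

lemma proj_S2E_sum:
  assumes u: "u \<in> S2E (g p) (Q p)" and h: "h \<in> S2H (g p) (Q p)"
  shows "proj_S2E (g p) (Q p) (\<lambda>v w. u v w + h v w) = u"
proof (intro ext)
  fix v w
  interpret q: quat_space "g p" "onb (g p)" "triple p 1" "triple p 2" "triple p 3" by (rule quat)
  obtain a :: "nat \<Rightarrow> real" where a: "\<And>v w. h v w = (\<Sum>i=1..3. a i * g p (triple p i v) w)"
    using h unfolding S2H_iff by blast
  have ui: "u (triple p 1 v) (triple p 1 w) = u v w" "u (triple p 2 v) (triple p 2 w) = u v w"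
    "u (triple p 3 v) (triple p 3 w) = u v w"
    using S2E_D(3)[OF u] by simp_all
  show "proj_S2E (g p) (Q p) (\<lambda>v w. u v w + h v w) v w = u v w"
    unfolding proj_S2E_eq sum_1_3 ui a by (simp add: q.J_calc)
qed

lemma S2H_trace:
  assumes h: "h \<in> S2H (g p) (Q p)"
  shows "(\<Sum>e\<in>onb (g p). \<Sum>f\<in>onb (g p). h e f * M4 p e f v w) = real DIM('v) * h v w" "bilinear h"
proof -
  interpret q: quat_space "g p" "onb (g p)" "triple p 1" "triple p 2" "triple p 3" by (rule quat)
  obtain a :: "nat \<Rightarrow> real" where "\<And>v w. h v w = (\<Sum>i=1..3. a i * g p (triple p i v) w)"
    using h unfolding S2H_iff by blast
  then have a: "h v w = a 1 * g p (triple p 1 v) w + a 2 * g p (triple p 2 v) w + a 3 * g p (triple p 3 v) w" for v w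
    unfolding sum_1_3 .
  show b: "bilinear h"
    unfolding bilinear_def a by (auto intro!: linearI simp: algebra_simps)
  have "h e (triple p 1 e) = a 1 * g p e e" "h e (triple p 2 e) = a 2 * g p e e" "h e (triple p 3 e) = a 3 * g p e e" for e
    unfolding a by (simp_all add: q.J_calc)
  then show "(\<Sum>e\<in>onb (g p). \<Sum>f\<in>onb (g p). h e f * M4 p e f v w) = real DIM('v) * h v w"
    unfolding M4_def q.trace_M[OF b] using q.trace_G
    by (simp add: sum_distrib_left[symmetric] q.card_E a algebra_simps)
qed

lemma covd2_bilinear: "smooth_tensor2 \<kappa> UNIV B \<Longrightarrow> bilinear (covd2 \<kappa> D B p y)"
  unfolding bilinear_def using linear_covd2_args[of B p y] by simp

lemma smooth_proj_S2E:
  assumes "two_form \<kappa> \<psi>"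
  shows "section_S2E \<kappa> g Q (S2E_part g Q \<psi>)"
proof -
  note \<psi> = two_formD[OF assms]
  have mem: "S2E_part g Q \<psi> p \<in> S2E (g p) (Q p)" for p
    unfolding S2E_part_def by (rule proj_S2E_mem[OF \<psi>(2)]) (rule \<psi>(3))
  have "smooth_tensor2 \<kappa> UNIV (S2E_part g Q \<psi>)"
  proof (rule smooth_tensor2I)
    show "bilinear (S2E_part g Q \<psi> q)" for q using mem[of q] unfolding S2E_def by blast
    show "smooth_fun_at q (\<lambda>r. S2E_part g Q \<psi> r (X r) (Y r))" if XY: "smooth_vf_at q X" "smooth_vf_at q Y" for q X Y
      unfolding S2E_part_def proj_S2E_M4[OF \<psi>(2)]
      by (intro smooth_fun_at_mult smooth_fun_at_const smooth_fun_at_add smooth_tensor2_at[OF \<psi>(1) open_UNIV UNIV_I]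
          parallel_trace(1)[OF \<psi>(1) open_UNIV UNIV_I parallel4_M4'] XY)
  qed
  then show ?thesis
    using mem unfolding section_S2E_def two_form_def S2E_def by blast
qed

text \<open>Membership in S2E gives the single identity \<open>tr\<close>, a contraction with a
  parallel tensor. Differentiating it transfers the averaged invariance to the derivative of
  \<open>u\<close>, and \<open>conjugation_invariant\<close> recovers invariance under each
  structure.\<close>

lemma covd2_S2E:
  assumes u: "section_S2E \<kappa> g Q u" and i: "i \<in> {1..3}"
  shows "covd2 \<kappa> D u p y (triple p i v) (triple p i w) = covd2 \<kappa> D u p y v w"
proof -
  interpret q: quat_space "g p" "onb (g p)" "triple p 1" "triple p 2" "triple p 3" by (rule quat)
  have tf: "two_form \<kappa> u" using u unfolding section_S2E_def by blast
  note ut = two_formD[OF tf]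
  have tr: "(\<Sum>e\<in>onb (g q). \<Sum>f\<in>onb (g q). u q e f * M4 q v e w f) = 3 * u q v w" for q v w
  proof -
    have "u q \<in> S2E (g q) (Q q)" using u unfolding section_S2E_def by blast
    from S2E_D(3)[OF this] have "u q (triple q 1 v) (triple q 1 w) = u q v w" "u q (triple q 2 v) (triple q 2 w) = u q v w"
      "u q (triple q 3 v) (triple q 3 w) = u q v w"
      by simp_all
    then show ?thesis unfolding M4_def quat_space.trace_M_conjugates[OF quat ut(2)] by simp
  qed
  note bl = covd2_bilinear[OF ut(1), of p y]
  have "covd2 \<kappa> D u p y (triple p 1 v) (triple p 1 w) + covd2 \<kappa> D u p y (triple p 2 v) (triple p 2 w)
      + covd2 \<kappa> D u p y (triple p 3 v) (triple p 3 w) = 3 * covd2 \<kappa> D u p y v w" for v w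
  proof -
    let ?V = "cfield \<kappa> p v" and ?W = "cfield \<kappa> p w"
    have c: "smooth_vf_at p (cfield \<kappa> p w)" for w by (simp add: smooth_vf_at_cfield)
    note pt = parallel_trace(2)[OF ut(1) open_UNIV UNIV_I parallel4_M4' c[of v] c[of w], of y]
    have "3 * ddir \<kappa> (\<lambda>q. u q (?V q) (?W q)) p y =
        (\<Sum>e\<in>onb (g p). \<Sum>f\<in>onb (g p). covd2 \<kappa> D u p y e f * M4 p v e w f) +
        3 * u p (D ?V p y) w + 3 * u p v (D ?W p y)"
      using pt unfolding tr ddir_cmult[OF smooth_tensor2_at[OF ut(1) open_UNIV UNIV_I c c]] by (simp add: cfield_self)
    then have "(\<Sum>e\<in>onb (g p). \<Sum>f\<in>onb (g p). covd2 \<kappa> D u p y e f * M4 p v e w f) = 3 * covd2 \<kappa> D u p y v w"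
      unfolding covd2_field[OF ut(1) c c] by (simp add: cfield_self)
    then show ?thesis unfolding M4_def q.trace_M_conjugates[OF bl] .
  qed
  note q.conjugation_invariant[OF bl this]
  moreover have "i = 1 \<or> i = 2 \<or> i = 3" using i by auto
  ultimately show ?thesis by auto
qed

text \<open>\<open>S2H_trace\<close> holds at every point; differentiating this contraction gives
  the same identity for the derivative of \<open>h\<close>.\<close>

lemma covd2_S2H:
  assumes h: "smooth_tensor2 \<kappa> UNIV h" "\<And>q. h q \<in> S2H (g q) (Q q)"
  shows "real DIM('v) * covd2 \<kappa> D h p y v w = (\<Sum>e\<in>onb (g p). \<Sum>f\<in>onb (g p). covd2 \<kappa> D h p y e f * M4 p e f v w)"
proof -
  let ?V = "cfield \<kappa> p v" and ?W = "cfield \<kappa> p w" and ?N = "real DIM('v)"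
  have c: "smooth_vf_at p (cfield \<kappa> p w)" for w by (simp add: smooth_vf_at_cfield)
  note pt = parallel_trace(2)[OF h(1) open_UNIV UNIV_I parallel4_M4 c[of v] c[of w], of y]
  have "?N * ddir \<kappa> (\<lambda>q. h q (?V q) (?W q)) p y =
      (\<Sum>e\<in>onb (g p). \<Sum>f\<in>onb (g p). covd2 \<kappa> D h p y e f * M4 p e f v w) +
      ?N * h p (D ?V p y) w + ?N * h p v (D ?W p y)"
    using pt unfolding S2H_trace(1)[OF h(2)] ddir_cmult[OF smooth_tensor2_at[OF h(1) open_UNIV UNIV_I c c]]
    by (simp add: cfield_self)
  then show ?thesis
    unfolding covd2_field[OF h(1) c c] by (simp add: cfield_self algebra_simps)
qed

end

section \<open>Solutions and conformal-Killing forms\<close>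

locale qk_scal = qk_manifold \<kappa> g D Q
  for \<kappa> :: "('a::t2_space, 'v::euclidean_space) atlas" and g D Q +
  fixes n :: nat
  assumes dim_n: "DIM('v) = 4 * n" and n_ge: "4 * n \<ge> 8"
    and scal_nonzero: "scalar_curvature \<kappa> g D p \<noteq> 0"
begin

definition c0 :: real where "c0 = 1 / (4 * real n - 1)"

lemma dim_real: "real DIM('v) = 4 * real n"
  using dim_n by simp

lemma n_real: "real n \<ge> 2"
  using n_ge by simp

lemma c0_nonzero: "c0 \<noteq> 0" and c0_eq: "c0 * (1 - 4 * real n) = - 1"
  using n_real unfolding c0_def by (simp_all add: field_simps)

lemma card_onb: "real (card (onb (g p))) = 4 * real n"
  using onb_space.card_E[OF onb_space_onb, of p] dim_n by simp

lemma nu_reduced: "reduced_scalar_curvature \<kappa> g D n p = nu p"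
proof -
  have "4 * real n * (4 * real n + 8) = 4 * (4 * real n * (real n + 2))"
    by (simp add: algebra_simps)
  then show ?thesis
    unfolding reduced_scalar_curvature_def nu_def dim_real by simp
qed

lemma nu_nonzero: "nu p \<noteq> 0"
  unfolding nu_def dim_real using scal_nonzero n_real by simp

lemma wedge_Phi4:
  assumes "admissible_triple (g p) (Q p) I"
  shows "wedge (g p) x y z w + (\<Sum>i=1..3. wedge (g p) (I i x) (I i y) z w) = Phi4 p x y z w"
  unfolding Phi4_eq M4_admissible[OF assms] wedge_def by (simp add: sum_subtractf)

text \<open>\<open>Phi4\<close> does not depend on the admissible basis, and every point lies in the
  domain of one; so the condition over all local bases becomes one tensor equation.\<close>

lemma S2E_equation_iff:
  "S2E_equation \<kappa> g D Q n u X \<longleftrightarrow> (\<forall>p y z w. covd2 \<kappa> D u p y z w = c0 * Phi4 p (X p) y z w)"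
proof
  assume eq: "S2E_equation \<kappa> g D Q n u X"
  show "\<forall>p y z w. covd2 \<kappa> D u p y z w = c0 * Phi4 p (X p) y z w"
  proof (intro allI)
    fix p y z w
    obtain U J where J: "p \<in> U" "admissible_basis \<kappa> g Q U J" using admissible by blast
    then have t: "admissible_triple (g p) (Q p) (\<lambda>i. J i p)"
      unfolding admissible_basis_def by simp
    show "covd2 \<kappa> D u p y z w = c0 * Phi4 p (X p) y z w"
      using eq[unfolded S2E_equation_def, THEN spec, THEN spec, THEN mp, OF J(2), THEN bspec, OF J(1)]
        wedge_Phi4[OF t] unfolding c0_def by simp
  qed
next
  assume eq: "\<forall>p y z w. covd2 \<kappa> D u p y z w = c0 * Phi4 p (X p) y z w"
  show "S2E_equation \<kappa> g D Q n u X"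
    unfolding S2E_equation_def
  proof (intro allI impI ballI)
    fix U J p y z w assume J: "admissible_basis \<kappa> g Q U J" "p \<in> U"
    then have t: "admissible_triple (g p) (Q p) (\<lambda>i. J i p)"
      unfolding admissible_basis_def by simp
    show "covd2 \<kappa> D u p y z w = 1 / (4 * real n - 1) *
        (wedge (g p) (X p) y z w + (\<Sum>i=1..3. wedge (g p) (J i p (X p)) (J i p y) z w))"
      using eq wedge_Phi4[OF t] unfolding c0_def by simp
  qed
qed

text \<open>The factor \<open>4n + 2\<close> is minus the trace of \<open>Phi4\<close> computed in
  \<open>trace_Phi\<close>, and \<open>4n - 1\<close> comes from \<open>c0\<close>.\<close>

lemma codiff_solution:
  assumes u: "smooth_tensor2 \<kappa> UNIV u" and eq: "\<And>y z w. covd2 \<kappa> D u p y z w = c0 * Phi4 p x y z w"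
  shows "codiff \<kappa> g D u p = ((4 * real n + 2) / (4 * real n - 1)) *\<^sub>R x"
proof (rule G_eqI)
  interpret q: quat_space "g p" "onb (g p)" "triple p 1" "triple p 2" "triple p 3" by (rule quat)
  fix w
  have "g p (codiff \<kappa> g D u p) w = - (c0 * (\<Sum>e\<in>onb (g p). Phi4 p x e e w))"
    unfolding codiff_G[OF u] eq by (simp add: sum_distrib_left)
  also have "\<dots> = c0 * (4 * real n + 2) * g p x w"
    unfolding Phi4_def q.trace_Phi card_onb by (simp add: algebra_simps)
  finally show "g p (codiff \<kappa> g D u p) w = g p (((4 * real n + 2) / (4 * real n - 1)) *\<^sub>R x) w"
    unfolding c0_def by simp
qed

lemma solution_vfield:
  assumes "section_S2E \<kappa> g Q u" "S2E_equation \<kappa> g D Q n u X"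
  shows "X p = ((4 * real n - 1) / (4 * real n + 2)) *\<^sub>R codiff \<kappa> g D u p"
    "codiff \<kappa> g D u p = ((4 * real n + 2) / (4 * real n - 1)) *\<^sub>R X p"
proof -
  show *: "codiff \<kappa> g D u p = ((4 * real n + 2) / (4 * real n - 1)) *\<^sub>R X p"
    by (rule codiff_solution) (use assms in \<open>auto simp: section_S2E_def two_form_def S2E_equation_iff\<close>)
  show "X p = ((4 * real n - 1) / (4 * real n + 2)) *\<^sub>R codiff \<kappa> g D u p"
    unfolding * using n_real by simp
qed

text \<open>The curvature commutes with \<open>u\<close> up to the terms given by \<open>\<nabla>X\<close>; contraction makes \<open>X\<close> Killing.\<close>

lemma solution_killing:
  assumes u: "section_S2E \<kappa> g Q u" and sX: "smooth_vfield \<kappa> UNIV X" and eq: "S2E_equation \<kappa> g D Q n u X"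
  shows "g p (D X p z) w = - g p z (D X p w)"
proof -
  have X: "smooth_vf_at q X" for q using sX smooth_vfield_iff[OF open_UNIV] by blast
  have c: "smooth_vf_at p (cfield \<kappa> p w)" for w by (simp add: smooth_vf_at_cfield)
  have tf: "two_form \<kappa> u" using u unfolding section_S2E_def by blast
  note ut = two_formD[OF tf]
  have eq: "covd2 \<kappa> D u p y z w = c0 * Phi4 p (X p) y z w" for p y z w
    using eq unfolding S2E_equation_iff by blast
  interpret q: quat_curvature "g p" "onb (g p)" "triple p 1" "triple p 2" "triple p 3" "curvature \<kappa> D p"
    by (rule quat_curv)
  have comm: "D (cfield \<kappa> p a) p b = D (cfield \<kappa> p b) p a" for a b
    using cfield_commute[OF centre_in_cdom, of p a b] by (simp add: cfield_self)
  have int: "- u p (curvature \<kappa> D p y z v) w - u p v (curvature \<kappa> D p y z w) =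
      c0 * (Phi4 p (D X p y) z v w - Phi4 p (D X p z) y v w)" for y z v w
    using ricci_identity[OF ut(1) c[of v] c[of w], where x = y and y = z]
    unfolding eq ddir_cmult[OF Phi4_field(2)[OF X c c c]] Phi4_field(1)[OF X c c c]
    by (simp add: cfield_self comm[of z y] algebra_simps)
  show ?thesis
    by (rule q.integrability_killing[OF c0_nonzero ut(2,3) linear_D[OF X] int[unfolded Phi4_def]])
qed

text \<open>The projection of \<nabla>X to S2H times the dimension, written as a contraction with
  \<open>M4\<close> so that \<open>parallel_trace\<close> applies.\<close>

definition S2H_form :: "('a, 'v) vfield \<Rightarrow> ('a, 'v) tensor2" where
  "S2H_form X p v w = (\<Sum>e\<in>onb (g p). \<Sum>f\<in>onb (g p). grad_form g D X p e f * M4 p e f v w)"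

lemma S2H_form_mem:
  assumes "smooth_vfield \<kappa> UNIV X"
  shows "(\<lambda>v w. r * S2H_form X p v w) \<in> S2H (g p) (Q p)"
proof -
  have b: "bilinear (grad_form g D X p)"
    using smooth_grad_form[OF assms] unfolding smooth_tensor2_def by blast
  define a where "a i = r * (\<Sum>e\<in>onb (g p). grad_form g D X p e (triple p i e))" for i
  have "r * S2H_form X p v w = (\<Sum>i=1..3. a i * g p (triple p i v) w)" for v w
    unfolding S2H_form_def M4_def quat_space.trace_M[OF quat b] sum_1_3 a_def by (simp add: algebra_simps)
  then show ?thesis unfolding S2H_iff by blast
qed

lemma smooth_S2H_form:
  assumes sX: "smooth_vfield \<kappa> UNIV X"
  shows "smooth_tensor2 \<kappa> UNIV (S2H_form X)"
proof (rule smooth_tensor2I)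
  show "bilinear (S2H_form X q)" for q
    using S2H_trace(2)[OF S2H_form_mem[OF sX, of 1 q]] by simp
  show "smooth_fun_at q (\<lambda>r. S2H_form X r (V r) (W r))" if "smooth_vf_at q V" "smooth_vf_at q W" for q V W
    unfolding S2H_form_def
    by (rule parallel_trace(1)[OF smooth_grad_form[OF sX] open_UNIV UNIV_I parallel4_M4 that])
qed

lemma S2H_form_skew:
  assumes "smooth_vfield \<kappa> UNIV X"
  shows "S2H_form X p v w = - S2H_form X p w v"
proof -
  have "M4 p e f v w = - M4 p e f w v" for e f
    unfolding M4_def quat_space.M_def[OF quat] quat_space.G_J_swap[OF quat[of p], of v w] by simp
  then show ?thesis unfolding S2H_form_def by (simp add: sum_negf)
qed

text \<open>Differentiating the contraction leaves the second derivative of \<open>X\<close>, which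
  is a curvature term by Kostant's formula. Its contraction with \<open>M4\<close> is known from
  \<open>trace_R_M\<close>, and the two minus signs cancel.\<close>

lemma covd2_S2H_form:
  assumes sX: "smooth_vfield \<kappa> UNIV X" and kill: "\<And>q z w. g q (D X q z) w = - g q z (D X q w)"
  shows "covd2 \<kappa> D (S2H_form X) p y v w = 2 * real n * nu p * M4 p (X p) y v w"
proof -
  have c: "smooth_vf_at p (cfield \<kappa> p w)" for w by (simp add: smooth_vf_at_cfield)
  interpret q: quat_curvature "g p" "onb (g p)" "triple p 1" "triple p 2" "triple p 3" "curvature \<kappa> D p"
    by (rule quat_curv)
  note B = smooth_grad_form[OF sX]
  note pt = parallel_trace(2)[OF B open_UNIV UNIV_I parallel4_M4 c[of v] c[of w], of y, folded S2H_form_def]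
  have "covd2 \<kappa> D (S2H_form X) p y v w =
      (\<Sum>e\<in>onb (g p). \<Sum>f\<in>onb (g p). covd2 \<kappa> D (grad_form g D X) p y e f * M4 p e f v w)"
    using pt unfolding covd2_field[OF smooth_S2H_form[OF sX] c c] by (simp add: cfield_self)
  also have "\<dots> = - (\<Sum>e\<in>onb (g p). \<Sum>f\<in>onb (g p). g p (curvature \<kappa> D p (X p) y e) f * M4 p e f v w)"
    unfolding covd2_grad_form[OF sX] killing_hess[OF sX kill]
    by (simp add: bilinear_lneg[OF g_bilinear] sum_negf)
  also have "\<dots> = 2 * real n * nu p * M4 p (X p) y v w"
    unfolding M4_def q.trace_R_M nu_eq card_onb by simp
  finally show ?thesis .
qed

lemma inverse_nu: "smooth_fun_at p (\<lambda>q. inverse (nu q))" "ddir \<kappa> (\<lambda>q. inverse (nu q)) p v = 0"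
proof -
  show s: "smooth_fun_at p (\<lambda>q. inverse (nu q))"
    by (rule smooth_fun_at_inverse[OF smooth_nu nu_nonzero])
  have "ddir \<kappa> (\<lambda>q. nu q * inverse (nu q)) p v = 0"
    using nu_nonzero by (simp add: ddir_const)
  then show "ddir \<kappa> (\<lambda>q. inverse (nu q)) p v = 0"
    unfolding ddir_mult[OF smooth_nu s] ddir_nu using nu_nonzero by simp
qed

text \<open>Three constants meet: \<open>(4n+2)/(4n-1)\<close> relates the codifferential of
  \<open>u\<close> to \<open>X\<close>, \<open>1/(4n)\<close> belongs to the projection, and
  \<open>1/((2n+1) nu)\<close> to the inverse map. Their product is
  \<open>c0 / (2n nu)\<close>.\<close>

lemma ck_form_of_solution:
  assumes u: "section_S2E \<kappa> g Q u" and sX: "smooth_vfield \<kappa> UNIV X" and eq: "S2E_equation \<kappa> g D Q n u X"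
  shows "ck_form_of \<kappa> g D Q n u =
    (\<lambda>p y z. u p y z + (- c0 / (2 * real n) * inverse (nu p)) * S2H_form X p y z)"
proof (intro ext)
  fix p y z
  have X: "smooth_vf_at q X" for q using sX smooth_vfield_iff[OF open_UNIV] by blast
  let ?k = "(4 * real n + 2) / (4 * real n - 1)"
  have cod: "codiff \<kappa> g D u = (\<lambda>q. ?k *\<^sub>R X q)"
    using solution_vfield(2)[OF u eq] by auto
  have gr: "grad_form g D (codiff \<kappa> g D u) p v w = ?k * grad_form g D X p v w" for v w
    unfolding cod grad_form_def D_cmult[OF X] by (rule bilinear_lmul[OF g_bilinear, unfolded real_scaleR_def])
  have b: "bilinear (grad_form g D X p)"
    using smooth_grad_form[OF sX] unfolding smooth_tensor2_def by blast
  have bk: "bilinear (\<lambda>v w. ?k * grad_form g D X p v w)"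
    unfolding bilinear_def by (auto intro!: linearI simp: bilinear_ladd[OF b] bilinear_radd[OF b]
        bilinear_lmul[OF b] bilinear_rmul[OF b]
        distrib_left add_divide_distrib)
  have "proj_S2H (g p) (Q p) (grad_form g D (codiff \<kappa> g D u) p) y z = 1 / (4 * real n) * ?k * S2H_form X p y z"
  proof -
    have fe: "grad_form g D (codiff \<kappa> g D u) p = (\<lambda>v w. ?k * grad_form g D X p v w)"
      using gr by blast
    show ?thesis
      unfolding fe proj_S2H_M4[OF bk] S2H_form_def dim_real
      by (simp only: sum_distrib_left mult.assoc mult.left_commute[of ?k])
  qed
  moreover have "1 / ((2 * real n + 1) * nu p) * (1 / (4 * real n) * ?k * S2H_form X p y z) =
      c0 / (2 * real n) * inverse (nu p) * S2H_form X p y z"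
  proof -
    define m where "m = 2 * real n + 1"
    have m: "m \<noteq> 0" "?k = 2 * c0 * m" unfolding c0_def m_def by simp_all
    show ?thesis unfolding m(2) m_def[symmetric] using m(1) n_real nu_nonzero[of p] by (simp add: field_simps)
  qed
  ultimately show "ck_form_of \<kappa> g D Q n u p y z = u p y z + (- c0 / (2 * real n) * inverse (nu p)) * S2H_form X p y z"
    unfolding ck_form_of_def nu_reduced by simp
qed

section \<open>Compatible conformal-Killing forms and their component equations\<close>

lemma M4_skew: "M4 p b a c d = - M4 p a b c d" "M4 p a b d c = - M4 p a b c d"
  unfolding M4_def quat_space.M_def[OF quat] quat_space.G_J_swap[OF quat[of p], of a b]
    quat_space.G_J_swap[OF quat[of p], of c d] by simp_all

text \<open>The traces of \<open>Phi4\<close> and \<open>M4\<close> are \<open>-(4n+2)\<close> and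
  \<open>-3\<close>, so the factor \<open>c0\<close> makes the codifferential equal to
  \<open>X\<close>. On the right side the \<open>M4\<close> terms combine to minus a cyclic sum, a
  3-form that accounts for a third of the exterior derivative; the metric terms have zero cyclic sum
  and give the wedge product.\<close>

lemma conformal_killingI:
  assumes \<psi>: "two_form \<kappa> \<psi>"
    and eq: "\<And>p y z w. covd2 \<kappa> D \<psi> p y z w = c0 * (Phi4 p (X p) y z w - M4 p (X p) y z w)"
  shows "conformal_killing \<kappa> g D \<psi>"
  unfolding conformal_killing_def
proof (intro conjI allI \<psi>)
  fix p y z w
  interpret q: quat_space "g p" "onb (g p)" "triple p 1" "triple p 2" "triple p 3" by (rule quat)
  have "codiff \<kappa> g D \<psi> p = X p"
  proof (rule G_eqI)
    fix w
    have "g p (codiff \<kappa> g D \<psi> p) w = - (c0 * ((\<Sum>e\<in>onb (g p). Phi4 p (X p) e e w) - (\<Sum>e\<in>onb (g p). M4 p (X p) e e w)))"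
      unfolding codiff_G[OF two_formD(1)[OF \<psi>]] eq by (simp add: sum_distrib_left[symmetric] sum_subtractf)
    moreover have "(\<Sum>e\<in>onb (g p). M4 p (X p) e e w) = - 3 * g p (X p) w"
      unfolding M4_def q.M_def
      by (simp add: sum.distrib q.contract(1)[OF q.linear_GJ(1)] q.contract(1)[OF q.linear_GJ(2)]
          q.contract(1)[OF q.linear_GJ(3)] q.J_sq)
    ultimately have "g p (codiff \<kappa> g D \<psi> p) w = - (c0 * (1 - 4 * real n)) * g p (X p) w"
      unfolding Phi4_def q.trace_Phi card_onb by (simp add: algebra_simps)
    then show "g p (codiff \<kappa> g D \<psi> p) w = g p (X p) w" unfolding c0_eq by simp
  qed
  moreover have "M4 p (X p) w z y = - M4 p (X p) w y z" "M4 p (X p) z w y = - M4 p (X p) z y w"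
    "M4 p (X p) y w z = - M4 p (X p) y z w"
    by (rule M4_skew(2))+
  ultimately show "covd2 \<kappa> D \<psi> p y z w = 1 / 3 * ext_deriv \<kappa> \<psi> p y z w
      - 1 / (real DIM('v) - 1) * wedge (g p) y (codiff \<kappa> g D \<psi> p) z w"
    unfolding ext_deriv_covd2[OF \<psi>] eq Phi4_eq wedge_def dim_real c0_def[symmetric]
    using g_sym[of p z y] g_sym[of p w y] g_sym[of p w z] by (simp add: algebra_simps)
qed

text \<open>Symmetrised in \<open>y\<close> and \<open>z\<close>, the conformal-Killing equation
  loses the exterior derivative, and \<open>killing_forward\<close> separates the result into
  equations for \<open>u\<close> and \<open>h\<close>. The form \<open>h\<close> is written with a
  factor \<open>- 1\<close> to match the lemmas on sums and multiples.\<close>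

lemma ck_decomposition:
  assumes "\<psi> \<in> compatible_ck_forms \<kappa> g D Q"
  defines "u \<equiv> S2E_part g Q \<psi>"
  defines "h \<equiv> \<lambda>p v w. \<psi> p v w + - 1 * u p v w"
  shows "section_S2E \<kappa> g Q u" "smooth_tensor2 \<kappa> UNIV h" "h p \<in> S2H (g p) (Q p)"
    "covd2 \<kappa> D u p y z w = c0 * Phi4 p (codiff \<kappa> g D \<psi> p) y z w"
    "covd2 \<kappa> D h p y z w = c0 * M4 p y (codiff \<kappa> g D \<psi> p) z w"
proof -
  have tf: "two_form \<kappa> \<psi>" and ck: "covd2 \<kappa> D \<psi> p y z w = 1 / 3 * ext_deriv \<kappa> \<psi> p y z w
        - 1 / (real DIM('v) - 1) * wedge (g p) y (codiff \<kappa> g D \<psi> p) z w"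
    and comp: "\<exists>h\<in>S2H (g p) (Q p). \<exists>e\<in>S2E (g p) (Q p). \<forall>v w. \<psi> p v w = h v w + e v w" for p y z w
    using assms(1) unfolding compatible_ck_forms_def conformal_killing_def compatible_def by blast+
  note \<psi> = two_formD[OF tf]
  show us: "section_S2E \<kappa> g Q u" unfolding u_def by (rule smooth_proj_S2E[OF tf])
  then have tu: "two_form \<kappa> u" unfolding section_S2E_def by blast
  note ut = two_formD[OF tu]
  show sh: "smooth_tensor2 \<kappa> UNIV h"
    unfolding h_def by (intro smooth_tensor2_add \<psi>(1) smooth_tensor2_fmult[where f = "\<lambda>_. - 1"] smooth_fun_at_const ut(1))
  have hm: "h p \<in> S2H (g p) (Q p)" for p
  proof -
    obtain h' e where he: "h' \<in> S2H (g p) (Q p)" "e \<in> S2E (g p) (Q p)" "\<And>v w. \<psi> p v w = h' v w + e v w"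
      using comp[of p] by blast
    have "\<psi> p = (\<lambda>v w. e v w + h' v w)" using he(3) by (auto simp: fun_eq_iff)
    then have "u p = e" unfolding u_def S2E_part_def using proj_S2E_sum[OF he(2,1)] by simp
    then have "h p = h'" unfolding h_def using he(3) by (auto simp: fun_eq_iff)
    then show ?thesis using he(1) by simp
  qed
  then show "h p \<in> S2H (g p) (Q p)" .
  interpret q: quat_space "g p" "onb (g p)" "triple p 1" "triple p 2" "triple p 3" by (rule quat)
  let ?X = "codiff \<kappa> g D \<psi> p" and ?A = "covd2 \<kappa> D u p" and ?H = "covd2 \<kappa> D h p"
  let ?N = "real (card (onb (g p)))"
  have \<psi>_split: "covd2 \<kappa> D \<psi> p y z w = ?A y z w + ?H y z w" for y z w
  proof -
    have "(\<lambda>q v w. u q v w + h q v w) = \<psi>" unfolding h_def by simp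
    then show ?thesis using covd2_add[OF ut(1) sh, of p y z w] by simp
  qed
  \<comment> \<open>The coefficients of the derivative of \<open>h\<close> with respect to the
    Kaehler forms at \<open>p\<close>; by \<open>covd2_S2H\<close> they determine this
    derivative.\<close>
  define \<theta> where "\<theta> i y = 1 / (4 * real n) * (\<Sum>e\<in>onb (g p). ?H y e (triple p i e))" for i y
  have lin\<theta>: "linear (\<theta> i)" for i
  proof (rule linearI)
    note l = linear_covd2[OF sh]
    show "\<theta> i (a + b) = \<theta> i a + \<theta> i b" for a b
      unfolding \<theta>_def linear_add[OF l] sum.distrib distrib_left ..
    show "\<theta> i (r *\<^sub>R a) = r *\<^sub>R \<theta> i a" for r a
      unfolding \<theta>_def linear_scale[OF l] real_scaleR_def sum_distrib_left by (simp only: mult.left_commute)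
  qed
  have H: "?H y z w = \<theta> 1 y * g p (triple p 1 z) w + \<theta> 2 y * g p (triple p 2 z) w + \<theta> 3 y * g p (triple p 3 z) w" for y z w
  proof -
    have "4 * real n * ?H y z w = (\<Sum>e\<in>onb (g p). ?H y e (triple p 1 e)) * g p (triple p 1 z) w +
        (\<Sum>e\<in>onb (g p). ?H y e (triple p 2 e)) * g p (triple p 2 z) w +
        (\<Sum>e\<in>onb (g p). ?H y e (triple p 3 e)) * g p (triple p 3 z) w"
      using covd2_S2H[OF sh hm, of p y z w] unfolding M4_def q.trace_M[OF covd2_bilinear[OF sh]] dim_real .
    then have "?H y z w = 1 / (4 * real n) * ((\<Sum>e\<in>onb (g p). ?H y e (triple p 1 e)) * g p (triple p 1 z) w +
        (\<Sum>e\<in>onb (g p). ?H y e (triple p 2 e)) * g p (triple p 2 z) w +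
        (\<Sum>e\<in>onb (g p). ?H y e (triple p 3 e)) * g p (triple p 3 z) w)"
      using n_real by (simp add: eq_divide_eq mult.commute)
    then show ?thesis unfolding \<theta>_def by (simp add: distrib_left add_divide_distrib)
  qed
  have ext: "ext_deriv \<kappa> \<psi> p y z w + ext_deriv \<kappa> \<psi> p z y w = 0" for y z w
    unfolding ext_deriv_covd2[OF tf]
    using covd2_skew[OF tf, of p y z w] covd2_skew[OF tf, of p z w y] covd2_skew[OF tf, of p w y z] by linarith
  have star: "?A y z w + ?A z y w
      + \<theta> 1 y * g p (triple p 1 z) w + \<theta> 2 y * g p (triple p 2 z) w + \<theta> 3 y * g p (triple p 3 z) w
      + \<theta> 1 z * g p (triple p 1 y) w + \<theta> 2 z * g p (triple p 2 y) w + \<theta> 3 z * g p (triple p 3 y) w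
      = c0 * (g p ?X z * g p y w + g p ?X y * g p z w - 2 * g p ?X w * g p y z)" for y z w
  proof -
    have "covd2 \<kappa> D \<psi> p y z w + covd2 \<kappa> D \<psi> p z y w =
        1 / 3 * (ext_deriv \<kappa> \<psi> p y z w + ext_deriv \<kappa> \<psi> p z y w)
        - c0 * (wedge (g p) y ?X z w + wedge (g p) z ?X y w)"
      unfolding ck[of p y z w] ck[of p z y w] dim_real c0_def[symmetric] by (simp add: algebra_simps)
    then have "covd2 \<kappa> D \<psi> p y z w + covd2 \<kappa> D \<psi> p z y w = - c0 * (wedge (g p) y ?X z w + wedge (g p) z ?X y w)"
      unfolding ext by simp
    moreover have "wedge (g p) y ?X z w + wedge (g p) z ?X y w =
        - (g p ?X z * g p y w + g p ?X y * g p z w - 2 * g p ?X w * g p y z)"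
      unfolding wedge_def using g_sym[of p z y] by (simp add: algebra_simps)
    ultimately show ?thesis
      unfolding \<psi>_split H by (simp add: algebra_simps)
  qed
  have N8: "?N \<ge> 8" unfolding card_onb using n_real by simp
  have c: "c0 = 1 / (?N - 1)" unfolding card_onb c0_def ..
  have inv: "?A y (triple p i z) (triple p i w) = ?A y z w" if "i \<in> {1..3}" for i y z w
    by (rule covd2_S2E[OF us that])
  have i123: "(1::nat) \<in> {1..3}" "(2::nat) \<in> {1..3}" "(3::nat) \<in> {1..3}" by auto
  note kf = q.killing_forward[OF N8 c linear_covd2[OF ut(1)] linear_covd2_args[OF ut(1)] lin\<theta> lin\<theta> lin\<theta>
      covd2_skew[OF tu] inv[OF i123(1)] inv[OF i123(2)] inv[OF i123(3)] star]
  show "?A y z w = c0 * Phi4 p ?X y z w" unfolding Phi4_def by (rule kf(4))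
  show "?H y z w = c0 * M4 p y ?X z w"
    unfolding H kf(1-3) M4_def q.M_def using g_sym[of p ?X] by (simp add: algebra_simps)
qed

lemma smooth_vfield_codiff: "two_form \<kappa> \<psi> \<Longrightarrow> smooth_vfield \<kappa> UNIV (codiff \<kappa> g D \<psi>)"
  unfolding smooth_vfield_iff[OF open_UNIV] using smooth_codiff two_formD(1) by blast

lemma S2E_part_solution:
  assumes "\<psi> \<in> compatible_ck_forms \<kappa> g D Q"
  shows "S2E_part g Q \<psi> \<in> S2E_solutions \<kappa> g D Q n" "S2E_equation \<kappa> g D Q n (S2E_part g Q \<psi>) (codiff \<kappa> g D \<psi>)"
    "smooth_vfield \<kappa> UNIV (codiff \<kappa> g D \<psi>)"
proof -
  have tf: "two_form \<kappa> \<psi>" using assms unfolding compatible_ck_forms_def conformal_killing_def by blast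
  show *: "S2E_equation \<kappa> g D Q n (S2E_part g Q \<psi>) (codiff \<kappa> g D \<psi>)"
    unfolding S2E_equation_iff using ck_decomposition(4)[OF assms] by blast
  show **: "smooth_vfield \<kappa> UNIV (codiff \<kappa> g D \<psi>)" by (rule smooth_vfield_codiff[OF tf])
  show "S2E_part g Q \<psi> \<in> S2E_solutions \<kappa> g D Q n"
    unfolding S2E_solutions_def using ck_decomposition(1)[OF assms] * ** by blast
qed

text \<open>The vector field is an unknown here, in place of the codifferential, and the equation is
  linear in the pair of form and field. Linear combinations and the image of the inverse map are
  handled through this description.\<close>

lemma compatible_ck_forms_iff:
  "\<psi> \<in> compatible_ck_forms \<kappa> g D Q \<longleftrightarrow> two_form \<kappa> \<psi> \<and> compatible g Q \<psi> \<and>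
    (\<exists>X. smooth_vfield \<kappa> UNIV X \<and> (\<forall>p y z w. covd2 \<kappa> D \<psi> p y z w = c0 * (Phi4 p (X p) y z w - M4 p (X p) y z w)))"
proof
  assume a: "\<psi> \<in> compatible_ck_forms \<kappa> g D Q"
  then have tf: "two_form \<kappa> \<psi>" and co: "compatible g Q \<psi>"
    unfolding compatible_ck_forms_def conformal_killing_def by blast+
  have tu: "smooth_tensor2 \<kappa> UNIV (S2E_part g Q \<psi>)"
    using ck_decomposition(1)[OF a] unfolding section_S2E_def two_form_def by blast
  let ?h = "\<lambda>p v w. \<psi> p v w + - 1 * S2E_part g Q \<psi> p v w"
  have eq: "(\<lambda>q v w. S2E_part g Q \<psi> q v w + ?h q v w) = \<psi>" by simp
  have "covd2 \<kappa> D \<psi> p y z w = c0 * (Phi4 p (codiff \<kappa> g D \<psi> p) y z w - M4 p (codiff \<kappa> g D \<psi> p) y z w)" for p y z w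
    using covd2_add[OF tu ck_decomposition(2)[OF a], of p y z w] M4_skew(1)[of p y "codiff \<kappa> g D \<psi> p" z w]
    unfolding eq ck_decomposition(4,5)[OF a] by (simp add: algebra_simps)
  then show "two_form \<kappa> \<psi> \<and> compatible g Q \<psi> \<and>
    (\<exists>X. smooth_vfield \<kappa> UNIV X \<and> (\<forall>p y z w. covd2 \<kappa> D \<psi> p y z w = c0 * (Phi4 p (X p) y z w - M4 p (X p) y z w)))"
    using tf co S2E_part_solution(3)[OF a] by blast
next
  assume "two_form \<kappa> \<psi> \<and> compatible g Q \<psi> \<and>
    (\<exists>X. smooth_vfield \<kappa> UNIV X \<and> (\<forall>p y z w. covd2 \<kappa> D \<psi> p y z w = c0 * (Phi4 p (X p) y z w - M4 p (X p) y z w)))"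
  then show "\<psi> \<in> compatible_ck_forms \<kappa> g D Q"
    unfolding compatible_ck_forms_def using conformal_killingI by blast
qed

text \<open>The components of \<open>h\<close> at \<open>p\<close> are computed from the Ricci
  identity, once for each cyclic order of the triple. Division by \<open>nu\<close> turns them into
  the S2H part of \<nabla>X, so \<open>h\<close> is determined by \<open>u\<close>.\<close>

lemma ck_form_of_S2E_part:
  assumes a: "\<psi> \<in> compatible_ck_forms \<kappa> g D Q"
  shows "ck_form_of \<kappa> g D Q n (S2E_part g Q \<psi>) = \<psi>"
proof (intro ext)
  fix p v w
  let ?u = "S2E_part g Q \<psi>" and ?X = "codiff \<kappa> g D \<psi>"
  define h where "h = (\<lambda>p v w. \<psi> p v w + - 1 * ?u p v w)"
  note d = ck_decomposition[OF a, folded h_def]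
  note sX = S2E_part_solution(3)[OF a]
  have X: "smooth_vf_at q ?X" for q using sX smooth_vfield_iff[OF open_UNIV] by blast
  have c: "smooth_vf_at p (cfield \<kappa> p w)" for w by (simp add: smooth_vf_at_cfield)
  interpret q: quat_curvature "g p" "onb (g p)" "triple p 1" "triple p 2" "triple p 3" "curvature \<kappa> D p"
    by (rule quat_curv)
  interpret c2: quat_curvature "g p" "onb (g p)" "triple p 2" "triple p 3" "triple p 1" "curvature \<kappa> D p"
    by (rule q.quat_curvature_cyclic)
  interpret c3: quat_curvature "g p" "onb (g p)" "triple p 3" "triple p 1" "triple p 2" "curvature \<kappa> D p"
    by (rule c2.quat_curvature_cyclic)
  have comm: "D (cfield \<kappa> p a) p b = D (cfield \<kappa> p b) p a" for a b
    using cfield_commute[OF centre_in_cdom, of p a b] by (simp add: cfield_self)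
  have int: "- h p (curvature \<kappa> D p y z v) w - h p v (curvature \<kappa> D p y z w) =
      c0 * (M4 p z (D ?X p y) v w - M4 p y (D ?X p z) v w)" for y z v w
    using ricci_identity[OF d(2) c[of v] c[of w], where x = y and y = z]
    unfolding d(5) ddir_cmult[OF M4_field(1)[OF c X c c]] M4_field(2)[OF c X c c]
    by (simp add: cfield_self comm[of z y] algebra_simps)
  obtain f :: "nat \<Rightarrow> real" where f: "\<And>v w. h p v w = (\<Sum>i=1..3. f i * g p (triple p i v) w)"
    using ck_decomposition(3)[OF a, of p] unfolding S2H_iff h_def by blast
  have cM: "c2.M a b c d = M4 p a b c d" "c3.M a b c d = M4 p a b c d" "q.M a b c d = M4 p a b c d" for a b c d
    unfolding M4_def c2.M_def c3.M_def q.M_def by simp_all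
  let ?t = "\<lambda>i. \<Sum>e\<in>onb (g p). g p (D ?X p e) (triple p i e)"
  note int' = int[unfolded f sum_1_3]
  have f1: "q.nu * f 1 * q.N = - 2 * c0 * ?t 1"
  proof (rule q.integrability_S2H1[OF linear_D[OF X], where ?f2.0 = "f 2" and ?f3.0 = "f 3"], unfold cM, goal_cases)
    case (1 y z v w)
    show ?case using int'[of y z v w] by linarith
  qed
  have f2: "q.nu * f 2 * q.N = - 2 * c0 * ?t 2"
  proof (rule c2.integrability_S2H1[OF linear_D[OF X], where ?f2.0 = "f 3" and ?f3.0 = "f 1"], unfold cM, goal_cases)
    case (1 y z v w)
    show ?case using int'[of y z v w] by linarith
  qed
  have f3: "q.nu * f 3 * q.N = - 2 * c0 * ?t 3"
  proof (rule c3.integrability_S2H1[OF linear_D[OF X], where ?f2.0 = "f 1" and ?f3.0 = "f 2"], unfold cM, goal_cases)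
    case (1 y z v w)
    show ?case using int'[of y z v w] by linarith
  qed
  have fi: "f i = - c0 / (2 * real n) * inverse (nu p) * ?t i" if "i = 1 \<or> i = 2 \<or> i = 3" for i
  proof -
    have "nu p * f i * (4 * real n) = - 2 * c0 * ?t i"
      using that
    proof (elim disjE)
      assume i: "i = 1" show ?thesis using f1 unfolding i nu_eq card_onb .
    next
      assume i: "i = 2" show ?thesis using f2 unfolding i nu_eq card_onb .
    next
      assume i: "i = 3" show ?thesis using f3 unfolding i nu_eq card_onb .
    qed
    then have m: "f i * (nu p * (4 * real n)) = - 2 * c0 * ?t i" by (simp only: mult_ac)
    have nz: "nu p * (4 * real n) \<noteq> 0" using nu_nonzero[of p] n_real by simp
    have e: "- 2 * c0 * t / (nu p * (4 * real n)) = - c0 / (2 * real n) * inverse (nu p) * t" for t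
      using nu_nonzero[of p] n_real by (simp add: field_simps)
    show ?thesis unfolding eq_divide_imp[OF nz m] by (rule e)
  qed
  have b: "bilinear (grad_form g D ?X p)"
    using smooth_grad_form[OF sX] unfolding smooth_tensor2_def by blast
  have S: "S2H_form ?X p v w = ?t 1 * g p (triple p 1 v) w + ?t 2 * g p (triple p 2 v) w + ?t 3 * g p (triple p 3 v) w"
    using q.trace_M[OF b, of v w] unfolding S2H_form_def M4_def grad_form_def .
  have "h p v w = (- c0 / (2 * real n) * inverse (nu p)) * S2H_form ?X p v w"
    unfolding S f sum_1_3 fi[OF disjI1[OF refl]] fi[OF disjI2[OF disjI1[OF refl]]]
      fi[OF disjI2[OF disjI2[OF refl]]] by (simp only: distrib_left mult.assoc)
  then show "ck_form_of \<kappa> g D Q n ?u p v w = \<psi> p v w"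
    unfolding ck_form_of_solution[OF d(1) sX S2E_part_solution(2)[OF a]] h_def by simp
qed

text \<open>The vector field of a solution is Killing, so \<open>covd2_S2H_form\<close> applies, and
  the factor \<open>r\<close> may be treated as a constant because the differential of
  \<open>nu\<close> vanishes. This supplies the equation for the S2H part.\<close>

lemma ck_form_of_compatible:
  assumes us: "u \<in> S2E_solutions \<kappa> g D Q n"
  shows "ck_form_of \<kappa> g D Q n u \<in> compatible_ck_forms \<kappa> g D Q" "S2E_part g Q (ck_form_of \<kappa> g D Q n u) = u"
proof -
  obtain X where u: "section_S2E \<kappa> g Q u" and sX: "smooth_vfield \<kappa> UNIV X" and eq: "S2E_equation \<kappa> g D Q n u X"
    using us unfolding S2E_solutions_def by blast
  define r where "r p = - c0 / (2 * real n) * inverse (nu p)" for p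
  have ck: "ck_form_of \<kappa> g D Q n u = (\<lambda>p y z. u p y z + r p * S2H_form X p y z)"
    unfolding r_def by (rule ck_form_of_solution[OF u sX eq])
  have tu: "two_form \<kappa> u" and um: "u p \<in> S2E (g p) (Q p)" for p using u unfolding section_S2E_def by blast+
  note ut = two_formD[OF tu]
  have sr: "smooth_fun_at p r" for p
    unfolding r_def[abs_def] by (intro smooth_fun_at_mult smooth_fun_at_const inverse_nu)
  have dr: "ddir \<kappa> r p y = 0" for p y
    unfolding r_def[abs_def] ddir_cmult[OF inverse_nu(1)] inverse_nu(2) by simp
  note sS = smooth_S2H_form[OF sX]
  have sh: "smooth_tensor2 \<kappa> UNIV (\<lambda>p y z. r p * S2H_form X p y z)"
    by (rule smooth_tensor2_fmult[OF sr sS])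
  have kill: "g q (D X q z) w = - g q z (D X q w)" for q z w
    by (rule solution_killing[OF u sX eq])
  have mem: "(\<lambda>v w. r p * S2H_form X p v w) \<in> S2H (g p) (Q p)" for p by (rule S2H_form_mem[OF sX])
  show "S2E_part g Q (ck_form_of \<kappa> g D Q n u) = u"
    unfolding S2E_part_def ck using proj_S2E_sum[OF um mem] by simp
  have "two_form \<kappa> (ck_form_of \<kappa> g D Q n u)"
    unfolding two_form_def ck
  proof (intro conjI allI smooth_tensor2_add ut(1) sh)
    show "u p v w + r p * S2H_form X p v w = - (u p w v + r p * S2H_form X p w v)" for p v w
      using ut(3)[of p v w] S2H_form_skew[OF sX, of p v w] by simp
  qed
  moreover have "compatible g Q (ck_form_of \<kappa> g D Q n u)"
    unfolding compatible_def ck using mem um by (metis add.commute)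
  moreover have "covd2 \<kappa> D (ck_form_of \<kappa> g D Q n u) p y z w = c0 * (Phi4 p (X p) y z w - M4 p (X p) y z w)" for p y z w
  proof -
    \<comment> \<open>The constant in \<open>r\<close> turns the factor \<open>2n nu\<close> in the
      derivative of \<open>S2H_form\<close> into exactly the coefficient \<open>- c0\<close> of
      \<open>M4\<close>.\<close>
    have "r p * (2 * real n * nu p) = - c0" unfolding r_def using nu_nonzero[of p] n_real by simp
    then have "r p * (2 * real n * nu p * M4 p (X p) y z w) = - c0 * M4 p (X p) y z w"
      by (simp only: mult.assoc[symmetric])
    moreover have "covd2 \<kappa> D u p y z w = c0 * Phi4 p (X p) y z w" using eq unfolding S2E_equation_iff by blast
    ultimately show ?thesis
      unfolding ck covd2_add[OF ut(1) sh] covd2_fmult[OF sr sS] dr covd2_S2H_form[OF sX kill]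
      by (simp add: algebra_simps)
  qed
  ultimately show "ck_form_of \<kappa> g D Q n u \<in> compatible_ck_forms \<kappa> g D Q"
    unfolding compatible_ck_forms_iff using sX by blast
qed

subsection \<open>Vector space structures\<close>

lemma smooth_vfield_lincomb:
  "smooth_vfield \<kappa> UNIV X \<Longrightarrow> smooth_vfield \<kappa> UNIV Y \<Longrightarrow> smooth_vfield \<kappa> UNIV (\<lambda>p. a *\<^sub>R X p + b *\<^sub>R Y p)"
  unfolding smooth_vfield_iff[OF open_UNIV]
  by (intro ballI smooth_vf_at_add smooth_vf_at_scaleR smooth_fun_at_const) auto

lemma two_form_lincomb:
  assumes "two_form \<kappa> \<phi>" "two_form \<kappa> \<psi>"
  shows "two_form \<kappa> (\<lambda>p y z. a * \<phi> p y z + b * \<psi> p y z)"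
  unfolding two_form_def
proof (intro conjI allI)
  show "smooth_tensor2 \<kappa> UNIV (\<lambda>p y z. a * \<phi> p y z + b * \<psi> p y z)"
    using two_formD(1)[OF assms(1)] two_formD(1)[OF assms(2)]
    by (intro smooth_tensor2_add smooth_tensor2_fmult smooth_fun_at_const)
  show "a * \<phi> p v w + b * \<psi> p v w = - (a * \<phi> p w v + b * \<psi> p w v)" for p v w
    using two_formD(3)[OF assms(1), of p v w] two_formD(3)[OF assms(2), of p v w] by simp
qed

lemma covd2_lincomb:
  assumes "two_form \<kappa> \<phi>" "two_form \<kappa> \<psi>"
  shows "covd2 \<kappa> D (\<lambda>p y z. a * \<phi> p y z + b * \<psi> p y z) p y v w = a * covd2 \<kappa> D \<phi> p y v w + b * covd2 \<kappa> D \<psi> p y v w"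
  using covd2_add[OF smooth_tensor2_fmult[OF smooth_fun_at_const two_formD(1)[OF assms(1)], of a]
      smooth_tensor2_fmult[OF smooth_fun_at_const two_formD(1)[OF assms(2)], of b], of p y v w]
    covd2_fmult[OF smooth_fun_at_const two_formD(1)[OF assms(1)], where p = p and y = y and v = v and w = w]
    covd2_fmult[OF smooth_fun_at_const two_formD(1)[OF assms(2)], where p = p and y = y and v = v and w = w]
  by (simp add: ddir_const)

lemma S2H_lincomb: "h \<in> S2H (g p) (Q p) \<Longrightarrow> k \<in> S2H (g p) (Q p) \<Longrightarrow> (\<lambda>v w. a * h v w + b * k v w) \<in> S2H (g p) (Q p)"
  unfolding S2H_iff
proof (elim exE)
  fix c d :: "nat \<Rightarrow> real"
  assume "\<forall>v w. h v w = (\<Sum>i=1..3. c i * g p (triple p i v) w)" "\<forall>v w. k v w = (\<Sum>i=1..3. d i * g p (triple p i v) w)"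
  then show "\<exists>c :: nat \<Rightarrow> real. \<forall>v w. a * h v w + b * k v w = (\<Sum>i=1..3. c i * g p (triple p i v) w)"
    by (intro exI[of _ "\<lambda>i. a * c i + b * d i"])
      (simp add: sum_distrib_left sum.distrib[symmetric] distrib_right mult.assoc)
qed

lemma S2E_lincomb:
  assumes "h \<in> S2E (g p) (Q p)" "k \<in> S2E (g p) (Q p)"
  shows "(\<lambda>v w. a * h v w + b * k v w) \<in> S2E (g p) (Q p)"
  unfolding S2E_iff
proof (intro conjI allI ballI)
  note bh = S2E_D(1)[OF assms(1)] and bk = S2E_D(1)[OF assms(2)]
  show "bilinear (\<lambda>v w. a * h v w + b * k v w)"
    unfolding bilinear_def by (auto intro!: linearI simp: bilinear_ladd[OF bh] bilinear_radd[OF bh] bilinear_lmul[OF bh]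
        bilinear_rmul[OF bh] bilinear_ladd[OF bk] bilinear_radd[OF bk] bilinear_lmul[OF bk] bilinear_rmul[OF bk] algebra_simps)
  show "a * h v w + b * k v w = - (a * h w v + b * k w v)" for v w
    using S2E_D(2)[OF assms(1), of v w] S2E_D(2)[OF assms(2), of v w] by simp
qed (use S2E_D(3)[OF assms(1)] S2E_D(3)[OF assms(2)] in simp)

lemma Phi4_M4_lincomb:
  "Phi4 p (a *\<^sub>R x + b *\<^sub>R x') y z w = a * Phi4 p x y z w + b * Phi4 p x' y z w"
  "M4 p (a *\<^sub>R x + b *\<^sub>R x') y z w = a * M4 p x y z w + b * M4 p x' y z w"
proof -
  show M: "M4 p (a *\<^sub>R x + b *\<^sub>R x') y z w = a * M4 p x y z w + b * M4 p x' y z w" for y z w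
    by (simp add: linear_add[OF linear_M4(1)] linear_cmul[OF linear_M4(1)])
  show "Phi4 p (a *\<^sub>R x + b *\<^sub>R x') y z w = a * Phi4 p x y z w + b * Phi4 p x' y z w"
    unfolding Phi4_eq M bilinear_ladd[OF g_bilinear] bilinear_lmul[OF g_bilinear] by (simp add: algebra_simps)
qed

lemma tensor2_subspaceI:
  fixes V :: "('a, 'v) tensor2 set"
  assumes "V \<noteq> {}" "\<And>a b \<phi> \<psi>. \<phi> \<in> V \<Longrightarrow> \<psi> \<in> V \<Longrightarrow> (\<lambda>p y z. a * \<phi> p y z + b * \<psi> p y z) \<in> V"
  shows "tensor2_subspace V"
proof -
  obtain \<phi> where "\<phi> \<in> V" using assms(1) by blast
  then have "(\<lambda>p y z. 0) \<in> V" using assms(2)[of \<phi> \<phi> 0 0] by simp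
  then show ?thesis
    unfolding tensor2_subspace_def using assms(2)[of _ _ 1 1] assms(2)[of _ "\<lambda>p y z. 0" _ 0] by simp
qed

lemma solutions_lincomb:
  assumes "\<phi> \<in> S2E_solutions \<kappa> g D Q n" "\<psi> \<in> S2E_solutions \<kappa> g D Q n"
  shows "(\<lambda>p y z. a * \<phi> p y z + b * \<psi> p y z) \<in> S2E_solutions \<kappa> g D Q n"
proof -
  obtain X Y where s: "section_S2E \<kappa> g Q \<phi>" "section_S2E \<kappa> g Q \<psi>" and XY: "smooth_vfield \<kappa> UNIV X" "smooth_vfield \<kappa> UNIV Y"
    and eq: "\<And>p y z w. covd2 \<kappa> D \<phi> p y z w = c0 * Phi4 p (X p) y z w"
      "\<And>p y z w. covd2 \<kappa> D \<psi> p y z w = c0 * Phi4 p (Y p) y z w"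
    using assms unfolding S2E_solutions_def S2E_equation_iff by blast
  have t: "two_form \<kappa> \<phi>" "two_form \<kappa> \<psi>" using s unfolding section_S2E_def by blast+
  have "section_S2E \<kappa> g Q (\<lambda>p y z. a * \<phi> p y z + b * \<psi> p y z)"
    unfolding section_S2E_def using two_form_lincomb[OF t] S2E_lincomb s unfolding section_S2E_def by simp
  moreover have "S2E_equation \<kappa> g D Q n (\<lambda>p y z. a * \<phi> p y z + b * \<psi> p y z) (\<lambda>p. a *\<^sub>R X p + b *\<^sub>R Y p)"
    unfolding S2E_equation_iff covd2_lincomb[OF t] eq Phi4_M4_lincomb by (simp add: algebra_simps)
  ultimately show ?thesis
    unfolding S2E_solutions_def using smooth_vfield_lincomb[OF XY] by blast
qed

lemma ck_forms_lincomb: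
  assumes "\<phi> \<in> compatible_ck_forms \<kappa> g D Q" "\<psi> \<in> compatible_ck_forms \<kappa> g D Q"
  shows "(\<lambda>p y z. a * \<phi> p y z + b * \<psi> p y z) \<in> compatible_ck_forms \<kappa> g D Q"
proof -
  obtain X Y where t: "two_form \<kappa> \<phi>" "two_form \<kappa> \<psi>" and co: "compatible g Q \<phi>" "compatible g Q \<psi>"
    and XY: "smooth_vfield \<kappa> UNIV X" "smooth_vfield \<kappa> UNIV Y"
    and eq: "\<And>p y z w. covd2 \<kappa> D \<phi> p y z w = c0 * (Phi4 p (X p) y z w - M4 p (X p) y z w)"
      "\<And>p y z w. covd2 \<kappa> D \<psi> p y z w = c0 * (Phi4 p (Y p) y z w - M4 p (Y p) y z w)"
    using assms unfolding compatible_ck_forms_iff by blast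
  have "compatible g Q (\<lambda>p y z. a * \<phi> p y z + b * \<psi> p y z)"
    unfolding compatible_def
  proof
    fix p
    obtain h e k f where he: "h \<in> S2H (g p) (Q p)" "e \<in> S2E (g p) (Q p)" "\<forall>v w. \<phi> p v w = h v w + e v w"
      and kf: "k \<in> S2H (g p) (Q p)" "f \<in> S2E (g p) (Q p)" "\<forall>v w. \<psi> p v w = k v w + f v w"
      using co unfolding compatible_def by metis
    show "\<exists>h\<in>S2H (g p) (Q p). \<exists>e\<in>S2E (g p) (Q p). \<forall>v w. a * \<phi> p v w + b * \<psi> p v w = h v w + e v w"
      by (intro bexI[OF _ S2H_lincomb[OF he(1) kf(1), of a b]] bexI[OF _ S2E_lincomb[OF he(2) kf(2), of a b]])
        (simp add: he(3) kf(3) algebra_simps)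
  qed
  moreover have "covd2 \<kappa> D (\<lambda>p y z. a * \<phi> p y z + b * \<psi> p y z) p y z w =
      c0 * (Phi4 p (a *\<^sub>R X p + b *\<^sub>R Y p) y z w - M4 p (a *\<^sub>R X p + b *\<^sub>R Y p) y z w)" for p y z w
    unfolding covd2_lincomb[OF t] eq Phi4_M4_lincomb by (simp add: algebra_simps)
  ultimately show ?thesis
    unfolding compatible_ck_forms_iff using two_form_lincomb[OF t] smooth_vfield_lincomb[OF XY, of a b] by blast
qed

lemma zero_solution: "(\<lambda>p y z. 0) \<in> S2E_solutions \<kappa> g D Q n"
proof -
  have "two_form \<kappa> (\<lambda>p y z. 0)"
    unfolding two_form_def by (auto intro!: smooth_tensor2I smooth_fun_at_const simp: bilinear_def linear_zero)
  moreover have "(\<lambda>v w. 0) \<in> S2E (g p) (Q p)" for p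
    unfolding S2E_iff by (simp add: bilinear_def linear_zero)
  moreover have "covd2 \<kappa> D (\<lambda>p y z. 0) p y z w = c0 * Phi4 p 0 y z w" for p y z w
    using Phi4_M4_lincomb(1)[of p 0 0 0 0] unfolding covd2_def by (simp add: ddir_const)
  moreover have "smooth_vfield \<kappa> UNIV (\<lambda>p. 0)"
    unfolding smooth_vfield_iff[OF open_UNIV] by (simp add: smooth_vf_at_zero)
  ultimately show ?thesis
    unfolding S2E_solutions_def section_S2E_def S2E_equation_iff by blast
qed

lemma S2E_part_iso:
  "tensor2_iso (compatible_ck_forms \<kappa> g D Q) (S2E_solutions \<kappa> g D Q n) (S2E_part g Q)"
  unfolding tensor2_iso_def
proof (intro conjI ballI allI)
  show "tensor2_subspace (S2E_solutions \<kappa> g D Q n)"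
    by (rule tensor2_subspaceI) (use zero_solution solutions_lincomb in auto)
  show "tensor2_subspace (compatible_ck_forms \<kappa> g D Q)"
    \<comment> \<open>Non-emptiness is witnessed by the image of the zero solution under the inverse
      map.\<close>
    by (rule tensor2_subspaceI) (use ck_form_of_compatible(1)[OF zero_solution] ck_forms_lincomb in auto)
  show "S2E_part g Q (\<lambda>p y z. \<phi> p y z + \<psi> p y z) = (\<lambda>p y z. S2E_part g Q \<phi> p y z + S2E_part g Q \<psi> p y z)"
    for \<phi> \<psi> :: "('a, 'v) tensor2"
    unfolding S2E_part_def proj_S2E_eq by (intro ext) (simp add: sum.distrib add_divide_distrib)
  show "S2E_part g Q (\<lambda>p y z. a * \<psi> p y z) = (\<lambda>p y z. a * S2E_part g Q \<psi> p y z)" for a and \<psi> :: "('a, 'v) tensor2"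
    unfolding S2E_part_def proj_S2E_eq by (intro ext) (simp add: sum_distrib_left distrib_left)
  show "bij_betw (S2E_part g Q) (compatible_ck_forms \<kappa> g D Q) (S2E_solutions \<kappa> g D Q n)"
    by (rule bij_betwI[where g = "ck_form_of \<kappa> g D Q n"])
      (use S2E_part_solution(1) ck_form_of_compatible ck_form_of_S2E_part in auto)
qed

end

theorem proposition10:
  fixes \<kappa> :: "('a::{t2_space, second_countable_topology}, 'v::euclidean_space) atlas"
    and g :: "('a, 'v) tensor2"
    and D :: "('a, 'v) connection"
    and Q :: "'a \<Rightarrow> ('v \<Rightarrow> 'v) set"
    and n :: nat
  assumes "quaternionic_kaehler \<kappa> g D Q"
    and "connected (UNIV :: 'a set)"
    and "DIM('v) = 4 * n" and "4 * n \<ge> 8"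
    and "\<forall>p. scalar_curvature \<kappa> g D p \<noteq> 0"
  shows "tensor2_iso (compatible_ck_forms \<kappa> g D Q) (S2E_solutions \<kappa> g D Q n) (S2E_part g Q)
    \<and> (\<forall>u X. section_S2E \<kappa> g Q u \<and> smooth_vfield \<kappa> UNIV X \<and> S2E_equation \<kappa> g D Q n u X \<longrightarrow>
          X = (\<lambda>p. ((4 * real n - 1) / (4 * real n + 2)) *\<^sub>R codiff \<kappa> g D u p))
    \<and> (\<forall>u \<in> S2E_solutions \<kappa> g D Q n.
          ck_form_of \<kappa> g D Q n u \<in> compatible_ck_forms \<kappa> g D Q
          \<and> S2E_part g Q (ck_form_of \<kappa> g D Q n u) = u)
    \<and> (\<forall>\<psi> \<in> compatible_ck_forms \<kappa> g D Q. ck_form_of \<kappa> g D Q n (S2E_part g Q \<psi>) = \<psi>)"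
proof -
  have *: "smooth_atlas \<kappa>" "riemannian_metric \<kappa> g" "levi_civita \<kappa> g D"
    "\<And>p. \<exists>U J. p \<in> U \<and> admissible_basis \<kappa> g Q U J" "parallel_subbundle \<kappa> D Q"
    using assms(1) unfolding quaternionic_kaehler_def by blast+
  interpret qk_scal \<kappa> g D Q n
    by unfold_locales (use * assms in auto)
  show ?thesis
    using S2E_part_iso solution_vfield(1) ck_form_of_compatible ck_form_of_S2E_part
    by (intro conjI allI impI ballI ext) auto
qed

end
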